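(* If $S=x_1,\dots,x_s$, $s>0$, is in $\mathfrak P$ (i.e. is a principal (+)-admissible sequence on $(\Gamma,\Lambda)$), the following are equivalent. (a) There exists an indecomposable preprojective $k(\Gamma,\Lambda)$-module $M$ satisfying $S\sim S_M$. (b) The word $w(S)\in\mathcal W$ is reduced. (c) For $0<i<s$, $\sigma_{x_i}\cdots\sigma_{x_{s-1}}(e_{x_s})>0$.
   Context: $k$ is an arbitrary field and $\Gamma=(\Gamma_0,\Gamma_1)$ is a finite connected graph (multiple edges allowed) without loops and with more than one vertex. An orientation $\Lambda$ on $\Gamma$ chooses for each edge a starting point and an endpoint among its incident vertices, giving a quiver $(\Gamma,\Lambda)$; all orientations are assumed to have no oriented cycles. $\Gamma_0$ is a poset $(\Gamma_0,\Lambda)$ with $x\le y$ iff there is a path (possibly of length $0$) from $x$ to $y$. A sink is a vertex at which no arrow starts. $\sigma_x\Lambda$ is the orientation obtained by reversing all arrows incident with $x$. A finite sequence $S=x_1,\dots,x_s$ of vertices ($s\ge 0$) is (+)-admissible on $(\Gamma,\Lambda)$ if $x_1$ is a sink for $\Lambda$, $x_2$ is a sink for $\sigma_{x_1}\Lambda$, and so on; put $\Lambda^S=\sigma_{x_s}\cdots\sigma_{x_1}\Lambda$. $\mathfrak S$ is the set of (+)-admissible sequences on $(\Gamma,\Lambda)$. $\sim$ is the equivalence relation on $\mathfrak S$ generated by interchanging two consecutive terms $x_i,x_{i+1}$ that are not connected by an edge of $\Gamma$. For $S,T\in\mathfrak S$, $S\preccurlyeq T$ ($S$ is a subsequence of $T$)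 means $T\sim SU$ (concatenation) for some (+)-admissible sequence $U$ on $(\Gamma,\Lambda^S)$. $\mathrm{Supp}\,S$ is the set of vertices occurring in $S$. Canonical form: every nonempty $S\in\mathfrak S$ satisfies $S\sim S_1\cdots S_r$ where each segment $S_i$ is nonempty, consists of distinct vertices, and $\mathrm{Supp}\,S_i=\mathrm{Supp}\,S_iS_{i+1}\cdots S_r$; $r$ (the size) and the segments up to equivalence are determined by $S$. A filter of $(\Gamma_0,\Lambda)$ is an up-closed subset; the principal filter generated by $x$ is $\langle x\rangle=\{y: x\le y\}$. The hull $H_\Lambda(F)$ of a filter $F$ is the smallest filter containing $F$ and every vertex connected by an edge to a vertex in $F$. A nonempty $S\in\mathfrak S$ with canonical form $S_1\cdots S_r$ is principal if $\mathrm{Supp}\,S_i=H_\Lambda(\mathrm{Supp}\,S_{i+1})$ for $0<i<r$ and $\mathrm{Supp}\,S_r$ is a principal filter; $\mathfrak P$ is the set of principal sequences. $k(\Gamma,\Lambda)$-modules are finite-dimensional left modules over the path algebra, identified with finite-dimensional representations $(V,f)$ of $(\Gamma,\Lambda)$ over $k$. For a sink $x$ of $(\Gamma,\Lambda)$, the positive reflection functor $F_x^+$ from $k(\Gamma,\Lambda)$-modules to $k(\Gamma,\sigma_x\Lambda)$-modules sends $(V,f)$ to $(W,g)$ with $W(z)=V(z)$ for $z\ne x$ and $W(x)=\ker\big(h:\bigoplus_i V(y_i)\to V(x)\big)$, where $a_i:y_i\to x$ are all the arrows ending at $x$ and $h$ is induced by the $f_{a_i}$; $g$ agrees with $f$ on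 arrows not incident with $x$, and for the reversed arrows $x\to y_i$ the maps $W(x)\to V(y_i)$ are induced by the inclusion $W(x)\subset\bigoplus_i V(y_i)$; on morphisms $F_x^+$ is defined naturally. For $S=x_1,\dots,x_s$ in $\mathfrak S$, $F(S)=F^+_{x_s}\cdots F^+_{x_1}$ (the identity if $S=\emptyset$); $S$ annihilates $M$ if $F(S)M=0$. $M$ is preprojective if some $S\in\mathfrak S$ annihilates it. A shortest sequence annihilating $M$ is an $S\in\mathfrak S$ that annihilates $M$ while no proper subsequence of $S$ (no $S'\preccurlyeq S$ with $S'\not\sim S$) annihilates $M$; for each preprojective $M$ such a sequence exists and is unique up to $\sim$, and it is denoted $S_M$. Weyl group: $\Gamma_0=\{1,\dots,n\}$; put $a_{ii}=2$ and, for $i\ne j$, $-a_{ij}=$ the number of edges connecting $i$ and $j$. With $e_1,\dots,e_n$ the standard basis of $\mathbb Z^n$, let $\sigma_i$ be the automorphism of $\mathbb Z^n$ with $\sigma_i(e_j)=e_j-a_{ij}e_i$ for all $j$; $\mathcal W\subset GL(\mathbb Z^n)$ is the group generated by the simple reflections $\sigma_1,\dots,\sigma_n$. For $v\in\mathbb Z^n$, $v>0$ means $v\neq0$ and all coordinates of $v$ are nonnegative. The length $\ell(w)$ of $w\in\mathcal W$ is the least $l\ge0$ such that $w$ is a product of $l$ simple reflections; a word $\sigma_{y_t}\cdots\sigma_{y_1}$ is reduced if its length as an element is $t$. For $S=x_1,\dots,x_s$ in $\mathfrak S$, $w(S)=\sigma_{x_s}\cdots\sigma_{x_1}$. *)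

theory Defs
  imports "HOL-Analysis.Analysis" "HOL-Library.Function_Algebras"
begin

subsection \<open>Graphs and orientations\<close>

text \<open>A graph with vertex type \<open>'v\<close> and edge type \<open>'e\<close> sends each edge to its set of end vertices;
  an orientation sends each edge to the pair (starting point, endpoint). Distinct edges may have the
  same ends. The vertex and edge types are required to be finite wherever this matters.\<close>

type_synonym ('v, 'e) graph = "'e \<Rightarrow> 'v set"
type_synonym ('v, 'e) orientation = "'e \<Rightarrow> 'v \<times> 'v"

definition adjacent :: "('v, 'e) graph \<Rightarrow> 'v \<Rightarrow> 'v \<Rightarrow> bool" where
  "adjacent \<Gamma> x y \<longleftrightarrow> (\<exists>e. \<Gamma> e = {x, y})"

definition loopfree_graph :: "('v, 'e) graph \<Rightarrow> bool" where
  "loopfree_graph \<Gamma> \<longleftrightarrow> (\<forall>e. card (\<Gamma> e) = 2)"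

definition connected_graph :: "('v, 'e) graph \<Rightarrow> bool" where
  "connected_graph \<Gamma> \<longleftrightarrow> (\<forall>x y. (adjacent \<Gamma>)\<^sup>*\<^sup>* x y)"

definition orientation_of :: "('v, 'e) graph \<Rightarrow> ('v, 'e) orientation \<Rightarrow> bool" where
  "orientation_of \<Gamma> \<Lambda> \<longleftrightarrow> (\<forall>e. \<Gamma> e = {fst (\<Lambda> e), snd (\<Lambda> e)})"

text \<open>The set \<open>range \<Lambda>\<close> is the arrow relation of the quiver.\<close>

definition acyclic_orientation :: "('v, 'e) orientation \<Rightarrow> bool" where
  "acyclic_orientation \<Lambda> \<longleftrightarrow> acyclic (range \<Lambda>)"

definition path_le :: "('v, 'e) orientation \<Rightarrow> 'v \<Rightarrow> 'v \<Rightarrow> bool" where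
  "path_le \<Lambda> x y \<longleftrightarrow> (x, y) \<in> (range \<Lambda>)\<^sup>*"

definition sink :: "('v, 'e) orientation \<Rightarrow> 'v \<Rightarrow> bool" where
  "sink \<Lambda> x \<longleftrightarrow> (\<forall>e. fst (\<Lambda> e) \<noteq> x)"

definition reverse_at :: "'v \<Rightarrow> ('v, 'e) orientation \<Rightarrow> ('v, 'e) orientation" where
  "reverse_at x \<Lambda> =
     (\<lambda>e. if fst (\<Lambda> e) = x \<or> snd (\<Lambda> e) = x then (snd (\<Lambda> e), fst (\<Lambda> e)) else \<Lambda> e)"

subsection \<open>Admissible sequences\<close>

fun admissible :: "('v, 'e) orientation \<Rightarrow> 'v list \<Rightarrow> bool" where
  "admissible \<Lambda> [] \<longleftrightarrow> True"
| "admissible \<Lambda> (x # S) \<longleftrightarrow> sink \<Lambda> x \<and> admissible (reverse_at x \<Lambda>) S"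

definition reverse_along :: "'v list \<Rightarrow> ('v, 'e) orientation \<Rightarrow> ('v, 'e) orientation" where
  "reverse_along S \<Lambda> = fold reverse_at S \<Lambda>"

definition interchange :: "('v, 'e) graph \<Rightarrow> 'v list \<Rightarrow> 'v list \<Rightarrow> bool" where
  "interchange \<Gamma> S T \<longleftrightarrow>
     (\<exists>A x y B. S = A @ [x, y] @ B \<and> T = A @ [y, x] @ B \<and> \<not> adjacent \<Gamma> x y)"

definition seq_equiv ::
    "('v, 'e) graph \<Rightarrow> ('v, 'e) orientation \<Rightarrow> 'v list \<Rightarrow> 'v list \<Rightarrow> bool" where
  "seq_equiv \<Gamma> \<Lambda> S T \<longleftrightarrow> admissible \<Lambda> S \<and> admissible \<Lambda> T \<and>
     equivclp (\<lambda>A B. admissible \<Lambda> A \<and> admissible \<Lambda> B \<and> interchange \<Gamma> A B) S T"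

definition subsequence ::
    "('v, 'e) graph \<Rightarrow> ('v, 'e) orientation \<Rightarrow> 'v list \<Rightarrow> 'v list \<Rightarrow> bool" where
  "subsequence \<Gamma> \<Lambda> S T \<longleftrightarrow> admissible \<Lambda> S \<and> admissible \<Lambda> T \<and>
     (\<exists>U. admissible (reverse_along S \<Lambda>) U \<and> seq_equiv \<Gamma> \<Lambda> T (S @ U))"

text \<open>The support of a sequence \<open>S\<close> is \<open>set S\<close>. The list of lists below holds the segments.\<close>

definition canonical_form ::
    "('v, 'e) graph \<Rightarrow> ('v, 'e) orientation \<Rightarrow> 'v list \<Rightarrow> 'v list list \<Rightarrow> bool" where
  "canonical_form \<Gamma> \<Lambda> S Ss \<longleftrightarrow> seq_equiv \<Gamma> \<Lambda> S (concat Ss) \<and>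
     (\<forall>i < length Ss. Ss ! i \<noteq> [] \<and> distinct (Ss ! i) \<and> set (Ss ! i) = set (concat (drop i Ss)))"

definition is_filter :: "('v, 'e) orientation \<Rightarrow> 'v set \<Rightarrow> bool" where
  "is_filter \<Lambda> F \<longleftrightarrow> (\<forall>x\<in>F. \<forall>y. path_le \<Lambda> x y \<longrightarrow> y \<in> F)"

definition principal_filter :: "('v, 'e) orientation \<Rightarrow> 'v \<Rightarrow> 'v set" where
  "principal_filter \<Lambda> x = {y. path_le \<Lambda> x y}"

definition hull_filter :: "('v, 'e) graph \<Rightarrow> ('v, 'e) orientation \<Rightarrow> 'v set \<Rightarrow> 'v set" where
  "hull_filter \<Gamma> \<Lambda> F = \<Inter>{G. is_filter \<Lambda> G \<and> F \<subseteq> G \<and> (\<forall>x\<in>F. \<forall>y. adjacent \<Gamma> x y \<longrightarrow> y \<in> G)}"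

text \<open>The segments of a canonical form are unique up to equivalence, hence so are their supports,
  and it does not matter which canonical form is used.\<close>

definition principal_seq :: "('v, 'e) graph \<Rightarrow> ('v, 'e) orientation \<Rightarrow> 'v list \<Rightarrow> bool" where
  "principal_seq \<Gamma> \<Lambda> S \<longleftrightarrow> S \<noteq> [] \<and> admissible \<Lambda> S \<and>
     (\<exists>Ss. canonical_form \<Gamma> \<Lambda> S Ss \<and>
        (\<forall>i. Suc i < length Ss \<longrightarrow> set (Ss ! i) = hull_filter \<Gamma> \<Lambda> (set (Ss ! Suc i))) \<and>
        (\<exists>x. set (last Ss) = principal_filter \<Lambda> x))"

subsection \<open>Representations\<close>

text \<open>The vector spaces of a representation are finite-dimensional subspaces of the one
  \<open>'k\<close>-vector space of all functions \<open>'e list \<Rightarrow> 'k\<close>. As soon as there is an edge this space is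
  infinite-dimensional, so every finite-dimensional representation is isomorphic to one of this
  form. The space contains the direct sum of an \<open>'e\<close>-indexed family of copies of itself: the family
  \<open>(w\<^sub>e)\<close> is the function taking \<open>[]\<close> to \<open>0\<close> and \<open>e # l\<close> to \<open>w\<^sub>e l\<close>. This lets the reflection
  functor, which forms direct sums over arrows, be iterated without changing types.\<close>

type_synonym ('e, 'k) ambient = "'e list \<Rightarrow> 'k"

definition ascale :: "'k::field \<Rightarrow> ('e, 'k) ambient \<Rightarrow> ('e, 'k) ambient" where
  "ascale c u = (\<lambda>l. c * u l)"

global_interpretation amb: vector_space "ascale :: 'k::field \<Rightarrow> ('e, 'k) ambient \<Rightarrow> _"
  by unfold_locales (auto simp: ascale_def fun_eq_iff algebra_simps)

definition component :: "'e \<Rightarrow> ('e, 'k) ambient \<Rightarrow> ('e, 'k) ambient" where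
  "component e w = (\<lambda>l. w (e # l))"

definition linear_map_between ::
    "('e, 'k::field) ambient set \<Rightarrow> ('e, 'k) ambient set \<Rightarrow>
     (('e, 'k) ambient \<Rightarrow> ('e, 'k) ambient) \<Rightarrow> bool" where
  "linear_map_between V W f \<longleftrightarrow> (\<forall>u\<in>V. f u \<in> W) \<and>
     (\<forall>u\<in>V. \<forall>v\<in>V. f (u + v) = f u + f v) \<and> (\<forall>c. \<forall>u\<in>V. f (ascale c u) = ascale c (f u))"

text \<open>\<open>space_at M x\<close> is \<open>V(x)\<close>. Only the values of \<open>map_at M e\<close> on \<open>V\<close> of the starting point of \<open>e\<close>
  matter.\<close>

record ('v, 'e, 'k) representation =
  space_at :: "'v \<Rightarrow> ('e, 'k) ambient set"
  map_at :: "'e \<Rightarrow> ('e, 'k) ambient \<Rightarrow> ('e, 'k) ambient"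

definition is_rep :: "('v, 'e) orientation \<Rightarrow> ('v, 'e, 'k::field) representation \<Rightarrow> bool" where
  "is_rep \<Lambda> M \<longleftrightarrow>
     (\<forall>x. amb.subspace (space_at M x) \<and> (\<exists>B. finite B \<and> space_at M x \<subseteq> amb.span B)) \<and>
     (\<forall>e. linear_map_between (space_at M (fst (\<Lambda> e))) (space_at M (snd (\<Lambda> e))) (map_at M e))"

definition zero_rep :: "('v, 'e, 'k::field) representation \<Rightarrow> bool" where
  "zero_rep M \<longleftrightarrow> (\<forall>x. space_at M x = {0})"

definition subrep ::
    "('v, 'e) orientation \<Rightarrow> ('v \<Rightarrow> ('e, 'k) ambient set) \<Rightarrow>
     ('v, 'e, 'k::field) representation \<Rightarrow> bool" where
  "subrep \<Lambda> A M \<longleftrightarrow> (\<forall>x. amb.subspace (A x) \<and> A x \<subseteq> space_at M x) \<and>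
     (\<forall>e. map_at M e ` A (fst (\<Lambda> e)) \<subseteq> A (snd (\<Lambda> e)))"

definition internal_direct_sum ::
    "('v \<Rightarrow> ('e, 'k) ambient set) \<Rightarrow> ('v \<Rightarrow> ('e, 'k) ambient set) \<Rightarrow>
     ('v, 'e, 'k::field) representation \<Rightarrow> bool" where
  "internal_direct_sum A B M \<longleftrightarrow>
     (\<forall>x. A x \<inter> B x = {0} \<and> space_at M x = {a + b | a b. a \<in> A x \<and> b \<in> B x})"

definition indecomposable ::
    "('v, 'e) orientation \<Rightarrow> ('v, 'e, 'k::field) representation \<Rightarrow> bool" where
  "indecomposable \<Lambda> M \<longleftrightarrow> is_rep \<Lambda> M \<and> \<not> zero_rep M \<and>
     (\<forall>A B. subrep \<Lambda> A M \<and> subrep \<Lambda> B M \<and> internal_direct_sum A B M \<longrightarrow>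
        (\<forall>x. A x = {0}) \<or> (\<forall>x. B x = {0}))"

subsection \<open>Reflection functors\<close>

text \<open>The value at a sink \<open>x\<close> of the positive reflection functor on objects. The new space at \<open>x\<close> is the kernel
  of the map from the direct sum, over the arrows ending at \<open>x\<close>, of the spaces at their starting
  points; the map along a reversed arrow is the corresponding projection of the direct sum.\<close>

definition reflection_kernel ::
    "('v, 'e::finite) orientation \<Rightarrow> 'v \<Rightarrow> ('v, 'e, 'k::field) representation \<Rightarrow>
     ('e, 'k) ambient set" where
  "reflection_kernel \<Lambda> x M =
     {w. w [] = 0 \<and>
         (\<forall>e. component e w \<in> (if snd (\<Lambda> e) = x then space_at M (fst (\<Lambda> e)) else {0})) \<and>
         (\<Sum>e | snd (\<Lambda> e) = x. map_at M e (component e w)) = 0}"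

definition reflect_rep ::
    "('v, 'e::finite) orientation \<Rightarrow> 'v \<Rightarrow> ('v, 'e, 'k::field) representation \<Rightarrow>
     ('v, 'e, 'k) representation" where
  "reflect_rep \<Lambda> x M =
     \<lparr> space_at = (space_at M)(x := reflection_kernel \<Lambda> x M),
       map_at = (\<lambda>e. if snd (\<Lambda> e) = x then component e else map_at M e) \<rparr>"

fun reflect_along ::
    "('v, 'e::finite) orientation \<Rightarrow> 'v list \<Rightarrow> ('v, 'e, 'k::field) representation \<Rightarrow>
     ('v, 'e, 'k) representation" where
  "reflect_along \<Lambda> [] M = M"
| "reflect_along \<Lambda> (x # S) M = reflect_along (reverse_at x \<Lambda>) S (reflect_rep \<Lambda> x M)"

definition annihilates ::
    "('v, 'e::finite) orientation \<Rightarrow> 'v list \<Rightarrow> ('v, 'e, 'k::field) representation \<Rightarrow> bool" where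
  "annihilates \<Lambda> S M \<longleftrightarrow> zero_rep (reflect_along \<Lambda> S M)"

definition preprojective ::
    "('v, 'e::finite) orientation \<Rightarrow> ('v, 'e, 'k::field) representation \<Rightarrow> bool" where
  "preprojective \<Lambda> M \<longleftrightarrow> is_rep \<Lambda> M \<and> (\<exists>S. admissible \<Lambda> S \<and> annihilates \<Lambda> S M)"

definition shortest_annihilating ::
    "('v, 'e::finite) graph \<Rightarrow> ('v, 'e) orientation \<Rightarrow> ('v, 'e, 'k::field) representation \<Rightarrow>
     'v list \<Rightarrow> bool" where
  "shortest_annihilating \<Gamma> \<Lambda> M S \<longleftrightarrow> admissible \<Lambda> S \<and> annihilates \<Lambda> S M \<and>
     (\<forall>S'. subsequence \<Gamma> \<Lambda> S' S \<and> \<not> seq_equiv \<Gamma> \<Lambda> S' S \<longrightarrow> \<not> annihilates \<Lambda> S' M)"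

subsection \<open>The Weyl group\<close>

definition cartan :: "('v, 'e::finite) graph \<Rightarrow> 'v \<Rightarrow> 'v \<Rightarrow> int" where
  "cartan \<Gamma> i j = (if i = j then 2 else - int (card {e. \<Gamma> e = {i, j}}))"

definition simple_reflection ::
    "('v::finite, 'e::finite) graph \<Rightarrow> 'v \<Rightarrow> int ^ 'v \<Rightarrow> int ^ 'v" where
  "simple_reflection \<Gamma> i v = v - axis i (\<Sum>j\<in>UNIV. cartan \<Gamma> i j * v $ j)"

text \<open>\<open>weyl_word \<Gamma> [x\<^sub>1, \<dots>, x\<^sub>s]\<close> is the product of the simple reflections with the one at \<open>x\<^sub>1\<close>
  applied first. As simple reflections are involutions, these products form the Weyl group.\<close>

definition weyl_word :: "('v::finite, 'e::finite) graph \<Rightarrow> 'v list \<Rightarrow> int ^ 'v \<Rightarrow> int ^ 'v" where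
  "weyl_word \<Gamma> S = fold (simple_reflection \<Gamma>) S"

definition weyl_length ::
    "('v::finite, 'e::finite) graph \<Rightarrow> (int ^ 'v \<Rightarrow> int ^ 'v) \<Rightarrow> nat" where
  "weyl_length \<Gamma> w = (LEAST l. \<exists>S. length S = l \<and> weyl_word \<Gamma> S = w)"

definition reduced_word :: "('v::finite, 'e::finite) graph \<Rightarrow> 'v list \<Rightarrow> bool" where
  "reduced_word \<Gamma> S \<longleftrightarrow> weyl_length \<Gamma> (weyl_word \<Gamma> S) = length S"

subsection \<open>Consistency checks\<close>

lemma simple_reflection_axis:
  "simple_reflection \<Gamma> i (axis j 1) = axis j 1 - axis i (cartan \<Gamma> i j)"
proof -
  have "(\<Sum>m\<in>UNIV. cartan \<Gamma> i m * axis j 1 $ m) = (\<Sum>m\<in>UNIV. if m = j then cartan \<Gamma> i m else 0)"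
    by (rule sum.cong) (auto simp: axis_def)
  then show ?thesis
    by (simp add: simple_reflection_def)
qed

lemma simple_reflection_involution:
  "simple_reflection \<Gamma> i (simple_reflection \<Gamma> i v) = v"
proof -
  define s where "s = (\<Sum>j\<in>UNIV. cartan \<Gamma> i j * v $ j)"
  have "(\<Sum>j\<in>UNIV. cartan \<Gamma> i j * (v - axis i s) $ j)
      = s - (\<Sum>j\<in>UNIV. if j = i then cartan \<Gamma> i j * s else 0)"
    unfolding s_def by (subst sum_subtractf[symmetric], rule sum.cong)
      (auto simp: axis_def algebra_simps)
  also have "\<dots> = - s"
    by (simp add: cartan_def)
  finally show ?thesis
    by (simp add: simple_reflection_def s_def[symmetric] vec_eq_iff axis_def)
qed

lemma orientation_of_reverse_at:
  "orientation_of \<Gamma> \<Lambda> \<Longrightarrow> orientation_of \<Gamma> (reverse_at x \<Lambda>)"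
  unfolding orientation_of_def reverse_at_def by (auto simp: insert_commute)

lemma is_filter_hull: "is_filter \<Lambda> (hull_filter \<Gamma> \<Lambda> F)"
  unfolding hull_filter_def is_filter_def by blast

lemma component_add: "component e (u + v) = component e u + component e v"
  by (simp add: component_def fun_eq_iff)

lemma component_scale: "component e (ascale c u) = ascale c (component e u)"
  by (simp add: component_def ascale_def fun_eq_iff)

lemma component_zero: "component e (0 :: ('e, 'k::zero) ambient) = 0"
  by (simp add: component_def fun_eq_iff)

lemma linear_map_between_zero:
  assumes "linear_map_between V W f" "amb.subspace V"
  shows "f 0 = 0"
proof -
  have z: "ascale 0 (0 :: ('a, 'b) ambient) = 0" "\<And>u. ascale 0 (u :: ('a, 'b) ambient) = 0"
    by (auto simp: ascale_def fun_eq_iff)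
  have "f (ascale 0 0) = ascale 0 (f 0)"
    using assms amb.subspace_0[of V] unfolding linear_map_between_def by blast
  then show ?thesis by (simp only: z)
qed

lemma sum_apply: "(\<Sum>e\<in>A. f e) l = (\<Sum>e\<in>A. f e l)"
  by (induction A rule: infinite_finite_induct) auto

lemma finite_span_subset_sum:
  fixes V :: "'e::finite \<Rightarrow> ('e, 'k::field) ambient set"
  assumes "\<And>e. \<exists>B. finite B \<and> V e \<subseteq> amb.span B"
  shows "\<exists>B. finite B \<and> {w. w [] = 0 \<and> (\<forall>e. component e w \<in> V e)} \<subseteq> amb.span B"
proof -
  define emb :: "'e \<Rightarrow> ('e, 'k) ambient \<Rightarrow> ('e, 'k) ambient" where
    "emb e u = (\<lambda>l. case l of [] \<Rightarrow> 0 | a # l' \<Rightarrow> if a = e then u l' else 0)" for e u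
  have add: "emb e (u + v) = emb e u + emb e v" for e u v
    by (auto simp: emb_def fun_eq_iff split: list.splits)
  have sc: "emb e (ascale c u) = ascale c (emb e u)" for e c u
    by (auto simp: emb_def ascale_def fun_eq_iff split: list.splits)
  have lin: "module_hom ascale ascale (emb e)" for e
    by (intro module_hom.intro module_hom_axioms.intro add sc) unfold_locales
  obtain B where B: "\<And>e. finite (B e)" "\<And>e. V e \<subseteq> amb.span (B e)"
    using assms by metis
  have "w \<in> amb.span (\<Union>e. emb e ` B e)" if w: "w [] = 0" "\<forall>e. component e w \<in> V e" for w
  proof -
    have "w l = (\<Sum>e\<in>UNIV. emb e (component e w) l)" for l
      using w(1) by (cases l) (simp_all add: emb_def component_def)
    then have "w = (\<Sum>e\<in>UNIV. emb e (component e w))"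
      by (simp add: fun_eq_iff sum_apply)
    moreover have "emb e (component e w) \<in> amb.span (\<Union>e. emb e ` B e)" for e
    proof -
      have "emb e (component e w) \<in> emb e ` amb.span (B e)" using B(2) w(2) by blast
      also have "\<dots> = amb.span (emb e ` B e)"
        using module_hom.span_image[OF lin, of e "B e"] by simp
      also have "\<dots> \<subseteq> amb.span (\<Union>e. emb e ` B e)"
        by (rule amb.span_mono) blast
      finally show ?thesis .
    qed
    ultimately show ?thesis by (metis (no_types, lifting) amb.span_sum)
  qed
  moreover have "finite (\<Union>e. emb e ` B e)" using B(1) by simp
  ultimately show ?thesis by blast
qed

lemma is_rep_reflect_rep:
  fixes M :: "('v, 'e::finite, 'k::field) representation"
  assumes M: "is_rep \<Lambda> M" and x: "sink \<Lambda> x"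
  shows "is_rep (reverse_at x \<Lambda>) (reflect_rep \<Lambda> x M)"
proof -
  let ?K = "reflection_kernel \<Lambda> x M"
  let ?V = "\<lambda>e. if snd (\<Lambda> e) = x then space_at M (fst (\<Lambda> e)) else {0}"
  have sub: "amb.subspace (space_at M y)" and fin: "\<exists>B. finite B \<and> space_at M y \<subseteq> amb.span B" for y
    using M by (auto simp: is_rep_def)
  have lin: "linear_map_between (space_at M (fst (\<Lambda> e))) (space_at M (snd (\<Lambda> e))) (map_at M e)" for e
    using M by (auto simp: is_rep_def)
  have subV: "amb.subspace (?V e)" for e using sub by simp
  have "amb.subspace ?K"
  proof (rule amb.subspaceI)
    show "0 \<in> ?K"
      using subV linear_map_between_zero[OF lin sub]
      by (auto simp: reflection_kernel_def component_zero amb.subspace_0 sub)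
  next
    fix u v assume u: "u \<in> ?K" and v: "v \<in> ?K"
    have "(\<Sum>e | snd (\<Lambda> e) = x. map_at M e (component e (u + v)))
        = (\<Sum>e | snd (\<Lambda> e) = x. map_at M e (component e u) + map_at M e (component e v))"
    proof (rule sum.cong[OF refl])
      fix e assume "e \<in> {e. snd (\<Lambda> e) = x}"
      then have "component e u \<in> space_at M (fst (\<Lambda> e))" "component e v \<in> space_at M (fst (\<Lambda> e))"
        using u v by (auto simp: reflection_kernel_def split: if_splits)
      then show "map_at M e (component e (u + v)) = map_at M e (component e u) + map_at M e (component e v)"
        using lin[of e] by (simp add: linear_map_between_def component_add)
    qed
    also have "\<dots> = 0"
      using u v by (simp add: sum.distrib reflection_kernel_def)
    finally have "(\<Sum>e | snd (\<Lambda> e) = x. map_at M e (component e (u + v))) = 0" .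
    moreover have "component e (u + v) \<in> ?V e" for e
      unfolding component_add using u v by (intro amb.subspace_add subV) (auto simp: reflection_kernel_def)
    ultimately show "u + v \<in> ?K"
      using u v by (simp add: reflection_kernel_def)
  next
    fix c u assume u: "u \<in> ?K"
    have "(\<Sum>e | snd (\<Lambda> e) = x. map_at M e (component e (ascale c u)))
        = (\<Sum>e | snd (\<Lambda> e) = x. ascale c (map_at M e (component e u)))"
    proof (rule sum.cong[OF refl])
      fix e assume "e \<in> {e. snd (\<Lambda> e) = x}"
      then have "component e u \<in> space_at M (fst (\<Lambda> e))"
        using u by (auto simp: reflection_kernel_def split: if_splits)
      then show "map_at M e (component e (ascale c u)) = ascale c (map_at M e (component e u))"
        using lin[of e] by (simp add: linear_map_between_def component_scale)
    qed
    also have "\<dots> = ascale c (\<Sum>e | snd (\<Lambda> e) = x. map_at M e (component e u))"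
      by (simp add: amb.scale_sum_right)
    also have "\<dots> = 0" using u by (simp add: reflection_kernel_def)
    finally have "(\<Sum>e | snd (\<Lambda> e) = x. map_at M e (component e (ascale c u))) = 0" .
    moreover have "component e (ascale c u) \<in> ?V e" for e
      unfolding component_scale using u by (intro amb.subspace_scale subV) (auto simp: reflection_kernel_def)
    moreover have "ascale c u [] = 0" using u by (simp add: reflection_kernel_def ascale_def)
    ultimately show "ascale c u \<in> ?K"
      by (simp add: reflection_kernel_def)
  qed
  moreover have "\<exists>B. finite B \<and> ?K \<subseteq> amb.span B"
  proof -
    have "\<exists>B. finite B \<and> ?V e \<subseteq> amb.span B" for e
      using fin[of "fst (\<Lambda> e)"] amb.span_zero by (cases "snd (\<Lambda> e) = x") auto
    then obtain B where B: "finite B"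
        "{w. w [] = 0 \<and> (\<forall>e. component e w \<in> ?V e)} \<subseteq> amb.span B"
      using finite_span_subset_sum[of ?V] by (metis (no_types, lifting))
    have "?K \<subseteq> {w. w [] = 0 \<and> (\<forall>e. component e w \<in> ?V e)}"
      unfolding reflection_kernel_def by (intro Collect_mono impI) (elim conjE, rule conjI)
    then have "?K \<subseteq> amb.span B" using B(2) by (rule order_trans)
    with B(1) show ?thesis by (intro exI conjI)
  qed
  moreover have "linear_map_between (space_at (reflect_rep \<Lambda> x M) (fst (reverse_at x \<Lambda> e)))
      (space_at (reflect_rep \<Lambda> x M) (snd (reverse_at x \<Lambda> e))) (map_at (reflect_rep \<Lambda> x M) e)" for e
  proof (cases "snd (\<Lambda> e) = x")
    case True
    have "component e w \<in> space_at M (fst (\<Lambda> e))" if "w \<in> ?K" for w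
    proof -
      have "\<forall>e. component e w \<in> ?V e"
        using that unfolding reflection_kernel_def by (elim CollectE conjE)
      then have "component e w \<in> ?V e" ..
      then show ?thesis using True by simp
    qed
    moreover have "fst (\<Lambda> e) \<noteq> x" using x by (simp add: sink_def)
    ultimately show ?thesis
      using True
      by (simp add: reflect_rep_def reverse_at_def linear_map_between_def component_add component_scale)
  next
    case False
    moreover have "fst (\<Lambda> e) \<noteq> x" using x by (simp add: sink_def)
    ultimately show ?thesis
      using lin[of e] by (simp add: reflect_rep_def reverse_at_def)
  qed
  ultimately show ?thesis
    using sub fin by (auto simp: is_rep_def reflect_rep_def)
qed

end

theory Submission
  imports Defs
begin

text \<open>
  Write \<open>S = x\<^sub>1, \<dots>, x\<^sub>s\<close>. For \<open>i \<le> j\<close> let \<open>\<beta>(i,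
  j)\<close> be the image of \<open>e\<close> at \<open>x\<^sub>j\<close> under the product of the reflections at
  \<open>x\<^sub>i, \<dots>, x\<^sub>j\<^sub>-\<^sub>1\<close>, a root that belongs to the letter
  \<open>x\<^sub>j\<close>. Condition (c) says that the roots \<open>\<beta>(i, s)\<close> of the last letter are
  positive. The proof compares this with the positivity of all \<open>\<beta>(i, j)\<close>, and reads \<open>\<beta>(i,
  s)\<close> as a dimension vector.

  In the Weyl group the length of \<open>w\<close> grows when the reflection at \<open>s\<close> is appended on the right
  if and only if \<open>w(e\<^sub>s) > 0\<close> (\<open>root_pos_iff_length_ascends\<close>). The proof is the
  classical reduction to dihedral subgroups. Consequently every root is nonnegative or nonpositive, and a word is reduced if
  and only if all its \<open>\<beta>(i, j)\<close> are positive. So (b) implies (c).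

  In a principal sequence every letter but the last is followed by one of its neighbours in the graph
  (\<open>principal_seq_later_neighbour\<close>), and equivalent principal sequences have the same last letter. Both follow
  from counting occurrences: the ends of an edge occur alternately, and by the hull condition every vertex of a segment has a
  predecessor in it, or lies in the next support, or has a neighbour there; the only exception is the generator of the last
  support.

  The Euler form of a quiver is invariant under simultaneous reflection of vectors and orientation. If some root of a letter
  \<open>y\<close> were not positive, one of its roots would be the negative of a simple root; the Euler form of this root
  with the corresponding root of a later neighbour of \<open>y\<close> would then be positive and nonpositive at once
  (\<open>roots_nonneg_from_last\<close>). So (c) implies (b).

  The positive reflection functor at a sink \<open>x\<close> either kills an indecomposable module, which then is the
  simple module at \<open>x\<close>, or gives an indecomposable module whose dimension vector is the reflected one
  (\<open>sink_reflection_dichotomy\<close>). If \<open>S\<close> is a shortest sequence that annihilates an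
  indecomposable module, the dimension vectors along \<open>S\<close> are therefore the \<open>\<beta>(i, s)\<close>,
  and (c) holds. Conversely, if \<open>w(S)\<close> is reduced, negative reflections starting from the simple module at
  \<open>x\<^sub>s\<close> produce an indecomposable module of dimension vector \<open>\<beta>(1, s)\<close>, which
  \<open>S\<close> annihilates; that no proper subsequence does is read off from dimension vectors and reducedness
  (\<open>shortest_annihilating_if_reduced\<close>).
\<close>

section \<open>Simple reflections\<close>

text \<open>The value on \<open>v\<close> of the simple coroot at \<open>i\<close>; with it a simple reflection takes the usual form
  \<open>v - \<langle>v, i\<rangle> e\<^sub>i\<close>, and all computations with reflections become linear.\<close>

definition pairing :: "('v::finite, 'e::finite) graph \<Rightarrow> 'v \<Rightarrow> int ^ 'v \<Rightarrow> int" where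
  "pairing \<Gamma> i v = (\<Sum>j\<in>UNIV. cartan \<Gamma> i j * v $ j)"

lemma simple_reflection_pairing:
  "simple_reflection \<Gamma> i v = v - pairing \<Gamma> i v *s axis i 1"
  by (simp add: simple_reflection_def pairing_def vec_eq_iff axis_def)

lemma pairing_add: "pairing \<Gamma> i (u + v) = pairing \<Gamma> i u + pairing \<Gamma> i v"
  by (simp add: pairing_def algebra_simps sum.distrib)

lemma pairing_scale: "pairing \<Gamma> i (c *s v) = c * pairing \<Gamma> i v"
  by (simp add: pairing_def algebra_simps sum_distrib_left)

lemma pairing_diff: "pairing \<Gamma> i (u - v) = pairing \<Gamma> i u - pairing \<Gamma> i v"
  by (simp add: pairing_def algebra_simps sum_subtractf)

lemma pairing_axis: "pairing \<Gamma> i (axis j 1) = cartan \<Gamma> i j"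
proof -
  have "pairing \<Gamma> i (axis j 1) = (\<Sum>m\<in>UNIV. if m = j then cartan \<Gamma> i m else 0)"
    unfolding pairing_def by (rule sum.cong) (auto simp: axis_def)
  then show ?thesis by simp
qed

lemmas pairing_linear = pairing_add pairing_diff pairing_scale pairing_axis

lemma cartan_sym: "cartan \<Gamma> i j = cartan \<Gamma> j i"
  by (simp add: cartan_def insert_commute)

lemma cartan_refl: "cartan \<Gamma> i i = 2"
  by (simp add: cartan_def)

lemma cartan_nonpos: "i \<noteq> j \<Longrightarrow> cartan \<Gamma> i j \<le> 0"
  by (simp add: cartan_def)

abbreviation reflection_product ::
    "('v::finite, 'e::finite) graph \<Rightarrow> 'v list \<Rightarrow> int ^ 'v \<Rightarrow> int ^ 'v" where
  "reflection_product \<Gamma> xs \<equiv> foldr (simple_reflection \<Gamma>) xs"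

lemma weyl_word_eq_product: "weyl_word \<Gamma> xs = reflection_product \<Gamma> (rev xs)"
  by (simp add: weyl_word_def foldr_conv_fold)

lemma reflection_product_eq_weyl_word: "reflection_product \<Gamma> xs = weyl_word \<Gamma> (rev xs)"
  by (simp add: weyl_word_eq_product)

lemma simple_reflection_add:
  "simple_reflection \<Gamma> i (u + v) = simple_reflection \<Gamma> i u + simple_reflection \<Gamma> i v"
  by (simp add: simple_reflection_pairing pairing_linear vec_eq_iff algebra_simps)

lemma simple_reflection_scale:
  "simple_reflection \<Gamma> i (c *s v) = c *s simple_reflection \<Gamma> i v"
  by (simp add: simple_reflection_pairing pairing_linear vec_eq_iff algebra_simps)

lemma reflection_product_add:
  "reflection_product \<Gamma> xs (u + v) = reflection_product \<Gamma> xs u + reflection_product \<Gamma> xs v"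
  by (induction xs) (simp_all add: simple_reflection_add)

lemma reflection_product_scale:
  "reflection_product \<Gamma> xs (c *s v) = c *s reflection_product \<Gamma> xs v"
  by (induction xs) (simp_all add: simple_reflection_scale)

lemma simple_reflection_uminus: "simple_reflection \<Gamma> i (- v) = - simple_reflection \<Gamma> i v"
proof -
  have "- v = (- 1) *s v" by (simp add: vec_eq_iff)
  moreover have "- simple_reflection \<Gamma> i v = (- 1) *s simple_reflection \<Gamma> i v" by (simp add: vec_eq_iff)
  ultimately show ?thesis by (metis simple_reflection_scale)
qed

lemma reflection_product_uminus:
  "reflection_product \<Gamma> xs (- v) = - reflection_product \<Gamma> xs v"
  by (induction xs) (simp_all add: simple_reflection_uminus)

lemma simple_reflection_own_root: "simple_reflection \<Gamma> i (axis i 1) = - axis i 1"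
  by (simp add: simple_reflection_pairing pairing_axis cartan_refl vec_eq_iff)

lemma reflection_product_rev_inverse:
  "reflection_product \<Gamma> (rev xs) (reflection_product \<Gamma> xs v) = v"
  by (induction xs arbitrary: v) (simp_all add: simple_reflection_involution)

lemma reflection_product_inverse_rev:
  "reflection_product \<Gamma> xs (reflection_product \<Gamma> (rev xs) v) = v"
  using reflection_product_rev_inverse[of \<Gamma> "rev xs"] by simp

lemma reflection_product_nonzero:
  assumes "v \<noteq> 0" shows "reflection_product \<Gamma> xs v \<noteq> 0"
proof
  assume "reflection_product \<Gamma> xs v = 0"
  then have "v = reflection_product \<Gamma> (rev xs) 0"
    by (metis reflection_product_rev_inverse)
  also have "\<dots> = 0" using reflection_product_scale[of \<Gamma> "rev xs" 0 0] by (simp add: vec_eq_iff)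
  finally show False using assms by simp
qed

lemma axis_one_nonzero: "axis i (1::int) \<noteq> 0"
  by (simp add: vec_eq_iff axis_def)

text \<open>Products of reflections are invertible, so a root is never zero. This is why the strict order of the
  statement can be replaced by the coordinatewise \<open>\<le>\<close> throughout.\<close>

lemma pos_iff_nonneg_root:
  "0 < reflection_product \<Gamma> xs (axis i 1) \<longleftrightarrow> 0 \<le> reflection_product \<Gamma> xs (axis i 1)"
  using reflection_product_nonzero[OF axis_one_nonzero, of \<Gamma> xs i] by (auto simp: order_less_le)

section \<open>Length and the sign of roots\<close>

text \<open>The length of the element of the Weyl group given by a word, as a function of the word. Words are
  read here from left to right as compositions of maps, in the opposite order to \<open>weyl_word\<close>; the
  length does not see this, because reversing a word inverts the element.\<close>

definition product_length :: "('v::finite, 'e::finite) graph \<Rightarrow> 'v list \<Rightarrow> nat" where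
  "product_length \<Gamma> xs = weyl_length \<Gamma> (reflection_product \<Gamma> xs)"

lemma product_length_le:
  assumes "reflection_product \<Gamma> ys = reflection_product \<Gamma> xs"
  shows "product_length \<Gamma> xs \<le> length ys"
  unfolding product_length_def weyl_length_def
  by (rule Least_le) (metis assms length_rev reflection_product_eq_weyl_word)

lemma product_length_attained:
  obtains ys where "reflection_product \<Gamma> ys = reflection_product \<Gamma> xs"
    "length ys = product_length \<Gamma> xs"
proof -
  have "\<exists>l S. length S = l \<and> weyl_word \<Gamma> S = reflection_product \<Gamma> xs"
    by (metis reflection_product_eq_weyl_word)
  from LeastI_ex[OF this] obtain S where "length S = product_length \<Gamma> xs"
      "weyl_word \<Gamma> S = reflection_product \<Gamma> xs"
    unfolding product_length_def weyl_length_def by blast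
  then show thesis using that[of "rev S"] by (simp add: weyl_word_eq_product)
qed

lemma product_length_cong:
  "reflection_product \<Gamma> ys = reflection_product \<Gamma> xs \<Longrightarrow> product_length \<Gamma> ys = product_length \<Gamma> xs"
  by (simp add: product_length_def)

lemma foldr_append_fun: "foldr f (xs @ ys) = foldr f xs \<circ> foldr f ys"
  by (simp add: fun_eq_iff)

lemma product_append_cong:
  assumes "reflection_product \<Gamma> a = reflection_product \<Gamma> a'"
    and "reflection_product \<Gamma> b = reflection_product \<Gamma> b'"
  shows "reflection_product \<Gamma> (a @ b) = reflection_product \<Gamma> (a' @ b')"
  using assms by (simp only: foldr_append_fun)

lemma product_cancel_double: "reflection_product \<Gamma> (a @ [c, c] @ b) = reflection_product \<Gamma> (a @ b)"
  by (simp add: fun_eq_iff simple_reflection_involution)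

lemma product_cancel_last: "reflection_product \<Gamma> (a @ [c] @ [c]) = reflection_product \<Gamma> a"
  by (simp add: fun_eq_iff simple_reflection_involution)

lemma reflections_commute:
  assumes "cartan \<Gamma> s t = 0"
  shows "reflection_product \<Gamma> [s, t] = reflection_product \<Gamma> [t, s]"
  using assms cartan_sym[of \<Gamma> s t]
  by (simp add: fun_eq_iff simple_reflection_pairing pairing_linear vec_eq_iff)

text \<open>A single edge between \<open>s\<close> and \<open>t\<close> makes the two reflections generate the symmetric group on
  three letters. With two or more edges there is no relation.\<close>

lemma reflections_braid:
  assumes "cartan \<Gamma> s t = - 1"
  shows "reflection_product \<Gamma> [t, s, t] = reflection_product \<Gamma> [s, t, s]"
  using assms cartan_sym[of \<Gamma> s t]
  by (simp add: fun_eq_iff simple_reflection_pairing pairing_linear vec_eq_iff cartan_refl algebra_simps)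

text \<open>Built by prepending letters, so that all these words end in \<open>t\<close> and the shorter ones are suffixes
  of the longer ones.\<close>

fun alternating :: "'v \<Rightarrow> 'v \<Rightarrow> nat \<Rightarrow> 'v list" where
  "alternating s t 0 = []"
| "alternating s t (Suc n) = (if even n then t else s) # alternating s t n"

lemma length_alternating [simp]: "length (alternating s t n) = n"
  by (induction n) auto

lemma alternating_suffix:
  assumes "k \<le> n" shows "\<exists>a. alternating s t n = a @ alternating s t k"
  using assms
proof (induction n)
  case (Suc n)
  then show ?case by (cases "k = Suc n") (auto simp: le_Suc_eq)
qed simp

lemma reflection_in_plane:
  "simple_reflection \<Gamma> t (p *s axis s 1 + q *s axis t 1)
     = p *s axis s 1 + (- cartan \<Gamma> s t * p - q) *s axis t 1"
  using cartan_sym[of \<Gamma> s t]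
  by (simp add: simple_reflection_pairing pairing_linear cartan_refl vec_eq_iff algebra_simps)

text \<open>With at least two edges between \<open>s\<close> and \<open>t\<close>, each reflection replaces the smaller of the two
  coordinates by at least twice the larger one minus the smaller, so the coordinates stay nonnegative
  forever. Keeping track of which coordinate is the larger one makes the induction work.\<close>

lemma alternating_root_in_cone:
  assumes "cartan \<Gamma> s t \<le> - 2"
  shows "\<exists>p q. 0 \<le> p \<and> 0 \<le> q \<and> (if even n then q \<le> p else p \<le> q) \<and>
    reflection_product \<Gamma> (alternating s t n) (axis s 1) = p *s axis s 1 + q *s axis t 1"
proof (induction n)
  case 0
  show ?case by (rule exI[of _ 1], rule exI[of _ 0]) (simp add: vec_eq_iff)
next
  case (Suc n)
  let ?m = "- cartan \<Gamma> s t"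
  from Suc obtain p q where pq: "0 \<le> p" "0 \<le> q" "if even n then q \<le> p else p \<le> q"
    "reflection_product \<Gamma> (alternating s t n) (axis s 1) = p *s axis s 1 + q *s axis t 1" by blast
  have mult: "2 * r \<le> ?m * r" if "0 \<le> r" for r
    using assms that by (intro mult_right_mono) auto
  show ?case
  proof (cases "even n")
    case True
    then show ?thesis using pq mult[of p]
      by (intro exI[of _ p] exI[of _ "?m * p - q"]) (auto simp: reflection_in_plane)
  next
    case False
    have "simple_reflection \<Gamma> s (p *s axis s 1 + q *s axis t 1)
        = (?m * q - p) *s axis s 1 + q *s axis t 1"
      using reflection_in_plane[of \<Gamma> s q t p] cartan_sym[of \<Gamma> s t] by (simp add: add.commute)
    then show ?thesis using pq False mult[of q]
      by (intro exI[of _ "?m * q - p"] exI[of _ q]) auto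
  qed
qed

text \<open>The rank two case of the theorem that length governs the sign of roots. An element of the
  subgroup generated by \<open>s\<close> and \<open>t\<close> which does not become shorter when \<open>s\<close> is appended has a shortest
  word that alternates and ends in \<open>t\<close>. Such a word has length at most one if \<open>s\<close> and \<open>t\<close> commute and at
  most two if they satisfy the braid relation; otherwise its length is unbounded, but then the
  coordinates grow.\<close>

lemma dihedral_root_in_cone:
  assumes st: "s \<noteq> t" and u: "set u \<subseteq> {s, t}"
    and short: "\<And>u'. set u' \<subseteq> {s, t} \<Longrightarrow> reflection_product \<Gamma> u' = reflection_product \<Gamma> u \<Longrightarrow>
      length u \<le> length u'"
    and short_s: "\<And>u'. set u' \<subseteq> {s, t} \<Longrightarrow>
      reflection_product \<Gamma> u' = reflection_product \<Gamma> (u @ [s]) \<Longrightarrow> length u \<le> length u'"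
  shows "\<exists>p q. 0 \<le> p \<and> 0 \<le> q \<and>
    reflection_product \<Gamma> u (axis s 1) = p *s axis s 1 + q *s axis t 1"
proof -
  \<comment> \<open>A repeated letter cancels, and a final s could be traded for the appended one;
    either would contradict minimality.\<close>
  have "b = alternating s t (length b)" if "u = a @ b" for a b
    using that
  proof (induction b arbitrary: a)
    case (Cons c b)
    have b: "b = alternating s t (length b)" using Cons.IH[of "a @ [c]"] Cons.prems by simp
    have c: "c = s \<or> c = t" using u Cons.prems by auto
    have "c = (if even (length b) then t else s)"
    proof (cases b)
      case Nil
      have "c \<noteq> s"
      proof
        assume "c = s"
        then have "reflection_product \<Gamma> a = reflection_product \<Gamma> (u @ [s])"
          using Cons.prems Nil product_cancel_last[of \<Gamma> a s] by simp
        then have "length u \<le> length a" using short_s[of a] u Cons.prems by auto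
        then show False using Cons.prems by simp
      qed
      then show ?thesis using c Nil by auto
    next
      case (Cons d b')
      have "c \<noteq> d"
      proof
        assume "c = d"
        then have "reflection_product \<Gamma> (a @ b') = reflection_product \<Gamma> u"
          using Cons.prems Cons product_cancel_double[of \<Gamma> a c b'] by simp
        then have "length u \<le> length (a @ b')" using short[of "a @ b'"] u Cons.prems Cons by auto
        then show False using Cons.prems Cons by simp
      qed
      moreover have "d = (if even (length b') then t else s)"
        using b Cons by simp
      ultimately show ?thesis using c Cons by (auto split: if_splits)
    qed
    then show ?case using b by simp
  qed simp
  from this[of "[]" u] have alt: "u = alternating s t (length u)" by simp
  \<comment> \<open>If the alternating word of length k followed by s is a product of fewer than k letters, then u
    cannot end in it, and so is shorter.\<close>
  have cut: "length u < k" if r: "reflection_product \<Gamma> (alternating s t k @ [s]) = reflection_product \<Gamma> r"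
      "length r < k" "set r \<subseteq> {s, t}" for k r
  proof (rule ccontr)
    assume "\<not> length u < k"
    then obtain a where a: "u = a @ alternating s t k"
      using alternating_suffix[of k "length u" s t] alt by (metis not_less)
    have "reflection_product \<Gamma> (a @ r) = reflection_product \<Gamma> (u @ [s])"
      unfolding a append_assoc by (rule product_append_cong[OF refl r(1)[symmetric]])
    then have "length u \<le> length (a @ r)" using short_s[of "a @ r"] u r(3) a by auto
    then show False using a r(2) by simp
  qed
  consider "cartan \<Gamma> s t = 0" | "cartan \<Gamma> s t = - 1" | "cartan \<Gamma> s t \<le> - 2"
    using cartan_nonpos[OF st, of \<Gamma>] by linarith
  then show ?thesis
  proof cases
    case 1
    have "reflection_product \<Gamma> (alternating s t 2 @ [s]) = reflection_product \<Gamma> [t]"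
      using reflections_commute[OF 1]
      by (simp add: numeral_2_eq_2 fun_eq_iff simple_reflection_involution)
    then have "length u < 2" by (intro cut[of _ "[t]"]) auto
    then consider "u = []" | "u = [t]" using alt by (auto simp: less_2_cases_iff)
    then show ?thesis
    proof cases
      case 1
      then show ?thesis by (intro exI[of _ 1] exI[of _ 0]) (simp add: vec_eq_iff)
    next
      case 2
      then show ?thesis using reflection_in_plane[of \<Gamma> t 1 s 0] \<open>cartan \<Gamma> s t = 0\<close>
        by (intro exI[of _ 1] exI[of _ 0]) (simp add: vec_eq_iff)
    qed
  next
    case 2
    have "reflection_product \<Gamma> (alternating s t 3 @ [s]) = reflection_product \<Gamma> [s, t]"
      using reflections_braid[OF 2]
      by (simp add: numeral_3_eq_3 fun_eq_iff simple_reflection_involution)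
    then have "length u < 3" by (intro cut[of _ "[s, t]"]) auto
    then have "length u = 0 \<or> length u = 1 \<or> length u = 2" by linarith
    then consider "u = []" | "u = [t]" | "u = [s, t]" using alt
      by (auto simp: numeral_2_eq_2)
    then show ?thesis
    proof cases
      case 1
      then show ?thesis by (intro exI[of _ 1] exI[of _ 0]) (simp add: vec_eq_iff)
    next
      case 2
      then show ?thesis using reflection_in_plane[of \<Gamma> t 1 s 0] \<open>cartan \<Gamma> s t = - 1\<close>
        by (intro exI[of _ 1] exI[of _ 1]) (simp add: vec_eq_iff)
    next
      case 3
      have "simple_reflection \<Gamma> t (axis s 1) = axis s 1 + axis t 1"
        using reflection_in_plane[of \<Gamma> t 1 s 0] \<open>cartan \<Gamma> s t = - 1\<close> by simp
      moreover have "simple_reflection \<Gamma> s (axis s 1 + axis t 1) = axis t 1"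
        using reflection_in_plane[of \<Gamma> s 1 t 1] \<open>cartan \<Gamma> s t = - 1\<close> cartan_sym[of \<Gamma> s t]
        by (simp add: add.commute)
      ultimately show ?thesis using 3
        by (intro exI[of _ 0] exI[of _ 1]) simp
    qed
  next
    case 3
    show ?thesis using alternating_root_in_cone[OF 3, of "length u"] alt by metis
  qed
qed

text \<open>The fundamental theorem on lengths and roots of a Coxeter group, by induction on the length. Let
  \<open>t\<close> be the last letter of a shortest word for \<open>w\<close>; then \<open>t \<noteq> s\<close>. Write \<open>w = v u\<close> with \<open>u\<close> in the
  subgroup generated by \<open>s\<close> and \<open>t\<close>, with lengths adding up, and with \<open>v\<close> as short as possible. Then
  \<open>v\<close> does not become shorter when \<open>s\<close> or \<open>t\<close> is appended, so by induction it maps both simple roots to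
  nonnegative vectors; and by the rank two case \<open>u\<close> maps the simple root of \<open>s\<close> to a nonnegative
  combination of these two.\<close>

lemma root_nonneg_if_length_ascends:
  assumes "product_length \<Gamma> xs \<le> product_length \<Gamma> (xs @ [s])"
  shows "0 \<le> reflection_product \<Gamma> xs (axis s 1)"
  using assms
proof (induction "product_length \<Gamma> xs" arbitrary: xs s rule: less_induct)
  case less
  let ?R = "reflection_product \<Gamma>"
  obtain ys where ys: "?R ys = ?R xs" "length ys = product_length \<Gamma> xs"
    by (rule product_length_attained)
  show ?case
  proof (cases ys rule: rev_cases)
    case Nil
    then have "?R xs = id" using ys by (simp add: fun_eq_iff)
    then show ?thesis by (simp add: less_eq_vec_def axis_def)
  next
    case (snoc ys' t)
    have st: "s \<noteq> t"
    proof
      assume "s = t"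
      then have "?R ys' = ?R (xs @ [s])"
        using snoc ys(1) product_cancel_last[of \<Gamma> ys' t] product_append_cong[OF ys(1) refl, of "[s]"]
        by simp
      then have "product_length \<Gamma> (xs @ [s]) \<le> length ys'" by (rule product_length_le)
      then show False using less.prems ys(2) snoc by simp
    qed
    define good where "good v u \<longleftrightarrow> ?R (v @ u) = ?R xs \<and> set u \<subseteq> {s, t} \<and>
      length v + length u = product_length \<Gamma> xs" for v u
    have ex: "\<exists>u. good ys' u"
      using ys snoc by (intro exI[of _ "[t]"]) (simp add: good_def)
    obtain v where v: "\<exists>u. good v u" "\<And>v'. (\<exists>u. good v' u) \<Longrightarrow> length v \<le> length v'"
      using ex ex_has_least_nat[of "\<lambda>v. \<exists>u. good v u" ys' length] by blast
    then obtain u where u: "?R (v @ u) = ?R xs" "set u \<subseteq> {s, t}"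
        "length v + length u = product_length \<Gamma> xs"
      by (auto simp: good_def)
    have v_shorter: "length v < product_length \<Gamma> xs"
      using v(2)[OF ex] ys(2) snoc by simp
    have v_le: "product_length \<Gamma> v \<le> length v" by (rule product_length_le) simp
    \<comment> \<open>A shorter word for v c would allow moving c into the second factor,
      contrary to the choice of v.\<close>
    have ascend: "product_length \<Gamma> v \<le> product_length \<Gamma> (v @ [c])" if c: "c \<in> {s, t}" for c
    proof (rule ccontr)
      assume less_c: "\<not> ?thesis"
      obtain v' where v': "?R v' = ?R (v @ [c])" "length v' = product_length \<Gamma> (v @ [c])"
        by (rule product_length_attained)
      have "?R (v' @ c # u) = ?R ((v @ [c]) @ c # u)" by (rule product_append_cong[OF v'(1) refl])
      also have "\<dots> = ?R xs" using u(1) product_cancel_double[of \<Gamma> v c u] by simp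
      finally have eq: "?R (v' @ c # u) = ?R xs" .
      have shorter: "length v' < length v" using less_c v'(2) v_le by linarith
      have "product_length \<Gamma> xs \<le> length (v' @ c # u)" using eq by (rule product_length_le)
      then have "good v' (c # u)" using eq c u(2,3) shorter by (auto simp: good_def)
      then show False using v(2)[of v'] shorter by auto
    qed
    have "product_length \<Gamma> v < product_length \<Gamma> xs" using v_le v_shorter by simp
    then have pos: "0 \<le> ?R v (axis s 1)" "0 \<le> ?R v (axis t 1)"
      using less.hyps ascend by auto
    have "\<exists>p q. 0 \<le> p \<and> 0 \<le> q \<and> ?R u (axis s 1) = p *s axis s 1 + q *s axis t 1"
    proof (rule dihedral_root_in_cone[OF st u(2)])
      fix u' assume "?R u' = ?R u"
      then have "?R (v @ u') = ?R xs" using u(1) product_append_cong[OF refl] by metis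
      then have "product_length \<Gamma> xs \<le> length (v @ u')" by (rule product_length_le)
      then show "length u \<le> length u'" using u(3) by simp
    next
      fix u' assume "?R u' = ?R (u @ [s])"
      then have "?R (v @ u') = ?R (v @ u @ [s])" by (rule product_append_cong[OF refl])
      also have "\<dots> = ?R (xs @ [s])" using product_append_cong[OF u(1) refl, of "[s]"] by simp
      finally have "product_length \<Gamma> (xs @ [s]) \<le> length (v @ u')" by (rule product_length_le)
      then show "length u \<le> length u'" using u(3) less.prems by simp
    qed
    then obtain p q where pq: "0 \<le> p" "0 \<le> q" "?R u (axis s 1) = p *s axis s 1 + q *s axis t 1"
      by blast
    have "?R xs (axis s 1) = ?R v (?R u (axis s 1))" using u(1) by (metis foldr_append_fun comp_apply)
    also have "\<dots> = p *s ?R v (axis s 1) + q *s ?R v (axis t 1)"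
      by (simp add: pq(3) reflection_product_add reflection_product_scale)
    finally show ?thesis using pos pq(1,2) by (simp add: less_eq_vec_def)
  qed
qed

text \<open>The previous lemma applied to the element \<open>w s\<close>, which maps the simple root of \<open>s\<close> to the negative of its image under \<open>w\<close>.\<close>

lemma root_nonpos_if_length_descends:
  assumes "product_length \<Gamma> (xs @ [s]) \<le> product_length \<Gamma> xs"
  shows "reflection_product \<Gamma> xs (axis s 1) \<le> 0"
proof -
  have "product_length \<Gamma> ((xs @ [s]) @ [s]) = product_length \<Gamma> xs"
    by (rule product_length_cong) (use product_cancel_last[of \<Gamma> xs s] in simp)
  then have "0 \<le> reflection_product \<Gamma> (xs @ [s]) (axis s 1)"
    using assms root_nonneg_if_length_ascends[of \<Gamma> "xs @ [s]" s] by simp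
  then show ?thesis
    by (simp add: simple_reflection_own_root reflection_product_uminus less_eq_vec_def)
qed

lemma root_sign_coherent:
  "0 \<le> reflection_product \<Gamma> xs (axis s 1) \<or> reflection_product \<Gamma> xs (axis s 1) \<le> 0"
  using root_nonneg_if_length_ascends[of \<Gamma> xs s] root_nonpos_if_length_descends[of \<Gamma> xs s] by linarith

text \<open>The inequality is strict because for equal lengths of \<open>w\<close> and \<open>w s\<close> the root would be both
  nonnegative and nonpositive.\<close>

lemma root_pos_iff_length_ascends:
  "0 < reflection_product \<Gamma> xs (axis s 1) \<longleftrightarrow> product_length \<Gamma> xs < product_length \<Gamma> (xs @ [s])"
proof
  assume "0 < reflection_product \<Gamma> xs (axis s 1)"
  then show "product_length \<Gamma> xs < product_length \<Gamma> (xs @ [s])"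
    using root_nonpos_if_length_descends[of \<Gamma> xs s] by (meson not_le order_less_le_trans order_less_irrefl)
next
  assume "product_length \<Gamma> xs < product_length \<Gamma> (xs @ [s])"
  then show "0 < reflection_product \<Gamma> xs (axis s 1)"
    using root_nonneg_if_length_ascends[of \<Gamma> xs s] by (simp add: pos_iff_nonneg_root)
qed

text \<open>A simple reflection changes one coordinate only. By sign coherence all other coordinates of the
  root are then both nonnegative and nonpositive, so the root is a multiple of \<open>e\<^sub>i\<close>; it is primitive,
  being the image of a simple root under an invertible integral matrix.\<close>

lemma root_reflected_to_negative_is_simple:
  assumes pos: "0 \<le> reflection_product \<Gamma> xs (axis s 1)"
    and neg: "\<not> 0 \<le> reflection_product \<Gamma> (i # xs) (axis s 1)"
  shows "reflection_product \<Gamma> xs (axis s 1) = axis i 1"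
proof -
  let ?v = "reflection_product \<Gamma> xs (axis s 1)"
  have le0: "simple_reflection \<Gamma> i ?v \<le> 0"
    using root_sign_coherent[of \<Gamma> "i # xs" s] neg by simp
  have "?v $ k = 0" if "k \<noteq> i" for k
  proof -
    have "simple_reflection \<Gamma> i ?v $ k = ?v $ k" using that by (simp add: simple_reflection_def axis_def)
    then have "?v $ k \<le> 0" using le0 by (metis less_eq_vec_def zero_index)
    moreover have "0 \<le> ?v $ k" using pos by (simp add: less_eq_vec_def)
    ultimately show ?thesis by simp
  qed
  then have v: "?v = ?v $ i *s axis i 1" by (auto simp: vec_eq_iff axis_def)
  have "axis s 1 = reflection_product \<Gamma> (rev xs) ?v" by (simp add: reflection_product_rev_inverse)
  also have "\<dots> = ?v $ i *s reflection_product \<Gamma> (rev xs) (axis i 1)"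
    by (subst v) (simp add: reflection_product_scale)
  finally have "1 = ?v $ i * reflection_product \<Gamma> (rev xs) (axis i 1) $ s"
    by (metis axis_nth vector_smult_component)
  then have "\<bar>?v $ i\<bar> = 1" by (metis dvd_triv_left zdvd1_eq)
  moreover have "0 \<le> ?v $ i" using pos by (simp add: less_eq_vec_def)
  ultimately have "?v $ i = 1" by simp
  then show ?thesis using v by simp
qed

section \<open>Reduced words\<close>

lemma product_length_rev: "product_length \<Gamma> (rev xs) = product_length \<Gamma> xs"
proof -
  have le: "product_length \<Gamma> (rev xs) \<le> product_length \<Gamma> xs" for xs
  proof -
    obtain ys where ys: "reflection_product \<Gamma> ys = reflection_product \<Gamma> xs"
        "length ys = product_length \<Gamma> xs"
      by (rule product_length_attained)
    have "reflection_product \<Gamma> (rev ys) v = reflection_product \<Gamma> (rev xs) v" for v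
    proof -
      have "reflection_product \<Gamma> (rev ys) v
          = reflection_product \<Gamma> (rev ys) (reflection_product \<Gamma> xs (reflection_product \<Gamma> (rev xs) v))"
        by (simp add: reflection_product_inverse_rev)
      also have "\<dots> = reflection_product \<Gamma> (rev xs) v"
        by (simp add: ys(1)[symmetric] reflection_product_rev_inverse)
      finally show ?thesis .
    qed
    then have "reflection_product \<Gamma> (rev ys) = reflection_product \<Gamma> (rev xs)" by blast
    then show ?thesis using ys(2) product_length_le[of \<Gamma> "rev ys" "rev xs"] by simp
  qed
  show ?thesis using le[of xs] le[of "rev xs"] by simp
qed

lemma reduced_word_iff_product_length: "reduced_word \<Gamma> S \<longleftrightarrow> product_length \<Gamma> S = length S"
  unfolding reduced_word_def weyl_word_eq_product product_length_def[symmetric] product_length_rev ..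

lemma product_length_append_le:
  "product_length \<Gamma> (a @ b) \<le> product_length \<Gamma> a + length b"
proof -
  obtain ys where ys: "reflection_product \<Gamma> ys = reflection_product \<Gamma> a" "length ys = product_length \<Gamma> a"
    by (rule product_length_attained)
  show ?thesis
    using product_length_le[OF product_append_cong[OF ys(1) refl], of b] ys(2) by simp
qed

lemma reduced_word_rev: "reduced_word \<Gamma> (rev S) \<longleftrightarrow> reduced_word \<Gamma> S"
  by (simp add: reduced_word_iff_product_length product_length_rev)

lemma reduced_word_prefix: "reduced_word \<Gamma> (a @ b) \<Longrightarrow> reduced_word \<Gamma> a"
  using product_length_append_le[of \<Gamma> a b] product_length_le[of \<Gamma> a a]
  by (simp add: reduced_word_iff_product_length)

lemma reduced_word_suffix: "reduced_word \<Gamma> (a @ b) \<Longrightarrow> reduced_word \<Gamma> b"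
  using reduced_word_prefix[of \<Gamma> "rev b" "rev a"] reduced_word_rev[of \<Gamma> "a @ b"] reduced_word_rev[of \<Gamma> b]
  by simp

text \<open>A word is reduced exactly if the length grows with every letter. Together with sign coherence this
  expresses reducedness as positivity of roots.\<close>

lemma reduced_word_snoc:
  "reduced_word \<Gamma> (xs @ [s]) \<longleftrightarrow> reduced_word \<Gamma> xs \<and> 0 < reflection_product \<Gamma> xs (axis s 1)"
  using product_length_append_le[of \<Gamma> xs "[s]"] reduced_word_prefix[of \<Gamma> xs "[s]"]
  by (auto simp: reduced_word_iff_product_length root_pos_iff_length_ascends)

lemma reduced_word_if_roots_pos:
  assumes "\<And>A y B. S = A @ y # B \<Longrightarrow> 0 < reflection_product \<Gamma> A (axis y 1)"
  shows "reduced_word \<Gamma> S"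
  using assms
proof (induction S rule: rev_induct)
  case Nil
  have "product_length \<Gamma> [] \<le> 0" using product_length_le[of \<Gamma> "[]" "[]"] by simp
  then show ?case by (simp add: reduced_word_iff_product_length)
next
  case (snoc s xs)
  have "reduced_word \<Gamma> xs"
    by (rule snoc.IH) (use snoc.prems in auto)
  moreover have "0 < reflection_product \<Gamma> xs (axis s 1)" using snoc.prems[of xs s "[]"] by simp
  ultimately show ?case by (simp add: reduced_word_snoc)
qed

section \<open>Admissible sequences\<close>

lemma edge_ends:
  assumes "loopfree_graph \<Gamma>" "orientation_of \<Gamma> \<Lambda>"
  shows "fst (\<Lambda> e) \<noteq> snd (\<Lambda> e)"
proof
  assume eq: "fst (\<Lambda> e) = snd (\<Lambda> e)"
  have "\<Gamma> e = {fst (\<Lambda> e), snd (\<Lambda> e)}" using assms(2) by (simp add: orientation_of_def)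
  then have "card (\<Gamma> e) = 1" using eq by simp
  then show False using assms(1) by (simp add: loopfree_graph_def)
qed

lemma reverse_along_Cons [simp]: "reverse_along (x # S) \<Lambda> = reverse_along S (reverse_at x \<Lambda>)"
  by (simp add: reverse_along_def)

lemma reverse_along_Nil [simp]: "reverse_along [] \<Lambda> = \<Lambda>"
  by (simp add: reverse_along_def)

lemma reverse_along_append: "reverse_along (S @ T) \<Lambda> = reverse_along T (reverse_along S \<Lambda>)"
  by (simp add: reverse_along_def)

lemma orientation_of_reverse_along:
  "orientation_of \<Gamma> \<Lambda> \<Longrightarrow> orientation_of \<Gamma> (reverse_along S \<Lambda>)"
  by (induction S arbitrary: \<Lambda>) (auto simp: orientation_of_reverse_at)

lemma admissible_append:
  "admissible \<Lambda> (S @ T) \<longleftrightarrow> admissible \<Lambda> S \<and> admissible (reverse_along S \<Lambda>) T"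
  by (induction S arbitrary: \<Lambda>) auto

lemma neighbour_by_edge:
  assumes "orientation_of \<Gamma> \<Lambda>" "adjacent \<Gamma> x y"
  obtains e where "\<Lambda> e = (x, y)" | e where "\<Lambda> e = (y, x)"
proof -
  obtain e where "\<Gamma> e = {x, y}" using assms(2) by (auto simp: adjacent_def)
  moreover have "\<Gamma> e = {fst (\<Lambda> e), snd (\<Lambda> e)}" using assms(1) by (simp add: orientation_of_def)
  ultimately have "(fst (\<Lambda> e) = x \<and> snd (\<Lambda> e) = y) \<or> (fst (\<Lambda> e) = y \<and> snd (\<Lambda> e) = x)"
    by (metis doubleton_eq_iff)
  then show thesis using that by (metis prod.collapse)
qed

lemma adjacent_if_arrow:
  assumes "orientation_of \<Gamma> \<Lambda>" "\<Lambda> e = (x, y)"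
  shows "adjacent \<Gamma> x y" "adjacent \<Gamma> y x"
proof -
  have "\<Gamma> e = {x, y}" using assms by (simp add: orientation_of_def)
  then show "adjacent \<Gamma> x y" "adjacent \<Gamma> y x"
    by (auto simp: adjacent_def insert_commute intro!: exI[of _ e])
qed

lemma exists_neighbour:
  fixes \<Gamma> :: "('v::finite, 'e) graph"
  assumes "connected_graph \<Gamma>" "CARD('v) > 1"
  shows "\<exists>z. adjacent \<Gamma> y z"
proof -
  have "(UNIV :: 'v set) \<noteq> {y}" using assms(2) by (metis card_1_singleton_iff less_irrefl One_nat_def)
  then obtain w where "w \<noteq> y" by blast
  moreover have "(adjacent \<Gamma>)\<^sup>*\<^sup>* y w" using assms(1) by (simp add: connected_graph_def)
  ultimately show ?thesis by (metis converse_rtranclpE)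
qed

text \<open>Whenever a letter \<open>y\<close> occurs, \<open>y\<close> must be a sink, and all edges at \<open>y\<close> are turned away from it. Hence
  the two ends of an edge occur alternately, beginning with the original endpoint, and the direction
  of an edge after a sequence is determined by how often its ends have occurred.\<close>

lemma alternating_firing:
  assumes "admissible \<Lambda> T" and "\<Lambda> e = (p, y)" and "p \<noteq> y"
  shows "reverse_along T \<Lambda> e = (p, y) \<and> count_list T y = count_list T p \<or>
    reverse_along T \<Lambda> e = (y, p) \<and> count_list T y = Suc (count_list T p)"
  using assms(1)
proof (induction T rule: rev_induct)
  case Nil
  then show ?case using assms by simp
next
  case (snoc z T)
  then have "admissible \<Lambda> T" and z: "fst (reverse_along T \<Lambda> e) \<noteq> z"
    by (auto simp: admissible_append sink_def)
  have "reverse_along T \<Lambda> e = (p, y) \<and> count_list T y = count_list T p \<or>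
      reverse_along T \<Lambda> e = (y, p) \<and> count_list T y = Suc (count_list T p)"
    by (rule snoc.IH) fact
  then show ?case
  proof
    assume *: "reverse_along T \<Lambda> e = (p, y) \<and> count_list T y = count_list T p"
    then have "reverse_along (T @ [z]) \<Lambda> e = (if y = z then (y, p) else (p, y))" and "z \<noteq> p"
      using z by (simp_all add: reverse_along_append reverse_at_def)
    then show ?thesis using * by simp
  next
    assume *: "reverse_along T \<Lambda> e = (y, p) \<and> count_list T y = Suc (count_list T p)"
    then have "reverse_along (T @ [z]) \<Lambda> e = (if p = z then (p, y) else (y, p))" and "z \<noteq> y"
      using z by (simp_all add: reverse_along_append reverse_at_def)
    then show ?thesis using * by simp
  qed
qed

lemma count_le_if_admissible:
  assumes "orientation_of \<Gamma> \<Lambda>" "loopfree_graph \<Gamma>" "admissible \<Lambda> T" "\<Lambda> e = (p, y)"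
  shows "count_list T p \<le> count_list T y" "count_list T y \<le> Suc (count_list T p)"
  using alternating_firing[OF assms(3,4)] edge_ends[OF assms(2,1), of e] assms(4) by auto

text \<open>Reflections at vertices without a common edge commute, so equivalent sequences define the same
  element of the Weyl group.\<close>

lemma interchange_invariants:
  assumes "interchange \<Gamma> S T"
  shows "mset S = mset T" "weyl_word \<Gamma> S = weyl_word \<Gamma> T"
proof -
  obtain A x y B where S: "S = A @ [x, y] @ B" and T: "T = A @ [y, x] @ B" and n: "\<not> adjacent \<Gamma> x y"
    using assms by (auto simp: interchange_def)
  show "mset S = mset T" by (simp add: S T)
  show "weyl_word \<Gamma> S = weyl_word \<Gamma> T"
  proof (cases "x = y")
    case False
    then have "cartan \<Gamma> y x = 0" using n by (auto simp: cartan_def adjacent_def insert_commute)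
    then have "reflection_product \<Gamma> [y, x] = reflection_product \<Gamma> [x, y]"
      by (rule reflections_commute)
    then have "reflection_product \<Gamma> (rev B @ [y, x] @ rev A) = reflection_product \<Gamma> (rev B @ [x, y] @ rev A)"
      by (intro product_append_cong refl)
    then show ?thesis by (simp add: weyl_word_eq_product S T)
  qed (simp add: S T)
qed

lemma seq_equiv_invariants:
  assumes "seq_equiv \<Gamma> \<Lambda> S T"
  shows "mset S = mset T" "weyl_word \<Gamma> S = weyl_word \<Gamma> T"
proof -
  have "equivclp (\<lambda>A B. admissible \<Lambda> A \<and> admissible \<Lambda> B \<and> interchange \<Gamma> A B) S T"
    using assms by (simp add: seq_equiv_def)
  then have "mset S = mset T \<and> weyl_word \<Gamma> S = weyl_word \<Gamma> T"
    by (induction rule: equivclp_induct) (use interchange_invariants in metis)+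
  then show "mset S = mset T" "weyl_word \<Gamma> S = weyl_word \<Gamma> T" by auto
qed

lemma seq_equiv_sym: "seq_equiv \<Gamma> \<Lambda> S T \<Longrightarrow> seq_equiv \<Gamma> \<Lambda> T S"
  unfolding seq_equiv_def by (blast intro: equivclp_sym)

lemma seq_equiv_trans: "seq_equiv \<Gamma> \<Lambda> S T \<Longrightarrow> seq_equiv \<Gamma> \<Lambda> T U \<Longrightarrow> seq_equiv \<Gamma> \<Lambda> S U"
  unfolding seq_equiv_def by (elim conjE, intro conjI, assumption, assumption, rule equivclp_trans)

lemma seq_equiv_refl: "admissible \<Lambda> S \<Longrightarrow> seq_equiv \<Gamma> \<Lambda> S S"
  by (auto simp: seq_equiv_def)

lemma seq_equiv_length:
  fixes \<Gamma> :: "('v::finite, 'e::finite) graph"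
  shows "seq_equiv \<Gamma> \<Lambda> S T \<Longrightarrow> length S = length T"
  by (rule mset_eq_length[OF seq_equiv_invariants(1)])

lemma reduced_word_seq_equiv: "seq_equiv \<Gamma> \<Lambda> S T \<Longrightarrow> reduced_word \<Gamma> S \<longleftrightarrow> reduced_word \<Gamma> T"
  by (simp add: reduced_word_def seq_equiv_invariants(2) seq_equiv_length)

section \<open>Principal sequences\<close>

text \<open>Since the supports of the segments decrease, a vertex occurs exactly in the first few segments, once
  in each. So the number of its occurrences tells which segments contain it, and this number does not
  change when the sequence is replaced by an equivalent one.\<close>

lemma count_concat_nested:
  assumes "\<And>i. i < length Ss \<Longrightarrow> distinct (Ss ! i) \<and> set (Ss ! i) = set (concat (drop i Ss))"
  shows "j < count_list (concat Ss) z \<longleftrightarrow> j < length Ss \<and> z \<in> set (Ss ! j)"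
  using assms
proof (induction Ss arbitrary: j)
  case (Cons s Ss)
  have s: "distinct s" "set s = set (concat (s # Ss))"
    using Cons.prems[of 0] by auto
  have IH: "j < count_list (concat Ss) z \<longleftrightarrow> j < length Ss \<and> z \<in> set (Ss ! j)" for j
  proof (rule Cons.IH)
    fix i assume "i < length Ss"
    then show "distinct (Ss ! i) \<and> set (Ss ! i) = set (concat (drop i Ss))"
      using Cons.prems[of "Suc i"] by simp
  qed
  show ?case
  proof (cases "z \<in> set s")
    case True
    then have "count_list s z = 1" using s(1) by (metis count_mset distinct_count_atmost_1)
    then have "count_list (concat (s # Ss)) z = Suc (count_list (concat Ss) z)" by simp
    then show ?thesis using IH True by (cases j) auto
  next
    case False
    then have "z \<notin> set (concat (s # Ss))" using s(2) by blast
    then have "count_list (concat (s # Ss)) z = 0" by (simp add: count_list_0_iff)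
    moreover have "\<not> (j < length (s # Ss) \<and> z \<in> set ((s # Ss) ! j))"
      using \<open>z \<notin> set (concat (s # Ss))\<close> by (metis UN_I nth_mem set_concat)
    ultimately show ?thesis by simp
  qed
qed simp

text \<open>The data behind a principal sequence, made explicit: equivalent sequences can then share the same
  segments and the same generator \<open>x\<close> of the last support.\<close>

definition principal_segments where
  "principal_segments \<Gamma> \<Lambda> S Ss x \<longleftrightarrow> S \<noteq> [] \<and> canonical_form \<Gamma> \<Lambda> S Ss \<and>
     (\<forall>i. Suc i < length Ss \<longrightarrow> set (Ss ! i) = hull_filter \<Gamma> \<Lambda> (set (Ss ! Suc i))) \<and>
     set (last Ss) = principal_filter \<Lambda> x"

lemma path_last_arrow:
  assumes "path_le \<Lambda> u y" "u \<noteq> y"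
  obtains p e where "path_le \<Lambda> u p" "\<Lambda> e = (p, y)"
proof -
  obtain p where "(u, p) \<in> (range \<Lambda>)\<^sup>*" "(p, y) \<in> range \<Lambda>"
    using assms unfolding path_le_def by (blast elim: rtranclE)
  then show thesis using that unfolding path_le_def by fastforce
qed

text \<open>Suppose that no neighbour of \<open>y\<close> occurs after a certain occurrence of \<open>y\<close>, the one with number
  \<open>n + 1\<close> say. The alternation of neighbours determines all counts around \<open>y\<close>: predecessors of \<open>y\<close>
  occur \<open>n\<close> times, successors \<open>n + 1\<close> times, and this occurrence of \<open>y\<close> is the last one. So in the
  segment of index \<open>n\<close> the vertex \<open>y\<close> has no predecessor, while the next segment, if there is one,
  contains neither \<open>y\<close> nor any neighbour of \<open>y\<close>. In the latter case \<open>y\<close> could be removed from the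
  hull, which is the smallest filter of its kind. So the segment is the last one, and \<open>y\<close> is a minimal
  element of a principal filter, that is, its generator.\<close>

lemma principal_segments_no_later_neighbour:
  fixes \<Gamma> :: "('v::finite, 'e::finite) graph"
  assumes graph: "loopfree_graph \<Gamma>" "connected_graph \<Gamma>" "CARD('v) > 1" "orientation_of \<Gamma> \<Lambda>"
    and seg: "principal_segments \<Gamma> \<Lambda> S Ss x"
    and S: "S = A @ y # B" and none: "\<And>z. z \<in> set B \<Longrightarrow> \<not> adjacent \<Gamma> y z"
  shows "y = x \<and> y \<notin> set B"
proof -
  have eq: "seq_equiv \<Gamma> \<Lambda> S (concat Ss)"
    using seg by (simp add: principal_segments_def canonical_form_def)
  then have adm: "admissible \<Lambda> S" by (simp add: seq_equiv_def)
  have count: "count_list (concat Ss) z = count_list S z" for z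
    using seq_equiv_invariants(1)[OF eq] by (metis count_mset)
  have level: "j < count_list S z \<longleftrightarrow> j < length Ss \<and> z \<in> set (Ss ! j)" for j z
    unfolding count[symmetric] by (rule count_concat_nested)
      (use seg in \<open>auto simp: principal_segments_def canonical_form_def\<close>)
  have admA: "admissible \<Lambda> A" and y_sink: "sink (reverse_along A \<Lambda>) y"
    using adm by (auto simp: S admissible_append)
  define n where "n = count_list A y"
  have ins: "count_list A p = n \<and> p \<noteq> y \<and> p \<notin> set B" if e: "\<Lambda> e = (p, y)" for e p
  proof -
    have "p \<noteq> y" using edge_ends[OF graph(1,4), of e] e by simp
    moreover have "fst (reverse_along A \<Lambda> e) \<noteq> y" using y_sink by (simp add: sink_def)
    ultimately show ?thesis
      using alternating_firing[OF admA e] adjacent_if_arrow[OF graph(4) e] none by (auto simp: n_def)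
  qed
  have outs: "count_list A q = Suc n \<and> q \<noteq> y \<and> q \<notin> set B" if e: "\<Lambda> e = (y, q)" for e q
  proof -
    have "q \<noteq> y" using edge_ends[OF graph(1,4), of e] e by simp
    moreover have "fst (reverse_along A \<Lambda> e) \<noteq> y" using y_sink by (simp add: sink_def)
    ultimately show ?thesis
      using alternating_firing[OF admA e] adjacent_if_arrow[OF graph(4) e] none by (auto simp: n_def)
  qed
  have S_ins: "count_list S p = n" if "\<Lambda> e = (p, y)" for e p
    using ins[OF that] by (auto simp: S)
  have S_outs: "count_list S q = Suc n" if "\<Lambda> e = (y, q)" for e q
    using outs[OF that] by (auto simp: S)
  have "count_list S y \<le> Suc n"
  proof -
    obtain u where "adjacent \<Gamma> y u" using exists_neighbour[OF graph(2,3)] by blast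
    then show ?thesis
    proof (rule neighbour_by_edge[OF graph(4)])
      fix e assume e: "\<Lambda> e = (y, u)"
      show ?thesis using count_le_if_admissible(1)[OF graph(4,1) adm e] S_outs[OF e] by simp
    next
      fix e assume e: "\<Lambda> e = (u, y)"
      show ?thesis using count_le_if_admissible(2)[OF graph(4,1) adm e] S_ins[OF e] by simp
    qed
  qed
  then have yB: "y \<notin> set B" and S_y: "count_list S y = Suc n"
    by (auto simp: S n_def count_list_0_iff)
  have n_len: "n < length Ss" and y_n: "y \<in> set (Ss ! n)" using level[of n y] S_y by auto
  have p_n: "p \<notin> set (Ss ! n)" if "\<Lambda> e = (p, y)" for e p
    using level[of n p] S_ins[OF that] n_len by auto
  have "y = x"
  proof (rule ccontr)
    assume "y \<noteq> x"
    show False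
    proof (cases "Suc n < length Ss")
      case False
      then have "last Ss = Ss ! n" using n_len
        by (metis One_nat_def Suc_lessI diff_Suc_1 last_conv_nth length_0_conv less_nat_zero_code)
      then have filt: "set (Ss ! n) = principal_filter \<Lambda> x"
        using seg by (simp add: principal_segments_def)
      then have "path_le \<Lambda> x y" using y_n by (simp add: principal_filter_def)
      then obtain p e where "path_le \<Lambda> x p" "\<Lambda> e = (p, y)"
        using \<open>y \<noteq> x\<close> path_last_arrow[of \<Lambda> x y] by blast
      then show False using p_n filt by (auto simp: principal_filter_def)
    next
      case True
      let ?F = "set (Ss ! Suc n)"
      have hull: "set (Ss ! n) = hull_filter \<Gamma> \<Lambda> ?F"
        using seg True by (simp add: principal_segments_def)
      let ?G = "hull_filter \<Gamma> \<Lambda> ?F - {y}"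
      have notF: "z \<notin> ?F" if "count_list S z \<le> Suc n" for z
        using level[of "Suc n" z] that True by auto
      have "is_filter \<Lambda> ?G"
        unfolding is_filter_def
      proof (intro ballI allI impI)
        fix u w assume u: "u \<in> ?G" and uw: "path_le \<Lambda> u w"
        then have w: "w \<in> hull_filter \<Gamma> \<Lambda> ?F"
          using is_filter_hull[of \<Lambda> \<Gamma> ?F] by (auto simp: is_filter_def)
        have "w \<noteq> y"
        proof
          assume "w = y"
          then obtain p e where p: "path_le \<Lambda> u p" "\<Lambda> e = (p, y)"
            using u path_last_arrow[OF uw] by blast
          then have "p \<in> hull_filter \<Gamma> \<Lambda> ?F"
            using is_filter_hull[of \<Lambda> \<Gamma> ?F] u by (auto simp: is_filter_def)
          then show False using p_n[OF p(2)] hull by simp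
        qed
        then show "w \<in> ?G" using w by simp
      qed
      moreover have "?F \<subseteq> ?G"
        using notF[of y] S_y unfolding hull_filter_def by auto
      moreover have "w \<in> ?G" if "u \<in> ?F" "adjacent \<Gamma> u w" for u w
      proof -
        have "w \<noteq> y"
        proof
          assume "w = y"
          with that(2) have "adjacent \<Gamma> u y" by simp
          then show False
          proof (rule neighbour_by_edge[OF graph(4)])
            fix e assume "\<Lambda> e = (u, y)"
            then show False using S_ins notF[of u] that(1) by auto
          next
            fix e assume "\<Lambda> e = (y, u)"
            then show False using S_outs notF[of u] that(1) by auto
          qed
        qed
        then show ?thesis using that unfolding hull_filter_def by blast
      qed
      ultimately have "hull_filter \<Gamma> \<Lambda> ?F \<subseteq> ?G"
        unfolding hull_filter_def[of \<Gamma> \<Lambda> ?F] by blast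
      then show False using y_n hull by blast
    qed
  qed
  then show ?thesis using yB by simp
qed

lemma principal_segments_last:
  fixes \<Gamma> :: "('v::finite, 'e::finite) graph"
  assumes graph: "loopfree_graph \<Gamma>" "connected_graph \<Gamma>" "CARD('v) > 1" "orientation_of \<Gamma> \<Lambda>"
    and seg: "principal_segments \<Gamma> \<Lambda> S Ss x"
  shows "last S = x"
proof -
  have "S = butlast S @ [last S]" using seg by (simp add: principal_segments_def)
  then show ?thesis using principal_segments_no_later_neighbour[OF assms, of "butlast S" "last S" "[]"]
    by simp
qed

text \<open>Equivalently, in the partial order on positions generated by the order of neighbouring letters, the
  last position is the greatest element. This is how principality enters the comparison of roots.\<close>

lemma principal_segments_later_neighbour:
  fixes \<Gamma> :: "('v::finite, 'e::finite) graph"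
  assumes graph: "loopfree_graph \<Gamma>" "connected_graph \<Gamma>" "CARD('v) > 1" "orientation_of \<Gamma> \<Lambda>"
    and seg: "principal_segments \<Gamma> \<Lambda> S Ss x"
    and S: "S = A @ y # B" and B: "B \<noteq> []"
  shows "\<exists>z\<in>set B. adjacent \<Gamma> y z"
proof (rule ccontr)
  assume "\<not> ?thesis"
  then have "y = x \<and> y \<notin> set B"
    using principal_segments_no_later_neighbour[OF graph seg S] by blast
  moreover have "last B = x" using principal_segments_last[OF graph seg] S B by simp
  ultimately show False using B last_in_set by blast
qed

lemma principal_seq_segments:
  assumes "principal_seq \<Gamma> \<Lambda> S"
  obtains Ss x where "principal_segments \<Gamma> \<Lambda> S Ss x"
proof -
  obtain Ss x where "canonical_form \<Gamma> \<Lambda> S Ss"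
      "\<forall>i. Suc i < length Ss \<longrightarrow> set (Ss ! i) = hull_filter \<Gamma> \<Lambda> (set (Ss ! Suc i))"
      "set (last Ss) = principal_filter \<Lambda> x" and "S \<noteq> []"
    using assms unfolding principal_seq_def by (elim conjE exE)
  then show thesis using that[of Ss x] unfolding principal_segments_def by simp
qed

lemma principal_segments_seq_equiv:
  fixes \<Gamma> :: "('v::finite, 'e::finite) graph"
  assumes "principal_segments \<Gamma> \<Lambda> S Ss x" "seq_equiv \<Gamma> \<Lambda> S T"
  shows "principal_segments \<Gamma> \<Lambda> T Ss x"
proof -
  have "T \<noteq> []" using seq_equiv_length[OF assms(2)] assms(1) by (auto simp: principal_segments_def)
  moreover have "seq_equiv \<Gamma> \<Lambda> T (concat Ss)"
    using assms seq_equiv_sym[OF assms(2)] seq_equiv_trans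
    unfolding principal_segments_def canonical_form_def by metis
  ultimately show ?thesis
    using assms(1) unfolding principal_segments_def canonical_form_def by blast
qed

lemma principal_seq_later_neighbour:
  fixes \<Gamma> :: "('v::finite, 'e::finite) graph"
  assumes "loopfree_graph \<Gamma>" "connected_graph \<Gamma>" "CARD('v) > 1" "orientation_of \<Gamma> \<Lambda>"
    and "principal_seq \<Gamma> \<Lambda> S" and "S = A @ y # B" and "B \<noteq> []"
  shows "\<exists>z\<in>set B. adjacent \<Gamma> y z"
proof -
  obtain Ss x where "principal_segments \<Gamma> \<Lambda> S Ss x" using assms(5) by (rule principal_seq_segments)
  then show ?thesis using assms(6,7) by (rule principal_segments_later_neighbour[OF assms(1-4)])
qed

lemma principal_seq_seq_equiv:
  fixes \<Gamma> :: "('v::finite, 'e::finite) graph"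
  assumes "loopfree_graph \<Gamma>" "connected_graph \<Gamma>" "CARD('v) > 1" "orientation_of \<Gamma> \<Lambda>"
    and "principal_seq \<Gamma> \<Lambda> S" and "seq_equiv \<Gamma> \<Lambda> S T"
  shows "principal_seq \<Gamma> \<Lambda> T" "last T = last S"
proof -
  obtain Ss x where seg: "principal_segments \<Gamma> \<Lambda> S Ss x" using assms(5) by (rule principal_seq_segments)
  then have seg': "principal_segments \<Gamma> \<Lambda> T Ss x" using assms(6) by (rule principal_segments_seq_equiv)
  show "last T = last S"
    using principal_segments_last[OF assms(1-4) seg] principal_segments_last[OF assms(1-4) seg'] by simp
  show "principal_seq \<Gamma> \<Lambda> T"
    unfolding principal_seq_def
  proof (intro conjI)
    show "admissible \<Lambda> T" using assms(6) by (simp add: seq_equiv_def)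
    show "T \<noteq> []" using seg' by (simp add: principal_segments_def)
    show "\<exists>Ss. canonical_form \<Gamma> \<Lambda> T Ss \<and>
        (\<forall>i. Suc i < length Ss \<longrightarrow> set (Ss ! i) = hull_filter \<Gamma> \<Lambda> (set (Ss ! Suc i))) \<and>
        (\<exists>x. set (last Ss) = principal_filter \<Lambda> x)"
      by (rule exI[of _ Ss]) (use seg' in \<open>unfold principal_segments_def, elim conjE, intro conjI exI\<close>)
  qed
qed

section \<open>The Euler form\<close>

text \<open>The Euler form of the quiver. For modules it is the dimension of the space of homomorphisms minus
  that of the space of extensions.\<close>

definition euler_form ::
    "('v::finite, 'e::finite) orientation \<Rightarrow> int ^ 'v \<Rightarrow> int ^ 'v \<Rightarrow> int" where
  "euler_form \<Lambda> u v = (\<Sum>x\<in>UNIV. u $ x * v $ x) - (\<Sum>e\<in>UNIV. u $ fst (\<Lambda> e) * v $ snd (\<Lambda> e))"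

lemma pairing_at_sink:
  fixes \<Gamma> :: "('v::finite, 'e::finite) graph"
  assumes "loopfree_graph \<Gamma>" "orientation_of \<Gamma> \<Lambda>" "sink \<Lambda> x"
  shows "pairing \<Gamma> x v = 2 * v $ x - (\<Sum>e | snd (\<Lambda> e) = x. v $ fst (\<Lambda> e))"
proof -
  let ?E = "{e. snd (\<Lambda> e) = x}"
  have "(\<Sum>e\<in>?E. v $ fst (\<Lambda> e)) = (\<Sum>j\<in>UNIV. \<Sum>e\<in>{e\<in>?E. fst (\<Lambda> e) = j}. v $ fst (\<Lambda> e))"
    by (rule sum.group[symmetric]) auto
  also have "\<dots> = (\<Sum>j\<in>UNIV. int (card {e\<in>?E. fst (\<Lambda> e) = j}) * v $ j)"
    by (rule sum.cong) auto
  also have "\<dots> = (\<Sum>j\<in>UNIV. (if j = x then 2 * v $ x else 0) - cartan \<Gamma> x j * v $ j)"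
  proof (rule sum.cong[OF refl])
    fix j
    show "int (card {e\<in>?E. fst (\<Lambda> e) = j}) * v $ j = (if j = x then 2 * v $ x else 0) - cartan \<Gamma> x j * v $ j"
    proof (cases "j = x")
      case True
      then have "{e\<in>?E. fst (\<Lambda> e) = j} = {}" using assms(3) by (auto simp: sink_def)
      then have "card {e\<in>?E. fst (\<Lambda> e) = j} = 0" by (simp only: card.empty)
      then show ?thesis using True by (simp add: cartan_refl)
    next
      case False
      have "\<Gamma> e = {x, j} \<longleftrightarrow> snd (\<Lambda> e) = x \<and> fst (\<Lambda> e) = j" for e
      proof -
        have "\<Gamma> e = {fst (\<Lambda> e), snd (\<Lambda> e)}" "fst (\<Lambda> e) \<noteq> x"
          using assms(2,3) by (auto simp: orientation_of_def sink_def)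
        then show ?thesis by (metis doubleton_eq_iff)
      qed
      then have "{e\<in>?E. fst (\<Lambda> e) = j} = {e. \<Gamma> e = {x, j}}" by auto
      then show ?thesis using False by (simp add: cartan_def)
    qed
  qed
  also have "\<dots> = 2 * v $ x - pairing \<Gamma> x v"
    by (simp add: sum_subtractf pairing_def)
  finally show ?thesis by simp
qed

text \<open>The new coordinate at the sink is the dimension that the kernel has when the map from the direct sum
  is surjective.\<close>

lemma reflection_at_sink:
  fixes \<Gamma> :: "('v::finite, 'e::finite) graph"
  assumes "loopfree_graph \<Gamma>" "orientation_of \<Gamma> \<Lambda>" "sink \<Lambda> x"
  shows "simple_reflection \<Gamma> x v $ z =
    (if z = x then (\<Sum>e | snd (\<Lambda> e) = x. v $ fst (\<Lambda> e)) - v $ x else v $ z)"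
  using pairing_at_sink[OF assms, of v] by (simp add: simple_reflection_pairing axis_def)

text \<open>Reflecting vectors and orientation together does not change the Euler form. This transports
  statements about homomorphisms along the reflection functors at the level of dimension vectors.\<close>

lemma euler_form_reflection:
  fixes \<Gamma> :: "('v::finite, 'e::finite) graph"
  assumes "loopfree_graph \<Gamma>" "orientation_of \<Gamma> \<Lambda>" "sink \<Lambda> x"
  shows "euler_form (reverse_at x \<Lambda>) (simple_reflection \<Gamma> x u) (simple_reflection \<Gamma> x v) = euler_form \<Lambda> u v"
proof -
  let ?E = "{e. snd (\<Lambda> e) = x}"
  let ?u = "simple_reflection \<Gamma> x u" and ?v = "simple_reflection \<Gamma> x v"
  define a b where "a = (\<Sum>e\<in>?E. u $ fst (\<Lambda> e))" and "b = (\<Sum>e\<in>?E. v $ fst (\<Lambda> e))"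
  have refl_u: "?u $ z = (if z = x then a - u $ x else u $ z)"
    and refl_v: "?v $ z = (if z = x then b - v $ x else v $ z)" for z
    by (simp_all add: reflection_at_sink[OF assms] a_def b_def)
  have src: "fst (\<Lambda> e) \<noteq> x" for e using assms(3) by (simp add: sink_def)
  have split: "(\<Sum>e\<in>UNIV. f e) = (\<Sum>e\<in>?E. f e) + (\<Sum>e\<in>-?E. f e)" for f :: "'e \<Rightarrow> int"
    by (metis Compl_eq_Diff_UNIV add.commute finite_class.finite_UNIV subset_UNIV sum.subset_diff)
  have vert: "(\<Sum>z\<in>UNIV. ?u $ z * ?v $ z) = (\<Sum>z\<in>UNIV. u $ z * v $ z) - u $ x * v $ x + (a - u $ x) * (b - v $ x)"
    using sum.remove[of UNIV x "\<lambda>z. ?u $ z * ?v $ z"] sum.remove[of UNIV x "\<lambda>z. u $ z * v $ z"]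
    by (simp add: refl_u refl_v)
  have "(\<Sum>e\<in>?E. ?u $ fst (reverse_at x \<Lambda> e) * ?v $ snd (reverse_at x \<Lambda> e)) = (\<Sum>e\<in>?E. (a - u $ x) * v $ fst (\<Lambda> e))"
    by (rule sum.cong) (auto simp: reverse_at_def refl_u refl_v src)
  also have "\<dots> = (a - u $ x) * b" by (simp add: b_def sum_distrib_left)
  finally have in1: "(\<Sum>e\<in>?E. ?u $ fst (reverse_at x \<Lambda> e) * ?v $ snd (reverse_at x \<Lambda> e)) = (a - u $ x) * b" .
  have in2: "(\<Sum>e\<in>?E. u $ fst (\<Lambda> e) * v $ snd (\<Lambda> e)) = a * v $ x"
    by (simp add: a_def sum_distrib_right)
  have out: "(\<Sum>e\<in>-?E. ?u $ fst (reverse_at x \<Lambda> e) * ?v $ snd (reverse_at x \<Lambda> e)) = (\<Sum>e\<in>-?E. u $ fst (\<Lambda> e) * v $ snd (\<Lambda> e))"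
    by (rule sum.cong) (auto simp: reverse_at_def refl_u refl_v src)
  show ?thesis
    unfolding euler_form_def split vert in1 in2 out by (simp add: algebra_simps)
qed

lemma euler_form_product:
  fixes \<Gamma> :: "('v::finite, 'e::finite) graph"
  assumes "loopfree_graph \<Gamma>" "orientation_of \<Gamma> \<Lambda>" "admissible \<Lambda> T"
  shows "euler_form \<Lambda> (reflection_product \<Gamma> T u) (reflection_product \<Gamma> T v) = euler_form (reverse_along T \<Lambda>) u v"
  using assms
proof (induction T arbitrary: \<Lambda>)
  case (Cons x T)
  have x: "sink \<Lambda> x" using Cons.prems by simp
  have "euler_form \<Lambda> (reflection_product \<Gamma> (x # T) u) (reflection_product \<Gamma> (x # T) v)
      = euler_form (reverse_at x \<Lambda>) (reflection_product \<Gamma> T u) (reflection_product \<Gamma> T v)"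
    using euler_form_reflection[OF Cons.prems(1,2) x, of "reflection_product \<Gamma> (x # T) u" "reflection_product \<Gamma> (x # T) v"]
    by (simp add: simple_reflection_involution)
  then show ?case using Cons.IH Cons.prems orientation_of_reverse_at by fastforce
qed simp

text \<open>The simple module at a sink is projective, and homomorphisms from it measure the space at the sink.\<close>

lemma euler_form_sink:
  fixes \<Lambda> :: "('v::finite, 'e::finite) orientation"
  assumes "sink \<Lambda> x"
  shows "euler_form \<Lambda> (axis x 1) v = v $ x"
proof -
  have "(\<Sum>e\<in>UNIV. axis x 1 $ fst (\<Lambda> e) * v $ snd (\<Lambda> e)) = 0"
    using assms by (intro sum.neutral) (auto simp: axis_def sink_def)
  moreover have "(\<Sum>z\<in>UNIV. axis x 1 $ z * v $ z) = (\<Sum>z\<in>UNIV. if z = x then v $ z else 0)"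
    by (rule sum.cong) (auto simp: axis_def)
  ultimately show ?thesis by (simp add: euler_form_def)
qed

lemma euler_form_uminus_left: "euler_form \<Lambda> (- u) v = - euler_form \<Lambda> u v"
  by (simp add: euler_form_def sum_negf)

section \<open>Positivity of the last roots\<close>

lemma product_fixes_coordinate:
  "k \<notin> set T \<Longrightarrow> reflection_product \<Gamma> T v $ k = v $ k"
  by (induction T) (auto simp: simple_reflection_def axis_def)

text \<open>The key step: positivity of the roots that belong to the last letter implies positivity of the roots
  that belong to every letter. Go through the letters \<open>y\<close> from right to left. If a root belonging to \<open>y\<close>
  is not nonnegative, some such root is \<open>- e\<^sub>i\<close>, with \<open>i\<close> the first letter of the word that produces it.
  Let \<open>z\<close> be the first neighbour of \<open>y\<close> after \<open>y\<close>. The Euler form of the roots of \<open>y\<close> and \<open>z\<close> can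
  be computed in two places. Just before \<open>y\<close> the first of them is \<open>e\<^sub>y\<close>, and the form is the coordinate
  at \<open>y\<close> of the root of \<open>z\<close>, which is positive because \<open>y\<close> and \<open>z\<close> are neighbours. Just before \<open>i\<close>
  the first of them is \<open>- e\<^sub>i\<close>, and the form is minus a coordinate of a root of \<open>z\<close>, which is nonnegative
  by induction.\<close>

lemma roots_nonneg_from_last:
  fixes \<Gamma> :: "('v::finite, 'e::finite) graph"
  assumes graph: "loopfree_graph \<Gamma>" "orientation_of \<Gamma> \<Lambda>" and adm: "admissible \<Lambda> S"
    and later: "\<And>A y B. S = A @ y # B \<Longrightarrow> B \<noteq> [] \<Longrightarrow> \<exists>z\<in>set B. adjacent \<Gamma> y z"
    and last_roots: "\<And>A B z. S = A @ B @ [z] \<Longrightarrow> 0 \<le> reflection_product \<Gamma> B (axis z 1)"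
    and S: "S = A1 @ A2 @ y # B"
  shows "0 \<le> reflection_product \<Gamma> A2 (axis y 1)"
  using S
proof (induction "length B" arbitrary: A1 A2 y B rule: less_induct)
  case less
  note IH = less.hyps
  show ?case
  proof (cases "B = []")
    case True
    then show ?thesis using last_roots less.prems by simp
  next
    case B: False
    show ?thesis using less.prems
    proof (induction A2 arbitrary: A1)
      case Nil
      then show ?case by (simp add: less_eq_vec_def axis_def)
    next
      case (Cons i A2)
      show ?case
      proof (rule ccontr)
        assume neg: "\<not> 0 \<le> reflection_product \<Gamma> (i # A2) (axis y 1)"
        \<comment> \<open>So the reflection at i is what destroys nonnegativity.\<close>
        have "0 \<le> reflection_product \<Gamma> A2 (axis y 1)" using Cons.IH[of "A1 @ [i]"] Cons.prems by simp
        then have "reflection_product \<Gamma> A2 (axis y 1) = axis i 1"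
          using neg by (rule root_reflected_to_negative_is_simple)
        then have bad: "reflection_product \<Gamma> (i # A2) (axis y 1) = - axis i 1"
          by (simp add: simple_reflection_own_root)
        have "\<exists>z\<in>set B. adjacent \<Gamma> y z" using later[of "A1 @ i # A2" y B] Cons.prems B by simp
        then obtain B1 z B2 where B_split: "B = B1 @ z # B2" and yz: "adjacent \<Gamma> y z"
            and B1: "\<And>w. w \<in> set B1 \<Longrightarrow> \<not> adjacent \<Gamma> y w"
          using split_list_first_prop[of B "adjacent \<Gamma> y"] by blast
        define \<Lambda>i where "\<Lambda>i = reverse_along A1 \<Lambda>"
        define \<Lambda>y where "\<Lambda>y = reverse_along (i # A2) \<Lambda>i"
        have adm_i: "admissible \<Lambda>i (i # A2)" and adm_y: "admissible \<Lambda>y (y # B1)"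
          using adm unfolding Cons.prems B_split \<Lambda>i_def \<Lambda>y_def
          by (auto simp: admissible_append reverse_along_append)
        have or_i: "orientation_of \<Gamma> \<Lambda>i" using graph(2) by (simp add: \<Lambda>i_def orientation_of_reverse_along)
        then have or_y: "orientation_of \<Gamma> \<Lambda>y" by (simp only: \<Lambda>y_def orientation_of_reverse_along)
        let ?v = "reflection_product \<Gamma> B1 (axis z 1)"
        let ?w = "reflection_product \<Gamma> ((i # A2) @ y # B1) (axis z 1)"
        have w: "0 \<le> ?w" by (rule IH[of B2]) (simp_all add: Cons.prems B_split)
        have v: "0 \<le> ?v" by (rule IH[of B2 "A1 @ (i # A2) @ [y]"]) (simp_all add: Cons.prems B_split)
        obtain e where e: "\<Lambda>y e = (z, y)"
          using yz
        proof (rule neighbour_by_edge[OF or_y])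
          fix e assume "\<Lambda>y e = (y, z)"
          moreover have "fst (\<Lambda>y e) \<noteq> y" using adm_y by (simp add: sink_def)
          ultimately show thesis by simp
        qed (rule that)
        have "z \<noteq> y" using edge_ends[OF graph(1) or_y, of e] e by simp
        have "z \<notin> set B1" using B1 yz by blast
        then have v_z: "?v $ z = 1" by (simp add: product_fixes_coordinate)
        have "count_list (y # B1) y \<le> Suc (count_list (y # B1) z)"
          by (rule count_le_if_admissible(2)[OF or_y graph(1) adm_y e])
        then have "y \<notin> set B1"
          using \<open>z \<noteq> y\<close> \<open>z \<notin> set B1\<close> by (simp add: count_list_0_iff)
        then have v_y: "?v $ y = 0" using \<open>z \<noteq> y\<close> by (simp add: product_fixes_coordinate axis_def)
        have y_sink: "sink \<Lambda>y y" using adm_y by simp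
        \<comment> \<open>The reflection at y turns the coordinates 0 at y and 1 at the neighbour z into a positive
          one at y.\<close>
        have "1 \<le> (\<Sum>e | snd (\<Lambda>y e) = y. ?v $ fst (\<Lambda>y e))"
          using member_le_sum[of e "{e. snd (\<Lambda>y e) = y}" "\<lambda>e. ?v $ fst (\<Lambda>y e)"] e v v_z
          by (auto simp: less_eq_vec_def)
        then have "0 < reflection_product \<Gamma> (y # B1) (axis z 1) $ y"
          using v_y by (simp add: reflection_at_sink[OF graph(1) or_y y_sink])
        also have "reflection_product \<Gamma> (y # B1) (axis z 1) $ y = euler_form \<Lambda>y (axis y 1) (reflection_product \<Gamma> (y # B1) (axis z 1))"
          by (rule euler_form_sink[OF y_sink, symmetric])
        also have "\<dots> = euler_form \<Lambda>i (reflection_product \<Gamma> (i # A2) (axis y 1)) ?w"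
          unfolding \<Lambda>y_def euler_form_product[OF graph(1) or_i adm_i, symmetric] by simp
        also have "\<dots> = - (?w $ i)"
          unfolding bad euler_form_uminus_left using adm_i by (simp add: euler_form_sink)
        finally show False using w unfolding less_eq_vec_def by (metis neg_0_less_iff_less not_le zero_index)
      qed
    qed
  qed
qed

text \<open>For every reduced word the roots that belong to its last letter are positive. For a principal
  sequence the converse holds as well, since they control the roots of all other letters.\<close>

lemma reduced_iff_last_roots_pos:
  fixes \<Gamma> :: "('v::finite, 'e::finite) graph"
  assumes graph: "loopfree_graph \<Gamma>" "connected_graph \<Gamma>" "CARD('v) > 1" "orientation_of \<Gamma> \<Lambda>"
    and princ: "principal_seq \<Gamma> \<Lambda> S"
  shows "reduced_word \<Gamma> S \<longleftrightarrow>
    (\<forall>A B z. S = A @ B @ [z] \<longrightarrow> 0 < reflection_product \<Gamma> B (axis z 1))"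
proof (intro iffI allI impI)
  fix A B z assume "reduced_word \<Gamma> S" "S = A @ B @ [z]"
  then have "reduced_word \<Gamma> (B @ [z])" using reduced_word_suffix[of \<Gamma> A] by simp
  then show "0 < reflection_product \<Gamma> B (axis z 1)" by (simp add: reduced_word_snoc)
next
  assume last_roots: "\<forall>A B z. S = A @ B @ [z] \<longrightarrow> 0 < reflection_product \<Gamma> B (axis z 1)"
  have adm: "admissible \<Lambda> S" using princ by (simp add: principal_seq_def)
  show "reduced_word \<Gamma> S"
  proof (rule reduced_word_if_roots_pos)
    fix A y B assume S: "S = A @ y # B"
    have "0 \<le> reflection_product \<Gamma> A (axis y 1)"
    proof (rule roots_nonneg_from_last[OF graph(1,4) adm, where ?A1.0 = "[]"])
      show "S = [] @ A @ y # B" using S by simp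
    next
      fix A y B assume "S = A @ y # B" "B \<noteq> []"
      then show "\<exists>z\<in>set B. adjacent \<Gamma> y z" by (rule principal_seq_later_neighbour[OF graph princ])
    next
      fix A B z assume "S = A @ B @ [z]"
      then show "0 \<le> reflection_product \<Gamma> B (axis z 1)" using last_roots order_less_imp_le by blast
    qed
    then show "0 < reflection_product \<Gamma> A (axis y 1)" by (simp add: pos_iff_nonneg_root)
  qed
qed

section \<open>Linear algebra in the ambient space\<close>

global_interpretation amb_pair: vector_space_pair
  "ascale :: 'k::field \<Rightarrow> ('e, 'k) ambient \<Rightarrow> _" "ascale :: 'k::field \<Rightarrow> ('e, 'k) ambient \<Rightarrow> _"
  by unfold_locales

abbreviation amb_linear :: "(('e, 'k::field) ambient \<Rightarrow> ('e, 'k) ambient) \<Rightarrow> bool" where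
  "amb_linear \<equiv> Vector_Spaces.linear ascale ascale"

lemma amb_linearI:
  assumes "\<And>u v. g (u + v) = g u + g v" "\<And>c u. g (ascale c u) = ascale c (g u)"
  shows "amb_linear g"
  unfolding Vector_Spaces.linear_iff using assms amb.vector_space_axioms by blast

text \<open>The ambient space is infinite-dimensional, and subspaces are handled through bases. Coordinates with
  respect to the union of two disjoint parts of a basis show that their spans are independent.\<close>

lemma basis_split:
  assumes "amb.subspace A" "amb.subspace V" "A \<subseteq> V"
  obtains B C where "amb.independent (B \<union> C)" "B \<inter> C = {}" "amb.span B = A"
    "amb.span (B \<union> C) = V" "amb.span B \<inter> amb.span C = {0}"
proof -
  obtain B where B: "B \<subseteq> A" "amb.independent B" "A \<subseteq> amb.span B"
    by (metis amb.basis_exists)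
  obtain B' where B': "B \<subseteq> B'" "B' \<subseteq> V" "amb.independent B'" "V \<subseteq> amb.span B'"
    by (rule amb.maximal_independent_subset_extend[of B V]) (use B assms(3) in auto)
  let ?C = "B' - B"
  have "x = 0" if x: "x \<in> amb.span B" "x \<in> amb.span ?C" for x
  proof -
    have rep: "amb.representation B' x = amb.representation B x"
        "amb.representation B' x = amb.representation ?C x"
      by (rule amb.representation_extend[OF B'(3)]; use x B'(1) in auto)+
    have zero: "amb.representation B' x b = 0" for b
    proof (rule ccontr)
      assume "amb.representation B' x b \<noteq> 0"
      then have "b \<in> B" "b \<in> ?C"
        using amb.representation_ne_zero[of B x b] amb.representation_ne_zero[of ?C x b] rep by auto
      then show False by blast
    qed
    have "x \<in> amb.span B'" using x(1) amb.span_mono[OF B'(1)] by blast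
    then have "(\<Sum>b | amb.representation B' x b \<noteq> 0. ascale (amb.representation B' x b) b) = x"
      by (rule amb.sum_nonzero_representation_eq[OF B'(3)])
    then show ?thesis using zero by simp
  qed
  then have "amb.span B \<inter> amb.span ?C = {0}" using amb.span_zero by blast
  moreover have "B \<union> ?C = B'" using B'(1) by blast
  moreover have "amb.span B = A" using B assms(1) amb.span_minimal by blast
  moreover have "amb.span B' = V" using B' assms(2) amb.span_minimal by blast
  ultimately show thesis using that[of B ?C] B'(3) by simp
qed

lemma exists_complement:
  assumes "amb.subspace A" "amb.subspace V" "A \<subseteq> V"
  obtains C where "amb.subspace C" "C \<subseteq> V" "A \<inter> C = {0}" "V = {a + c | a c. a \<in> A \<and> c \<in> C}"
proof -
  obtain B C where *: "amb.span B = A" "amb.span (B \<union> C) = V" "amb.span B \<inter> amb.span C = {0}"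
    using basis_split[OF assms] by metis
  have "amb.span C \<subseteq> V" using *(2) amb.span_mono[of C "B \<union> C"] by auto
  moreover have "V = {a + c | a c. a \<in> A \<and> c \<in> amb.span C}"
    using amb.span_Un[of B C] unfolding *(1,2) .
  moreover have "A \<inter> amb.span C = {0}" using *(3) unfolding *(1) .
  ultimately show thesis using that[of "amb.span C"] amb.subspace_span by blast
qed

definition finite_dim :: "('e, 'k::field) ambient set \<Rightarrow> bool" where
  "finite_dim V \<longleftrightarrow> (\<exists>B. finite B \<and> V \<subseteq> amb.span B)"

text \<open>The rank-nullity formula for a finite-dimensional subspace of the ambient space: a complement of the
  kernel is mapped isomorphically onto the image.\<close>

lemma rank_nullity:
  assumes V: "amb.subspace V" and fin: "finite_dim V" and g: "amb_linear g"
  shows "amb.dim V = amb.dim {v \<in> V. g v = 0} + amb.dim (g ` V)"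
proof -
  let ?K = "{v \<in> V. g v = 0}"
  have "?K = V \<inter> {v. g v = 0}" by blast
  then have "amb.subspace ?K"
    using amb.subspace_inter[OF V amb_pair.linear_subspace_kernel[OF g]] by simp
  then obtain B C where bc: "amb.independent (B \<union> C)" "B \<inter> C = {}" "amb.span B = ?K"
      "amb.span (B \<union> C) = V" "amb.span B \<inter> amb.span C = {0}"
    using basis_split[OF _ V, of ?K] by blast
  have ind: "amb.independent B" "amb.independent C"
    using bc(1) amb.independent_mono by (blast, blast)
  obtain F where F: "finite F" "V \<subseteq> amb.span F" using fin by (auto simp: finite_dim_def)
  have "B \<union> C \<subseteq> amb.span F" using F(2) bc(4) amb.span_superset by blast
  then have finBC: "finite (B \<union> C)"
    using amb.independent_span_bound[OF F(1) bc(1)] by blast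
  have CV: "amb.span C \<subseteq> V" using bc(4) amb.span_mono[of C "B \<union> C"] by auto
  have inj: "inj_on g (amb.span C)"
    unfolding amb_pair.linear_inj_on_iff_eq_0[OF g amb.subspace_span]
    using CV bc(3,5) by blast
  have "g ` V = g ` amb.span C"
  proof
    show "g ` V \<subseteq> g ` amb.span C"
    proof
      fix y assume "y \<in> g ` V"
      then obtain b c where "y = g (b + c)" "b \<in> amb.span B" "c \<in> amb.span C"
        using bc(4) by (auto simp: amb.span_Un)
      moreover have "g b = 0" using \<open>b \<in> amb.span B\<close> bc(3) by auto
      ultimately show "y \<in> g ` amb.span C" by (simp add: amb_pair.linear_add[OF g])
    qed
  qed (use CV in blast)
  then have "amb.dim (g ` V) = amb.dim (amb.span (g ` C))"
    by (simp add: amb_pair.linear_span_image[OF g])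
  also have "\<dots> = card (g ` C)"
    by (rule amb.dim_span_eq_card_independent)
      (rule amb_pair.linear_independent_injective_image[OF g ind(2) inj])
  also have "\<dots> = card C"
    by (rule card_image) (rule inj_on_subset[OF inj amb.span_superset])
  finally have im: "amb.dim (g ` V) = card C" .
  have "amb.dim ?K = card B"
    using amb.dim_span_eq_card_independent[OF ind(1)] bc(3) by simp
  moreover have "amb.dim V = card (B \<union> C)"
    using amb.dim_span_eq_card_independent[OF bc(1)] bc(4) by simp
  moreover have "card (B \<union> C) = card B + card C"
    using finBC bc(2) by (intro card_Un_disjoint) auto
  ultimately show ?thesis using im by simp
qed

text \<open>The maps of a representation are linear on the given spaces only, and arbitrary elsewhere. Replacing
  them by linear maps on the whole ambient space makes kernels, images and preimages subspaces.\<close>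

lemma linear_map_extends:
  assumes V: "amb.subspace V" and f: "linear_map_between V W f"
  obtains g where "amb_linear g" "\<And>v. v \<in> V \<Longrightarrow> g v = f v"
proof -
  obtain B where B: "B \<subseteq> V" "amb.independent B" "V \<subseteq> amb.span B"
    by (metis amb.basis_exists)
  obtain g where g: "amb_linear g" "\<And>b. b \<in> B \<Longrightarrow> g b = f b"
    using amb_pair.linear_independent_extend[OF B(2)] by blast
  have "amb.subspace {v \<in> V. g v = f v}"
  proof (rule amb.subspaceI)
    show "0 \<in> {v \<in> V. g v = f v}"
      using linear_map_between_zero[OF f V] amb_pair.linear_0[OF g(1)] amb.subspace_0[OF V] by simp
  next
    fix u v assume "u \<in> {v \<in> V. g v = f v}" "v \<in> {v \<in> V. g v = f v}"
    then show "u + v \<in> {v \<in> V. g v = f v}"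
      using f amb.subspace_add[OF V] by (simp add: amb_pair.linear_add[OF g(1)] linear_map_between_def)
  next
    fix c v assume "v \<in> {v \<in> V. g v = f v}"
    then show "ascale c v \<in> {v \<in> V. g v = f v}"
      using f amb.subspace_scale[OF V] by (simp add: amb_pair.linear_scale[OF g(1)] linear_map_between_def)
  qed
  then have "amb.span B \<subseteq> {v \<in> V. g v = f v}"
    using B(1) g(2) by (intro amb.span_minimal) auto
  then show thesis using that[OF g(1)] B(3) by blast
qed

lemma linear_map_image_subspace:
  assumes "amb.subspace V" "linear_map_between V W f"
  shows "amb.subspace (f ` V)"
proof -
  obtain g where g: "amb_linear g" "\<And>v. v \<in> V \<Longrightarrow> g v = f v"
    using linear_map_extends[OF assms] by blast
  then have "f ` V = g ` V" by (metis image_cong)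
  then show ?thesis using amb_pair.linear_subspace_image[OF g(1) assms(1)] by simp
qed

lemma rank_nullity_between:
  assumes "amb.subspace V" "finite_dim V" "linear_map_between V W f"
  shows "amb.dim V = amb.dim {v \<in> V. f v = 0} + amb.dim (f ` V)"
proof -
  obtain g where g: "amb_linear g" "\<And>v. v \<in> V \<Longrightarrow> g v = f v"
    using linear_map_extends[OF assms(1,3)] by blast
  then have "f ` V = g ` V" "{v \<in> V. f v = 0} = {v \<in> V. g v = 0}" by (metis image_cong) (use g in auto)
  then show ?thesis using rank_nullity[OF assms(1,2) g(1)] by simp
qed

text \<open>A substitute for the quotient of \<open>D\<close> by \<open>I\<close>, which is not a subspace of the ambient space: the image
  of a projection along \<open>I\<close>.\<close>

lemma linear_map_with_kernel:
  assumes "amb.subspace I" "amb.subspace D" "I \<subseteq> D"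
  obtains \<pi> where "amb_linear \<pi>" "\<And>v. v \<in> D \<Longrightarrow> \<pi> v = 0 \<longleftrightarrow> v \<in> I"
proof -
  obtain B C where bc: "amb.independent (B \<union> C)" "B \<inter> C = {}" "amb.span B = I"
      "amb.span (B \<union> C) = D" "amb.span B \<inter> amb.span C = {0}"
    using basis_split[OF assms] by blast
  obtain \<pi> where \<pi>: "amb_linear \<pi>" "\<And>b. b \<in> B \<union> C \<Longrightarrow> \<pi> b = (if b \<in> C then b else 0)"
    using amb_pair.linear_independent_extend[OF bc(1), of "\<lambda>b. if b \<in> C then b else 0"] by blast
  have B0: "\<pi> u = 0" if "u \<in> amb.span B" for u
    using that by (rule amb_pair.linear_eq_0_on_span[OF \<pi>(1), rotated]) (use \<pi>(2) bc(2) in auto)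
  have "amb.subspace {u. \<pi> u = u}"
    by (rule amb.subspaceI)
      (simp_all add: amb_pair.linear_0[OF \<pi>(1)] amb_pair.linear_add[OF \<pi>(1)] amb_pair.linear_scale[OF \<pi>(1)])
  then have "amb.span C \<subseteq> {u. \<pi> u = u}"
    using \<pi>(2) by (intro amb.span_minimal) auto
  then have C1: "\<pi> u = u" if "u \<in> amb.span C" for u
    using that by blast
  have "\<pi> v = 0 \<longleftrightarrow> v \<in> I" if v: "v \<in> D" for v
  proof
    assume "v \<in> I" then show "\<pi> v = 0" using B0 bc(3) by simp
  next
    assume 0: "\<pi> v = 0"
    obtain b c where bc': "v = b + c" "b \<in> amb.span B" "c \<in> amb.span C"
      using v bc(4) by (auto simp: amb.span_Un)
    then have "c = 0" using 0 B0 C1 by (simp add: amb_pair.linear_add[OF \<pi>(1)])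
    then show "v \<in> I" using bc' bc(3) by simp
  qed
  then show thesis using that \<pi>(1) by blast
qed

lemma dim_zero_space: "amb.dim ({0} :: ('e, 'k::field) ambient set) = 0"
  using amb.dim_span_eq_card_independent[OF amb.independent_empty] by simp

lemma dim_nonzero_line:
  fixes v :: "('e, 'k::field) ambient"
  assumes "v \<noteq> 0" shows "amb.dim (amb.span {v}) = 1"
  using assms amb.dim_span_eq_card_independent[of "{v}"] by simp

lemma dim_zero_imp_zero:
  assumes "amb.subspace V" "finite_dim V" "amb.dim V = 0"
  shows "V = {0}"
proof -
  obtain B where B: "B \<subseteq> V" "amb.independent B" "V \<subseteq> amb.span B" "card B = amb.dim V"
    by (metis amb.basis_exists)
  obtain F where F: "finite F" "V \<subseteq> amb.span F" using assms(2) by (auto simp: finite_dim_def)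
  have "B \<subseteq> amb.span F" using B(1) F(2) by blast
  then have "finite B" using amb.independent_span_bound[OF F(1) B(2)] by blast
  then have "B = {}" using B(4) assms(3) by simp
  then have "V \<subseteq> {0}" using B(3) amb.span_empty by blast
  then show ?thesis using amb.subspace_0[OF assms(1)] by blast
qed

lemma finite_dim_image:
  assumes "finite_dim V" "amb_linear g" shows "finite_dim (g ` V)"
proof -
  obtain B where "finite B" "V \<subseteq> amb.span B" using assms(1) by (auto simp: finite_dim_def)
  then have "finite (g ` B)" "g ` V \<subseteq> amb.span (g ` B)"
    using amb_pair.linear_spans_image[OF assms(2)] by auto
  then show ?thesis unfolding finite_dim_def by blast
qed

section \<open>Families of vectors\<close>

text \<open>The inverse of taking components: the member of a direct sum with prescribed components, in the
  encoding of direct sums by functions on lists.\<close>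

definition tuple :: "'e set \<Rightarrow> ('e \<Rightarrow> ('e, 'k::zero) ambient) \<Rightarrow> ('e, 'k) ambient" where
  "tuple E f = (\<lambda>l. case l of [] \<Rightarrow> 0 | e # l' \<Rightarrow> if e \<in> E then f e l' else 0)"

definition family_space ::
    "'e set \<Rightarrow> ('e \<Rightarrow> ('e, 'k::field) ambient set) \<Rightarrow> ('e, 'k) ambient set" where
  "family_space E V = {w. w [] = 0 \<and> (\<forall>e\<in>E. component e w \<in> V e) \<and> (\<forall>e. e \<notin> E \<longrightarrow> component e w = 0)}"

lemma ambient_eqI:
  assumes "w [] = w' []" "\<And>e. component e w = component e w'"
  shows "w = w'"
proof
  fix l show "w l = w' l"
    using assms by (cases l) (auto simp: component_def fun_eq_iff)
qed

lemma component_tuple: "component e (tuple E f) = (if e \<in> E then f e else 0)"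
  by (auto simp: component_def tuple_def fun_eq_iff)

lemma tuple_Nil: "tuple E f [] = 0"
  by (simp add: tuple_def)

lemma component_sum: "component e (\<Sum>i\<in>I. w i) = (\<Sum>i\<in>I. component e (w i))"
  by (simp add: component_def fun_eq_iff sum_apply)

lemma amb_linear_component: "amb_linear (component e :: ('e, 'k::field) ambient \<Rightarrow> _)"
  by (rule amb_linearI) (simp_all add: component_add component_scale)

lemma amb_linear_singleton: "amb_linear (\<lambda>u :: ('e, 'k::field) ambient. tuple {e} (\<lambda>_. u))"
  by (rule amb_linearI) (auto simp: tuple_def ascale_def fun_eq_iff split: list.splits)

lemma tuple_in_family_space: "(\<And>e. e \<in> E \<Longrightarrow> f e \<in> V e) \<Longrightarrow> tuple E f \<in> family_space E V"
  by (simp add: family_space_def component_tuple tuple_Nil)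

lemma singleton_in_family_space:
  assumes "e \<in> E" "u \<in> V e" "\<And>e. e \<in> E \<Longrightarrow> amb.subspace (V e)"
  shows "tuple {e} (\<lambda>_. u) \<in> family_space E V"
  using assms by (auto simp: family_space_def component_tuple tuple_Nil amb.subspace_0)

lemma ascale_Nil: "ascale c u [] = c * u []"
  by (simp add: ascale_def)

lemma family_space_subspace:
  assumes "\<And>e. e \<in> E \<Longrightarrow> amb.subspace (V e)"
  shows "amb.subspace (family_space E V)"
  using assms
  by (intro amb.subspaceI)
    (auto simp: family_space_def component_zero component_add component_scale amb.subspace_0
      amb.subspace_add amb.subspace_scale ascale_Nil)

lemma family_space_expand:
  fixes w :: "('e::finite, 'k::field) ambient"
  assumes "w \<in> family_space E V"
  shows "w = (\<Sum>e\<in>E. tuple {e} (\<lambda>_. component e w))"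
proof (rule ambient_eqI)
  show "w [] = (\<Sum>e\<in>E. tuple {e} (\<lambda>_. component e w)) []"
    using assms by (simp add: sum_apply tuple_Nil family_space_def)
next
  fix a
  have "component a (\<Sum>e\<in>E. tuple {e} (\<lambda>_. component e w)) = (\<Sum>e\<in>E. if a = e then component e w else 0)"
    unfolding component_sum by (rule sum.cong) (auto simp: component_tuple)
  also have "\<dots> = (if a \<in> E then component a w else 0)" by simp
  also have "\<dots> = component a w" using assms by (simp add: family_space_def)
  finally show "component a w = component a (\<Sum>e\<in>E. tuple {e} (\<lambda>_. component e w))" by simp
qed

lemma finite_dim_family_space:
  fixes V :: "'e::finite \<Rightarrow> ('e, 'k::field) ambient set"
  assumes "\<And>e. e \<in> E \<Longrightarrow> finite_dim (V e)"
  shows "finite_dim (family_space E V)"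
proof -
  let ?V = "\<lambda>e. if e \<in> E then V e else {0}"
  have "\<exists>B. finite B \<and> ?V e \<subseteq> amb.span B" for e
    using assms[of e] amb.span_zero by (cases "e \<in> E") (auto simp: finite_dim_def)
  then obtain B where B: "finite B" "{w. w [] = 0 \<and> (\<forall>e. component e w \<in> ?V e)} \<subseteq> amb.span B"
    using finite_span_subset_sum[of ?V] by (metis (no_types, lifting))
  moreover have "family_space E V \<subseteq> {w. w [] = 0 \<and> (\<forall>e. component e w \<in> ?V e)}"
    by (auto simp: family_space_def)
  ultimately show ?thesis unfolding finite_dim_def by blast
qed

text \<open>Adding one summand at a time, by rank-nullity for the projection onto the new summand.\<close>

lemma dim_family_space:
  fixes V :: "'e::finite \<Rightarrow> ('e, 'k::field) ambient set"
  assumes "\<And>e. amb.subspace (V e)" "\<And>e. finite_dim (V e)"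
  shows "amb.dim (family_space E V) = (\<Sum>e\<in>E. amb.dim (V e))"
proof (induction E rule: finite_induct[OF finite])
  case 1
  have "w = 0" if "w \<in> family_space {} V" for w
    by (rule ambient_eqI) (use that in \<open>simp_all add: family_space_def component_zero\<close>)
  moreover have "0 \<in> family_space {} V" by (simp add: family_space_def component_zero)
  ultimately have "family_space {} V = {0}" by blast
  then show ?case by (simp add: dim_zero_space)
next
  case (2 e E)
  let ?D = "family_space (insert e E) V"
  have "amb.dim ?D = amb.dim {w \<in> ?D. component e w = 0} + amb.dim (component e ` ?D)"
    by (rule rank_nullity[OF family_space_subspace finite_dim_family_space amb_linear_component])
      (use assms in auto)
  moreover have "{w \<in> ?D. component e w = 0} = family_space E V"
    using 2(2) assms(1)[of e] by (auto simp: family_space_def amb.subspace_0)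
  moreover have "component e ` ?D = V e"
  proof
    show "V e \<subseteq> component e ` ?D"
    proof
      fix u assume "u \<in> V e"
      then have "tuple {e} (\<lambda>_. u) \<in> ?D" by (intro singleton_in_family_space assms(1)) auto
      then show "u \<in> component e ` ?D"
        by (rule image_eqI[rotated]) (simp add: component_tuple)
    qed
  qed (auto simp: family_space_def)
  ultimately show ?case using 2 by simp
qed

lemma family_space_mono:
  assumes "\<And>e. e \<in> E \<Longrightarrow> A e \<subseteq> V e" shows "family_space E A \<subseteq> family_space E V"
  using assms by (auto simp: family_space_def)

lemma family_space_direct_sum:
  assumes "\<And>e. e \<in> E \<Longrightarrow> A e \<inter> B e = {0}"
    and "\<And>e. e \<in> E \<Longrightarrow> V e = {a + b | a b. a \<in> A e \<and> b \<in> B e}"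
  shows "family_space E A \<inter> family_space E B \<subseteq> {0}"
    and "w \<in> family_space E V \<Longrightarrow> \<exists>a\<in>family_space E A. \<exists>b\<in>family_space E B. w = a + b"
proof -
  show "family_space E A \<inter> family_space E B \<subseteq> {0}"
  proof
    fix w assume "w \<in> family_space E A \<inter> family_space E B"
    then have zero: "w [] = 0" "component e w = 0" for e
      using assms(1)[of e] by (auto simp: family_space_def)
    have "w = 0" by (rule ambient_eqI) (simp_all add: zero component_zero)
    then show "w \<in> {0}" by simp
  qed
  assume w: "w \<in> family_space E V"
  have "\<exists>a b. a \<in> A e \<and> b \<in> B e \<and> component e w = a + b" if "e \<in> E" for e
    using w that assms(2)[OF that] by (fastforce simp: family_space_def)
  then obtain f g where fg: "\<And>e. e \<in> E \<Longrightarrow> f e \<in> A e \<and> g e \<in> B e \<and> component e w = f e + g e"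
    by metis
  have "w = tuple E f + tuple E g"
    by (rule ambient_eqI) (use w fg in \<open>auto simp: component_add component_tuple tuple_Nil family_space_def\<close>)
  moreover have "tuple E f \<in> family_space E A" "tuple E g \<in> family_space E B"
    using fg by (auto intro: tuple_in_family_space)
  ultimately show "\<exists>a\<in>family_space E A. \<exists>b\<in>family_space E B. w = a + b" by blast
qed

section \<open>The positive reflection of an indecomposable representation\<close>

definition dim_vector :: "('v::finite, 'e, 'k::field) representation \<Rightarrow> int ^ 'v" where
  "dim_vector M = (\<chi> z. int (amb.dim (space_at M z)))"

text \<open>The direct sum over all arrows ending at \<open>x\<close>. The argument is a family of subspaces and not a
  representation, so that the same construction applies to subrepresentations.\<close>

definition incoming :: "('v, 'e) orientation \<Rightarrow> 'v \<Rightarrow> ('v \<Rightarrow> ('e, 'k::field) ambient set) \<Rightarrow>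
    ('e, 'k) ambient set" where
  "incoming \<Lambda> x A = family_space {e. snd (\<Lambda> e) = x} (\<lambda>e. A (fst (\<Lambda> e)))"

definition incoming_sum :: "('v, 'e::finite) orientation \<Rightarrow> 'v \<Rightarrow> ('v, 'e, 'k::field) representation \<Rightarrow>
    ('e, 'k) ambient \<Rightarrow> ('e, 'k) ambient" where
  "incoming_sum \<Lambda> x M w = (\<Sum>e | snd (\<Lambda> e) = x. map_at M e (component e w))"

definition decomposition where
  "decomposition \<Lambda> A B M \<longleftrightarrow> subrep \<Lambda> A M \<and> subrep \<Lambda> B M \<and> internal_direct_sum A B M"

lemma indecomposable_iff:
  "indecomposable \<Lambda> M \<longleftrightarrow> is_rep \<Lambda> M \<and> \<not> zero_rep M \<and>
     (\<forall>A B. decomposition \<Lambda> A B M \<longrightarrow> (\<forall>x. A x = {0}) \<or> (\<forall>x. B x = {0}))"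
  by (simp add: indecomposable_def decomposition_def)

lemma is_rep_space:
  assumes "is_rep \<Lambda> M"
  shows "amb.subspace (space_at M x)" "finite_dim (space_at M x)" "0 \<in> space_at M x"
  using assms by (auto simp: is_rep_def finite_dim_def amb.subspace_0)

lemma is_rep_map:
  assumes "is_rep \<Lambda> M"
  shows "linear_map_between (space_at M (fst (\<Lambda> e))) (space_at M (snd (\<Lambda> e))) (map_at M e)"
    "map_at M e 0 = 0"
proof -
  show lin: "linear_map_between (space_at M (fst (\<Lambda> e))) (space_at M (snd (\<Lambda> e))) (map_at M e)"
    using assms by (simp add: is_rep_def)
  show "map_at M e 0 = 0"
    by (rule linear_map_between_zero[OF lin is_rep_space(1)[OF assms]])
qed

lemma subrep_space:
  assumes "subrep \<Lambda> A M"
  shows "amb.subspace (A z)" "A z \<subseteq> space_at M z"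
  using assms unfolding subrep_def by blast+

lemma reflection_kernel_incoming:
  "reflection_kernel \<Lambda> x M = {w \<in> incoming \<Lambda> x (space_at M). incoming_sum \<Lambda> x M w = 0}"
  unfolding reflection_kernel_def incoming_def incoming_sum_def family_space_def
  by (auto split: if_splits)

lemma incoming_subspace: "(\<And>z. amb.subspace (A z)) \<Longrightarrow> amb.subspace (incoming \<Lambda> x A)"
  unfolding incoming_def by (rule family_space_subspace)

lemma incoming_mono: "(\<And>z. A z \<subseteq> B z) \<Longrightarrow> incoming \<Lambda> x A \<subseteq> incoming \<Lambda> x B"
  unfolding incoming_def by (rule family_space_mono)

lemma incoming_cong:
  assumes "sink \<Lambda> x" "\<And>z. z \<noteq> x \<Longrightarrow> A z = B z"
  shows "incoming \<Lambda> x A = incoming \<Lambda> x B"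
  using assms by (simp add: incoming_def family_space_def sink_def)

lemma dim_incoming:
  fixes A :: "'v \<Rightarrow> ('e::finite, 'k::field) ambient set"
  assumes "\<And>z. amb.subspace (A z)" "\<And>z. finite_dim (A z)"
  shows "amb.dim (incoming \<Lambda> x A) = (\<Sum>e | snd (\<Lambda> e) = x. amb.dim (A (fst (\<Lambda> e))))"
  unfolding incoming_def by (rule dim_family_space) (use assms in auto)

lemma incoming_sum_linear:
  assumes "is_rep \<Lambda> M"
  shows "linear_map_between (incoming \<Lambda> x (space_at M)) (space_at M x) (incoming_sum \<Lambda> x M)"
proof -
  let ?E = "{e. snd (\<Lambda> e) = x}"
  have lin: "linear_map_between (space_at M (fst (\<Lambda> e))) (space_at M (snd (\<Lambda> e))) (map_at M e)" for e
    by (rule is_rep_map(1)[OF assms])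
  have mem: "component e w \<in> space_at M (fst (\<Lambda> e))" if "w \<in> incoming \<Lambda> x (space_at M)" "e \<in> ?E" for e w
    using that by (simp add: incoming_def family_space_def)
  show ?thesis
    unfolding linear_map_between_def
  proof (intro conjI ballI allI)
    fix w assume w: "w \<in> incoming \<Lambda> x (space_at M)"
    have "map_at M e (component e w) \<in> space_at M x" if "e \<in> ?E" for e
      using lin[of e] mem[OF w that] that by (auto simp: linear_map_between_def)
    then show "incoming_sum \<Lambda> x M w \<in> space_at M x"
      unfolding incoming_sum_def by (intro amb.subspace_sum is_rep_space(1)[OF assms])
    fix c
    have "map_at M e (component e (ascale c w)) = ascale c (map_at M e (component e w))" if "e \<in> ?E" for e
      using lin[of e] mem[OF w that] by (simp add: linear_map_between_def component_scale)
    then show "incoming_sum \<Lambda> x M (ascale c w) = ascale c (incoming_sum \<Lambda> x M w)"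
      unfolding incoming_sum_def by (simp add: amb.scale_sum_right)
  next
    fix u w assume u: "u \<in> incoming \<Lambda> x (space_at M)" and w: "w \<in> incoming \<Lambda> x (space_at M)"
    have "map_at M e (component e (u + w)) = map_at M e (component e u) + map_at M e (component e w)"
      if "e \<in> ?E" for e
      using lin[of e] mem[OF u that] mem[OF w that] by (simp add: linear_map_between_def component_add)
    then show "incoming_sum \<Lambda> x M (u + w) = incoming_sum \<Lambda> x M u + incoming_sum \<Lambda> x M w"
      unfolding incoming_sum_def by (simp add: sum.distrib)
  qed
qed

lemma incoming_sum_singleton:
  assumes "is_rep \<Lambda> M" "snd (\<Lambda> e) = x"
  shows "incoming_sum \<Lambda> x M (tuple {e} (\<lambda>_. u)) = map_at M e u"
proof -
  have "incoming_sum \<Lambda> x M (tuple {e} (\<lambda>_. u)) = (\<Sum>a | snd (\<Lambda> a) = x. if a = e then map_at M e u else 0)"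
    unfolding incoming_sum_def
    by (rule sum.cong) (auto simp: component_tuple is_rep_map(2)[OF assms(1)])
  then show ?thesis using assms(2) by simp
qed

lemma direct_sum_parts:
  assumes "internal_direct_sum A B M"
  shows "A z \<inter> B z = {0}" "space_at M z = {a + b | a b. a \<in> A z \<and> b \<in> B z}"
    "A z = {0} \<Longrightarrow> space_at M z = B z" "B z = {0} \<Longrightarrow> space_at M z = A z"
proof -
  have all: "A z \<inter> B z = {0} \<and> space_at M z = {a + b | a b. a \<in> A z \<and> b \<in> B z}"
    using assms unfolding internal_direct_sum_def by (rule spec)
  then show "A z \<inter> B z = {0}" ..
  from all show *: "space_at M z = {a + b | a b. a \<in> A z \<and> b \<in> B z}" ..
  show "space_at M z = B z" if "A z = {0}" unfolding * that by auto
  show "space_at M z = A z" if "B z = {0}" unfolding * that by auto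
qed

lemma sumset_commute:
  fixes X Y :: "'a::ab_semigroup_add set"
  shows "{a + b | a b. a \<in> X \<and> b \<in> Y} = {a + b | a b. a \<in> Y \<and> b \<in> X}"
  by (intro Collect_cong) (metis add.commute)

lemma internal_direct_sum_commute:
  "internal_direct_sum A B M \<Longrightarrow> internal_direct_sum B A M"
  unfolding internal_direct_sum_def sumset_commute[of "B _"] Int_commute[of "B _"] .

text \<open>A representation concentrated at one vertex is a vector space, and only the lines among these are
  indecomposable. Sinks and sources are covered alike.\<close>

lemma dim_vector_one_vertex:
  fixes M :: "('v::finite, 'e, 'k::field) representation"
  assumes ind: "indecomposable \<Lambda> M" and loops: "\<And>e. fst (\<Lambda> e) \<noteq> snd (\<Lambda> e)"
    and zero: "\<And>z. z \<noteq> x \<Longrightarrow> space_at M z = {0}"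
  shows "dim_vector M = axis x 1"
proof -
  have rep: "is_rep \<Lambda> M" and nonzero: "\<not> zero_rep M" using ind by (simp_all add: indecomposable_def)
  have "space_at M x \<noteq> {0}" using nonzero zero unfolding zero_rep_def by metis
  then obtain v where v: "v \<in> space_at M x" "v \<noteq> 0" using is_rep_space(3)[OF rep] by blast
  have sub: "amb.subspace (space_at M x)" by (rule is_rep_space(1)[OF rep])
  have line: "amb.span {v} \<subseteq> space_at M x" using v(1) sub by (intro amb.span_minimal) auto
  obtain C where C: "amb.subspace C" "C \<subseteq> space_at M x" "amb.span {v} \<inter> C = {0}"
      "space_at M x = {a + c | a c. a \<in> amb.span {v} \<and> c \<in> C}"
    by (rule exists_complement[OF amb.subspace_span sub line])
  define conc where "conc D = (\<lambda>z. if z = x then D else {0})" for D :: "('e, 'k) ambient set"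
  have conc_subrep: "subrep \<Lambda> (conc D) M" if D: "amb.subspace D" "D \<subseteq> space_at M x" for D
    unfolding subrep_def
  proof (intro conjI allI)
    fix e
    have "map_at M e u = 0" if u: "u \<in> conc D (fst (\<Lambda> e))" for u
    proof (cases "fst (\<Lambda> e) = x")
      case True
      then have "u \<in> space_at M (fst (\<Lambda> e))" using u D by (auto simp: conc_def)
      then have "map_at M e u \<in> space_at M (snd (\<Lambda> e))"
        using is_rep_map(1)[OF rep, of e] by (simp add: linear_map_between_def)
      then show ?thesis using zero[of "snd (\<Lambda> e)"] True loops[of e] by auto
    next
      case False
      then show ?thesis using u is_rep_map(2)[OF rep] by (simp add: conc_def)
    qed
    moreover have "0 \<in> conc D (snd (\<Lambda> e))" using D by (simp add: conc_def amb.subspace_0)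
    ultimately show "map_at M e ` conc D (fst (\<Lambda> e)) \<subseteq> conc D (snd (\<Lambda> e))" by auto
  qed (use D is_rep_space(3)[OF rep] in \<open>auto simp: conc_def\<close>)
  have "internal_direct_sum (conc (amb.span {v})) (conc C) M"
    unfolding internal_direct_sum_def
  proof
    fix z show "conc (amb.span {v}) z \<inter> conc C z = {0} \<and>
        space_at M z = {a + b | a b. a \<in> conc (amb.span {v}) z \<and> b \<in> conc C z}"
      using C(3,4) zero[of z] by (cases "z = x") (simp_all add: conc_def)
  qed
  then have "decomposition \<Lambda> (conc (amb.span {v})) (conc C) M"
    unfolding decomposition_def using conc_subrep amb.subspace_span line C(1,2) by blast
  then have "(\<forall>z. conc (amb.span {v}) z = {0}) \<or> (\<forall>z. conc C z = {0})"
    using ind unfolding indecomposable_iff by blast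
  moreover have "v \<in> conc (amb.span {v}) x" by (simp add: conc_def amb.span_base)
  ultimately have "conc C x = {0}" using v(2) by blast
  then have "space_at M x = amb.span {v}" using C(4) by (simp add: conc_def)
  then have "amb.dim (space_at M z) = (if z = x then 1 else 0)" for z
    using dim_nonzero_line[OF v(2)] zero[of z] by (simp add: dim_zero_space)
  then show ?thesis by (simp add: dim_vector_def vec_eq_iff axis_def)
qed

text \<open>A complement in the space at the sink of the image of all arrows is a direct summand, because no
  arrow leaves the sink. Unless the module is the simple one at the sink, the image is everything.\<close>

lemma incoming_sum_surjective:
  fixes M :: "('v::finite, 'e::finite, 'k::field) representation"
  assumes ind: "indecomposable \<Lambda> M" and loops: "\<And>e. fst (\<Lambda> e) \<noteq> snd (\<Lambda> e)"
    and x: "sink \<Lambda> x" and not_simple: "dim_vector M \<noteq> axis x 1"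
  shows "incoming_sum \<Lambda> x M ` incoming \<Lambda> x (space_at M) = space_at M x"
proof -
  have rep: "is_rep \<Lambda> M" using ind by (simp add: indecomposable_def)
  have sub: "amb.subspace (space_at M z)" for z by (rule is_rep_space(1)[OF rep])
  have src: "fst (\<Lambda> e) \<noteq> x" for e using x by (simp add: sink_def)
  define R where "R = incoming_sum \<Lambda> x M ` incoming \<Lambda> x (space_at M)"
  have R: "amb.subspace R" "R \<subseteq> space_at M x"
    using linear_map_image_subspace[OF incoming_subspace[of "space_at M", OF sub] incoming_sum_linear[OF rep]]
      incoming_sum_linear[OF rep] by (auto simp: R_def linear_map_between_def)
  obtain C where C: "amb.subspace C" "C \<subseteq> space_at M x" "R \<inter> C = {0}"
      "space_at M x = {a + c | a c. a \<in> R \<and> c \<in> C}"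
    by (rule exists_complement[OF R(1) sub R(2)])
  define A where "A = (space_at M)(x := R)"
  define B where "B = (\<lambda>z. {0} :: ('e, 'k) ambient set)(x := C)"
  have "map_at M e ` A (fst (\<Lambda> e)) \<subseteq> A (snd (\<Lambda> e))" for e
  proof (cases "snd (\<Lambda> e) = x")
    case True
    have "map_at M e u \<in> R" if u: "u \<in> space_at M (fst (\<Lambda> e))" for u
    proof -
      have "tuple {e} (\<lambda>_. u) \<in> incoming \<Lambda> x (space_at M)"
        unfolding incoming_def by (rule singleton_in_family_space) (use True u sub in auto)
      then show ?thesis unfolding R_def incoming_sum_singleton[OF rep True, of u, symmetric] by blast
    qed
    then show ?thesis using True src[of e] by (auto simp: A_def)
  next
    case False
    then show ?thesis using src[of e] is_rep_map(1)[OF rep, of e]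
      by (auto simp: A_def linear_map_between_def)
  qed
  then have "subrep \<Lambda> A M" using R sub by (auto simp: subrep_def A_def)
  moreover have "subrep \<Lambda> B M"
    using C(1,2) src is_rep_map(2)[OF rep] is_rep_space(3)[OF rep]
    by (auto simp: subrep_def B_def amb.subspace_0)
  moreover have "internal_direct_sum A B M"
    unfolding internal_direct_sum_def
  proof
    fix z show "A z \<inter> B z = {0} \<and> space_at M z = {a + b | a b. a \<in> A z \<and> b \<in> B z}"
      using C(3,4) is_rep_space(3)[OF rep, of z] by (cases "z = x") (simp_all add: A_def B_def)
  qed
  ultimately have "decomposition \<Lambda> A B M" by (simp add: decomposition_def)
  then have "(\<forall>z. A z = {0}) \<or> (\<forall>z. B z = {0})" using ind unfolding indecomposable_iff by blast
  then show ?thesis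
  proof
    assume A: "\<forall>z. A z = {0}"
    have "space_at M z = {0}" if "z \<noteq> x" for z using A that by (auto simp: A_def dest: spec[of _ z])
    then have "dim_vector M = axis x 1" by (rule dim_vector_one_vertex[OF ind loops])
    then show ?thesis using not_simple by simp
  next
    assume B: "\<forall>z. B z = {0}"
    then have "C = {0}" by (auto simp: B_def dest: spec[of _ x])
    then have "space_at M x = R" using C(4) by simp
    then show ?thesis by (simp add: R_def)
  qed
qed

lemma incoming_direct_sum:
  assumes "internal_direct_sum A B M" "sink \<Lambda> x"
  shows "incoming \<Lambda> x A \<inter> incoming \<Lambda> x B \<subseteq> {0}"
    and "w \<in> incoming \<Lambda> x (space_at M) \<Longrightarrow> \<exists>a\<in>incoming \<Lambda> x A. \<exists>b\<in>incoming \<Lambda> x B. w = a + b"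
  unfolding incoming_def
  by (rule family_space_direct_sum(1), rule direct_sum_parts(1)[OF assms(1)])
    (rule direct_sum_parts(2)[OF assms(1)],
     rule family_space_direct_sum(2)[OF direct_sum_parts(1)[OF assms(1)] direct_sum_parts(2)[OF assms(1)]])

lemma reflect_rep_space:
  "space_at (reflect_rep \<Lambda> x M) z = (if z = x then reflection_kernel \<Lambda> x M else space_at M z)"
  by (simp add: reflect_rep_def)

lemma reflect_rep_map:
  "map_at (reflect_rep \<Lambda> x M) e = (if snd (\<Lambda> e) = x then component e else map_at M e)"
  by (simp add: reflect_rep_def)

text \<open>The way back from a subrepresentation of the reflected representation to one of the original: at the
  sink take what arrives from the neighbours.\<close>

definition push_subrep where
  "push_subrep \<Lambda> x M A = (\<lambda>z. if z = x then incoming_sum \<Lambda> x M ` incoming \<Lambda> x A else A z)"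

lemma subrep_in_incoming:
  assumes x: "sink \<Lambda> x" and A: "subrep (reverse_at x \<Lambda>) A (reflect_rep \<Lambda> x M)"
  shows "A x \<subseteq> incoming \<Lambda> x A"
proof
  fix w assume w: "w \<in> A x"
  then have "w \<in> reflection_kernel \<Lambda> x M" using subrep_space(2)[OF A, of x] by (auto simp: reflect_rep_space)
  then have *: "w [] = 0" "\<And>e. snd (\<Lambda> e) \<noteq> x \<Longrightarrow> component e w = 0"
    by (auto simp: reflection_kernel_incoming incoming_def family_space_def)
  have "component e w \<in> A (fst (\<Lambda> e))" if "snd (\<Lambda> e) = x" for e
  proof -
    have "map_at (reflect_rep \<Lambda> x M) e ` A (fst (reverse_at x \<Lambda> e)) \<subseteq> A (snd (reverse_at x \<Lambda> e))"
      using A by (simp add: subrep_def)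
    then show ?thesis using that w by (auto simp: reflect_rep_map reverse_at_def)
  qed
  then show "w \<in> incoming \<Lambda> x A" using * by (simp add: incoming_def family_space_def)
qed

lemma subrep_incoming_mono:
  assumes "sink \<Lambda> x" "subrep (reverse_at x \<Lambda>) A (reflect_rep \<Lambda> x M)"
  shows "incoming \<Lambda> x A \<subseteq> incoming \<Lambda> x (space_at M)"
proof -
  have "incoming \<Lambda> x A \<subseteq> incoming \<Lambda> x (space_at (reflect_rep \<Lambda> x M))"
    by (rule incoming_mono) (use assms(2) in \<open>simp add: subrep_def\<close>)
  also have "\<dots> = incoming \<Lambda> x (space_at M)"
    by (rule incoming_cong[OF assms(1)]) (simp add: reflect_rep_space)
  finally show ?thesis .
qed

lemma push_subrep_is_subrep:
  assumes rep: "is_rep \<Lambda> M" and x: "sink \<Lambda> x"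
    and A: "subrep (reverse_at x \<Lambda>) A (reflect_rep \<Lambda> x M)"
  shows "subrep \<Lambda> (push_subrep \<Lambda> x M A) M"
proof -
  have src: "fst (\<Lambda> e) \<noteq> x" for e using x by (simp add: sink_def)
  have subA: "amb.subspace (A z)" for z using A by (simp add: subrep_def)
  have subM: "A z \<subseteq> space_at M z" if "z \<noteq> x" for z
    using subrep_space(2)[OF A, of z] that by (simp add: reflect_rep_space)
  have inc: "incoming \<Lambda> x A \<subseteq> incoming \<Lambda> x (space_at M)" by (rule subrep_incoming_mono[OF x A])
  have lin: "linear_map_between (incoming \<Lambda> x A) (space_at M x) (incoming_sum \<Lambda> x M)"
    using incoming_sum_linear[OF rep, of x] inc unfolding linear_map_between_def by blast
  have "amb.subspace (push_subrep \<Lambda> x M A z)" for z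
    using subA linear_map_image_subspace[OF incoming_subspace[of A, OF subA] lin]
    by (simp add: push_subrep_def)
  moreover have "push_subrep \<Lambda> x M A z \<subseteq> space_at M z" for z
    using subM[of z] lin by (auto simp: push_subrep_def linear_map_between_def)
  moreover have "map_at M e ` push_subrep \<Lambda> x M A (fst (\<Lambda> e)) \<subseteq> push_subrep \<Lambda> x M A (snd (\<Lambda> e))" for e
  proof (cases "snd (\<Lambda> e) = x")
    case True
    have "map_at M e u \<in> incoming_sum \<Lambda> x M ` incoming \<Lambda> x A" if u: "u \<in> A (fst (\<Lambda> e))" for u
    proof -
      have "tuple {e} (\<lambda>_. u) \<in> incoming \<Lambda> x A"
        unfolding incoming_def by (rule singleton_in_family_space) (use True u subA in auto)
      then show ?thesis unfolding incoming_sum_singleton[OF rep True, of u, symmetric] by blast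
    qed
    then show ?thesis using True src[of e] by (auto simp: push_subrep_def)
  next
    case False
    have "map_at (reflect_rep \<Lambda> x M) e ` A (fst (reverse_at x \<Lambda> e)) \<subseteq> A (snd (reverse_at x \<Lambda> e))"
      using A by (simp add: subrep_def)
    then show ?thesis
      using False src[of e] by (simp add: push_subrep_def reflect_rep_map reverse_at_def)
  qed
  ultimately show ?thesis by (simp add: subrep_def)
qed

text \<open>The only point at issue is the intersection at the sink. If \<open>a\<close> and \<open>b\<close> have the same image, then
  \<open>a - b\<close> lies in the kernel, that is, in the reflected space, which decomposes too. Comparing the
  decompositions puts \<open>a\<close> into the kernel.\<close>

lemma push_direct_sum:
  assumes rep: "is_rep \<Lambda> M" and x: "sink \<Lambda> x"
    and surj: "incoming_sum \<Lambda> x M ` incoming \<Lambda> x (space_at M) = space_at M x"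
    and dec: "decomposition (reverse_at x \<Lambda>) A B (reflect_rep \<Lambda> x M)"
  shows "internal_direct_sum (push_subrep \<Lambda> x M A) (push_subrep \<Lambda> x M B) M"
proof -
  let ?N = "reflect_rep \<Lambda> x M" and ?h = "incoming_sum \<Lambda> x M"
  have A: "subrep (reverse_at x \<Lambda>) A ?N" and B: "subrep (reverse_at x \<Lambda>) B ?N"
    and AB: "internal_direct_sum A B ?N" using dec by (simp_all add: decomposition_def)
  have subA: "amb.subspace (A z)" and subB: "amb.subspace (B z)" for z
    using A B by (simp_all add: subrep_def)
  have incN: "incoming \<Lambda> x (space_at ?N) = incoming \<Lambda> x (space_at M)"
    by (rule incoming_cong[OF x]) (simp add: reflect_rep_space)
  note inc_sum = incoming_direct_sum[OF AB x, unfolded incN]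
  have incA: "incoming \<Lambda> x A \<subseteq> incoming \<Lambda> x (space_at M)" and incB: "incoming \<Lambda> x B \<subseteq> incoming \<Lambda> x (space_at M)"
    using subrep_incoming_mono[OF x] A B by blast+
  have h_add: "?h (u + w) = ?h u + ?h w"
    if "u \<in> incoming \<Lambda> x (space_at M)" "w \<in> incoming \<Lambda> x (space_at M)" for u w
    using incoming_sum_linear[OF rep, of x] that by (simp add: linear_map_between_def)
  have sub_inc: "amb.subspace (incoming \<Lambda> x (space_at M))" "amb.subspace (incoming \<Lambda> x A)" "amb.subspace (incoming \<Lambda> x B)"
    using is_rep_space(1)[OF rep] subA subB by (auto intro: incoming_subspace)
  have zero: "?h a = 0" if a: "a \<in> incoming \<Lambda> x A" and b: "b \<in> incoming \<Lambda> x B" and eq: "?h a = ?h b" for a b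
  proof -
    have mem: "a \<in> incoming \<Lambda> x (space_at M)" "b \<in> incoming \<Lambda> x (space_at M)"
      using a b incA incB by blast+
    then have diff: "a - b \<in> incoming \<Lambda> x (space_at M)" using amb.subspace_diff[OF sub_inc(1)] by blast
    have "?h a = ?h (a - b) + ?h b" using h_add[OF diff mem(2)] by simp
    then have "?h (a - b) = 0" using eq by simp
    then have "a - b \<in> space_at ?N x" using diff by (simp add: reflect_rep_space reflection_kernel_incoming)
    then obtain a' b' where ab': "a - b = a' + b'" "a' \<in> A x" "b' \<in> B x"
      using direct_sum_parts(2)[OF AB, of x] by blast
    have "a - a' = b + b'" using ab'(1) by (metis add_diff_cancel_left' add_diff_eq diff_add_cancel diff_add_eq diff_diff_eq2)
    moreover have "a - a' \<in> incoming \<Lambda> x A"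
      using a ab'(2) subrep_in_incoming[OF x A] amb.subspace_diff[OF sub_inc(2)] by blast
    moreover have "b + b' \<in> incoming \<Lambda> x B"
      using b ab'(3) subrep_in_incoming[OF x B] amb.subspace_add[OF sub_inc(3)] by blast
    ultimately have "a - a' = 0" using inc_sum(1) by auto
    then have "a \<in> A x" using ab'(2) by simp
    then have "a \<in> space_at ?N x" using subrep_space(2)[OF A] by blast
    then show ?thesis by (simp add: reflect_rep_space reflection_kernel_incoming)
  qed
  have atx: "?h ` incoming \<Lambda> x A \<inter> ?h ` incoming \<Lambda> x B = {0}"
  proof
    show "?h ` incoming \<Lambda> x A \<inter> ?h ` incoming \<Lambda> x B \<subseteq> {0}" using zero by auto
    have "?h 0 = 0" by (rule linear_map_between_zero[OF incoming_sum_linear[OF rep] sub_inc(1)])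
    then show "{0} \<subseteq> ?h ` incoming \<Lambda> x A \<inter> ?h ` incoming \<Lambda> x B"
      using sub_inc(2,3)[THEN amb.subspace_0] by force
  qed
  have sumx: "space_at M x = {a + b | a b. a \<in> ?h ` incoming \<Lambda> x A \<and> b \<in> ?h ` incoming \<Lambda> x B}"
  proof
    show "space_at M x \<subseteq> {a + b | a b. a \<in> ?h ` incoming \<Lambda> x A \<and> b \<in> ?h ` incoming \<Lambda> x B}"
    proof
      fix v assume "v \<in> space_at M x"
      then obtain w where w: "w \<in> incoming \<Lambda> x (space_at M)" "v = ?h w" using surj by blast
      obtain a b where ab: "a \<in> incoming \<Lambda> x A" "b \<in> incoming \<Lambda> x B" "w = a + b"
        using inc_sum(2)[OF w(1)] by blast
      then have "v = ?h a + ?h b" using w(2) h_add incA incB by blast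
      then show "v \<in> {a + b | a b. a \<in> ?h ` incoming \<Lambda> x A \<and> b \<in> ?h ` incoming \<Lambda> x B}"
        using ab by blast
    qed
    have "?h ` incoming \<Lambda> x A \<subseteq> space_at M x" "?h ` incoming \<Lambda> x B \<subseteq> space_at M x"
      using incA incB surj by blast+
    then show "{a + b | a b. a \<in> ?h ` incoming \<Lambda> x A \<and> b \<in> ?h ` incoming \<Lambda> x B} \<subseteq> space_at M x"
      using amb.subspace_add[OF is_rep_space(1)[OF rep]] by blast
  qed
  show ?thesis
    unfolding internal_direct_sum_def
  proof
    fix z
    show "push_subrep \<Lambda> x M A z \<inter> push_subrep \<Lambda> x M B z = {0} \<and>
        space_at M z = {a + b | a b. a \<in> push_subrep \<Lambda> x M A z \<and> b \<in> push_subrep \<Lambda> x M B z}"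
    proof (cases "z = x")
      case True
      then show ?thesis using atx sumx by (simp add: push_subrep_def)
    next
      case False
      then show ?thesis using direct_sum_parts(1,2)[OF AB, of z]
        by (simp add: push_subrep_def reflect_rep_space)
    qed
  qed
qed

lemma incoming_trivial:
  assumes "sink \<Lambda> x" "\<And>z. z \<noteq> x \<Longrightarrow> A z = {0}"
  shows "incoming \<Lambda> x A \<subseteq> {0}"
proof
  fix w assume w: "w \<in> incoming \<Lambda> x A"
  then have z: "component e w = 0" for e
    using assms by (cases "snd (\<Lambda> e) = x") (auto simp: incoming_def family_space_def sink_def)
  have "w = 0"
    by (rule ambient_eqI) (use w in \<open>simp_all add: z component_zero incoming_def family_space_def\<close>)
  then show "w \<in> {0}" by simp
qed

lemma push_zero_imp_zero:
  assumes x: "sink \<Lambda> x" and A: "subrep (reverse_at x \<Lambda>) A (reflect_rep \<Lambda> x M)"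
    and zero: "\<And>z. push_subrep \<Lambda> x M A z = {0}"
  shows "A z = {0}"
proof (cases "z = x")
  case True
  have "A u = {0}" if "u \<noteq> x" for u using zero[of u] that by (simp add: push_subrep_def)
  then have "incoming \<Lambda> x A \<subseteq> {0}" by (rule incoming_trivial[OF x])
  then have "A x \<subseteq> {0}" using subrep_in_incoming[OF x A] by blast
  moreover have "0 \<in> A x" using A by (simp add: subrep_def amb.subspace_0)
  ultimately show ?thesis using True by blast
next
  case False
  then show ?thesis using zero[of z] by (simp add: push_subrep_def)
qed

text \<open>A decomposition of the reflected representation can be pushed back to the original one, where one
  of the summands must vanish; then it vanishes already before, as the space at the sink of the
  reflected representation consists of families of vectors at the neighbours.\<close>

lemma reflect_indecomposable:
  assumes ind: "indecomposable \<Lambda> M" and x: "sink \<Lambda> x"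
    and surj: "incoming_sum \<Lambda> x M ` incoming \<Lambda> x (space_at M) = space_at M x"
  shows "indecomposable (reverse_at x \<Lambda>) (reflect_rep \<Lambda> x M)"
proof -
  have rep: "is_rep \<Lambda> M" using ind by (simp add: indecomposable_def)
  have "\<not> zero_rep (reflect_rep \<Lambda> x M)"
  proof
    assume zero: "zero_rep (reflect_rep \<Lambda> x M)"
    have z: "space_at M u = {0}" if "u \<noteq> x" for u
      using zero that unfolding zero_rep_def reflect_rep_space by metis
    then have "incoming \<Lambda> x (space_at M) \<subseteq> {0}" by (rule incoming_trivial[OF x])
    moreover have "incoming_sum \<Lambda> x M 0 = 0"
      by (rule linear_map_between_zero[OF incoming_sum_linear[OF rep] incoming_subspace[OF is_rep_space(1)[OF rep]]])
    ultimately have "space_at M x \<subseteq> {0}" unfolding surj[symmetric] by blast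
    then have "space_at M x = {0}" using is_rep_space(3)[OF rep] by blast
    then have "zero_rep M" unfolding zero_rep_def using z by metis
    then show False using ind by (simp add: indecomposable_def)
  qed
  moreover have "(\<forall>z. A z = {0}) \<or> (\<forall>z. B z = {0})"
    if dec: "decomposition (reverse_at x \<Lambda>) A B (reflect_rep \<Lambda> x M)" for A B
  proof -
    have A: "subrep (reverse_at x \<Lambda>) A (reflect_rep \<Lambda> x M)" and B: "subrep (reverse_at x \<Lambda>) B (reflect_rep \<Lambda> x M)"
      using dec by (simp_all add: decomposition_def)
    have "decomposition \<Lambda> (push_subrep \<Lambda> x M A) (push_subrep \<Lambda> x M B) M"
      using push_subrep_is_subrep[OF rep x A] push_subrep_is_subrep[OF rep x B] push_direct_sum[OF rep x surj dec]
      by (simp add: decomposition_def)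
    then have "(\<forall>z. push_subrep \<Lambda> x M A z = {0}) \<or> (\<forall>z. push_subrep \<Lambda> x M B z = {0})"
      using ind unfolding indecomposable_iff by blast
    then show ?thesis
    proof
      assume zero: "\<forall>z. push_subrep \<Lambda> x M A z = {0}"
      have "A z = {0}" for z by (rule push_zero_imp_zero[OF x A]) (rule zero[rule_format])
      then show ?thesis by simp
    next
      assume zero: "\<forall>z. push_subrep \<Lambda> x M B z = {0}"
      have "B z = {0}" for z by (rule push_zero_imp_zero[OF x B]) (rule zero[rule_format])
      then show ?thesis by simp
    qed
  qed
  ultimately show ?thesis
    unfolding indecomposable_iff using is_rep_reflect_rep[OF rep x] by blast
qed

text \<open>Rank-nullity for the surjective map onto the space at the sink gives the coordinate that the simple
  reflection prescribes.\<close>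

lemma dim_vector_reflect:
  fixes \<Gamma> :: "('v::finite, 'e::finite) graph" and M :: "('v, 'e, 'k::field) representation"
  assumes graph: "loopfree_graph \<Gamma>" "orientation_of \<Gamma> \<Lambda>" and x: "sink \<Lambda> x" and rep: "is_rep \<Lambda> M"
    and surj: "incoming_sum \<Lambda> x M ` incoming \<Lambda> x (space_at M) = space_at M x"
  shows "dim_vector (reflect_rep \<Lambda> x M) = simple_reflection \<Gamma> x (dim_vector M)"
proof -
  note sp = is_rep_space[OF rep]
  have fin: "finite_dim (incoming \<Lambda> x (space_at M))"
    unfolding incoming_def by (rule finite_dim_family_space) (rule sp(2))
  have "amb.dim (incoming \<Lambda> x (space_at M)) = amb.dim (reflection_kernel \<Lambda> x M) + amb.dim (space_at M x)"
    using rank_nullity_between[OF incoming_subspace[OF sp(1)] fin incoming_sum_linear[OF rep]]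
    by (simp add: surj reflection_kernel_incoming)
  then have "(\<Sum>e | snd (\<Lambda> e) = x. int (amb.dim (space_at M (fst (\<Lambda> e)))))
      = int (amb.dim (reflection_kernel \<Lambda> x M)) + int (amb.dim (space_at M x))"
    unfolding dim_incoming[of "space_at M", OF sp(1,2)] by (metis of_nat_add of_nat_sum)
  then show ?thesis
    by (simp add: vec_eq_iff reflection_at_sink[OF graph x] dim_vector_def reflect_rep_space)
qed

text \<open>All arrows into the sink start at zero spaces, so the direct sum and the kernel in it are zero.\<close>

lemma reflect_simple_zero:
  fixes M :: "('v::finite, 'e::finite, 'k::field) representation"
  assumes x: "sink \<Lambda> x" and rep: "is_rep \<Lambda> M" and zero: "\<And>z. z \<noteq> x \<Longrightarrow> space_at M z = {0}"
  shows "zero_rep (reflect_rep \<Lambda> x M)"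
proof -
  have "reflection_kernel \<Lambda> x M \<subseteq> {0}"
    using incoming_trivial[of \<Lambda> x "space_at M", OF x zero] unfolding reflection_kernel_incoming by blast
  moreover have "0 \<in> reflection_kernel \<Lambda> x M"
    using is_rep_space(3)[OF is_rep_reflect_rep[OF rep x], of x] by (simp add: reflect_rep_space)
  ultimately show ?thesis using zero by (auto simp: zero_rep_def reflect_rep_space)
qed

section \<open>The negative reflection of an indecomposable representation\<close>

text \<open>For the reversed orientation \<open>x\<close> is a source; this is the map from its space into the direct sum of
  the spaces at its neighbours.\<close>

definition outgoing_vector :: "('v, 'e) orientation \<Rightarrow> 'v \<Rightarrow> ('v, 'e, 'k::field) representation \<Rightarrow>
    ('e, 'k) ambient \<Rightarrow> ('e, 'k) ambient" where
  "outgoing_vector \<Lambda> x N n = tuple {e. snd (\<Lambda> e) = x} (\<lambda>e. map_at N e n)"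

text \<open>The negative reflection functor on objects. It takes the cokernel of the map into the direct sum; here
  the cokernel is the image of a map \<open>\<pi>\<close> on the direct sum that has the right kernel.\<close>

definition negative_reflection :: "('v, 'e) orientation \<Rightarrow> 'v \<Rightarrow>
    (('e, 'k) ambient \<Rightarrow> ('e, 'k) ambient) \<Rightarrow> ('v, 'e, 'k::field) representation \<Rightarrow>
    ('v, 'e, 'k) representation" where
  "negative_reflection \<Lambda> x \<pi> N =
     \<lparr> space_at = (space_at N)(x := \<pi> ` incoming \<Lambda> x (space_at N)),
       map_at = (\<lambda>e. if snd (\<Lambda> e) = x then (\<lambda>u. \<pi> (tuple {e} (\<lambda>_. u))) else map_at N e) \<rparr>"

lemma reverse_at_sink:
  assumes "sink \<Lambda> x"
  shows "reverse_at x \<Lambda> e = (if snd (\<Lambda> e) = x then (x, fst (\<Lambda> e)) else \<Lambda> e)"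
  using assms by (auto simp: reverse_at_def sink_def)

context
  fixes \<Lambda> :: "('v::finite, 'e::finite) orientation" and x :: 'v
    and N :: "('v, 'e, 'k::field) representation"
  assumes x: "sink \<Lambda> x" and rep: "is_rep (reverse_at x \<Lambda>) N"
begin

lemma sink_not_source: "fst (\<Lambda> e) \<noteq> x"
  using x by (simp add: sink_def)

lemma map_along_reversed:
  assumes "snd (\<Lambda> e) = x"
  shows "linear_map_between (space_at N x) (space_at N (fst (\<Lambda> e))) (map_at N e)"
  using is_rep_map(1)[OF rep, of e] assms by (simp add: reverse_at_sink[OF x])

lemma map_along_other:
  assumes "snd (\<Lambda> e) \<noteq> x"
  shows "linear_map_between (space_at N (fst (\<Lambda> e))) (space_at N (snd (\<Lambda> e))) (map_at N e)"
  using is_rep_map(1)[OF rep, of e] assms by (simp add: reverse_at_sink[OF x])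

lemma outgoing_linear:
  "linear_map_between (space_at N x) (incoming \<Lambda> x (space_at N)) (outgoing_vector \<Lambda> x N)"
  unfolding linear_map_between_def
proof (intro conjI ballI allI)
  fix n assume n: "n \<in> space_at N x"
  show "outgoing_vector \<Lambda> x N n \<in> incoming \<Lambda> x (space_at N)"
    unfolding outgoing_vector_def incoming_def
    by (rule tuple_in_family_space) (use map_along_reversed n in \<open>auto simp: linear_map_between_def\<close>)
  fix c
  show "outgoing_vector \<Lambda> x N (ascale c n) = ascale c (outgoing_vector \<Lambda> x N n)"
    by (rule ambient_eqI)
      (use map_along_reversed n in \<open>auto simp: outgoing_vector_def tuple_Nil component_tuple component_scale ascale_Nil linear_map_between_def\<close>)
next
  fix m n assume "m \<in> space_at N x" "n \<in> space_at N x"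
  then show "outgoing_vector \<Lambda> x N (m + n) = outgoing_vector \<Lambda> x N m + outgoing_vector \<Lambda> x N n"
    by (intro ambient_eqI[of "outgoing_vector \<Lambda> x N (m + n)"])
      (use map_along_reversed in \<open>auto simp: outgoing_vector_def tuple_Nil component_tuple component_add linear_map_between_def\<close>)
qed

lemma incoming_N_subspace: "amb.subspace (incoming \<Lambda> x (space_at N))"
  by (rule incoming_subspace) (rule is_rep_space(1)[OF rep])

text \<open>Dual to the surjectivity at a sink: the common kernel of all arrows that leave a source is a direct
  summand.\<close>

lemma outgoing_injective:
  assumes ind: "indecomposable (reverse_at x \<Lambda>) N" and loops: "\<And>e. fst (\<Lambda> e) \<noteq> snd (\<Lambda> e)"
    and not_simple: "dim_vector N \<noteq> axis x 1"
    and n: "n \<in> space_at N x" and zero: "outgoing_vector \<Lambda> x N n = 0"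
  shows "n = 0"
proof (rule ccontr)
  assume "n \<noteq> 0"
  note sub = is_rep_space(1)[OF rep]
  obtain g where g: "amb_linear g" "\<And>v. v \<in> space_at N x \<Longrightarrow> g v = outgoing_vector \<Lambda> x N v"
    using linear_map_extends[OF sub outgoing_linear] by blast
  define K where "K = {v \<in> space_at N x. outgoing_vector \<Lambda> x N v = 0}"
  have "K = space_at N x \<inter> {v. g v = 0}" using g(2) by (auto simp: K_def)
  then have K: "amb.subspace K" "K \<subseteq> space_at N x"
    using amb.subspace_inter[OF sub amb_pair.linear_subspace_kernel[OF g(1)]] by auto
  obtain C where C: "amb.subspace C" "C \<subseteq> space_at N x" "K \<inter> C = {0}"
      "space_at N x = {a + c | a c. a \<in> K \<and> c \<in> C}"
    by (rule exists_complement[OF K(1) sub K(2)])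
  define A where "A = (\<lambda>z. {0} :: ('e, 'k) ambient set)(x := K)"
  define B where "B = (space_at N)(x := C)"
  have K0: "map_at N e k = 0" if "k \<in> K" "snd (\<Lambda> e) = x" for e k
  proof -
    have "component e (outgoing_vector \<Lambda> x N k) = 0" using that by (simp add: K_def component_zero)
    then show ?thesis using that(2) by (simp add: outgoing_vector_def component_tuple)
  qed
  have "map_at N e ` A (fst (reverse_at x \<Lambda> e)) \<subseteq> A (snd (reverse_at x \<Lambda> e))" for e
    using K0 sink_not_source is_rep_map(2)[OF rep] by (auto simp: A_def reverse_at_sink[OF x])
  then have "subrep (reverse_at x \<Lambda>) A N"
    using K is_rep_space(3)[OF rep] by (auto simp: subrep_def A_def)
  moreover have "map_at N e ` B (fst (reverse_at x \<Lambda> e)) \<subseteq> B (snd (reverse_at x \<Lambda> e))" for e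
  proof (cases "snd (\<Lambda> e) = x")
    case True
    then show ?thesis using map_along_reversed[OF True] C(2) sink_not_source[of e]
      by (auto simp: B_def reverse_at_sink[OF x] linear_map_between_def)
  next
    case False
    then show ?thesis using map_along_other[OF False] sink_not_source[of e]
      by (auto simp: B_def reverse_at_sink[OF x] linear_map_between_def)
  qed
  then have "subrep (reverse_at x \<Lambda>) B N"
    using C(1,2) sub by (auto simp: subrep_def B_def)
  moreover have "internal_direct_sum A B N"
    unfolding internal_direct_sum_def
  proof
    fix z show "A z \<inter> B z = {0} \<and> space_at N z = {a + b | a b. a \<in> A z \<and> b \<in> B z}"
      using C(3,4) is_rep_space(3)[OF rep, of z] by (cases "z = x") (simp_all add: A_def B_def)
  qed
  ultimately have "decomposition (reverse_at x \<Lambda>) A B N" by (simp add: decomposition_def)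
  then have "(\<forall>z. A z = {0}) \<or> (\<forall>z. B z = {0})" using ind unfolding indecomposable_iff by blast
  moreover have "n \<in> A x" using n zero by (simp add: A_def K_def)
  ultimately have B: "B z = {0}" for z using \<open>n \<noteq> 0\<close> by blast
  have "dim_vector N = axis x 1"
  proof (rule dim_vector_one_vertex[OF ind])
    show "fst (reverse_at x \<Lambda> e) \<noteq> snd (reverse_at x \<Lambda> e)" for e
      using loops[of e] sink_not_source[of e] by (simp add: reverse_at_sink[OF x])
    show "space_at N z = {0}" if "z \<noteq> x" for z using B[of z] that by (simp add: B_def)
  qed
  then show False using not_simple by simp
qed

context
  fixes \<pi> :: "('e, 'k) ambient \<Rightarrow> ('e, 'k) ambient" and M
  assumes lin: "amb_linear \<pi>"
    and ker: "\<And>w. w \<in> incoming \<Lambda> x (space_at N) \<Longrightarrow>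
      \<pi> w = 0 \<longleftrightarrow> w \<in> outgoing_vector \<Lambda> x N ` space_at N x"
    and inj: "\<And>n. n \<in> space_at N x \<Longrightarrow> outgoing_vector \<Lambda> x N n = 0 \<Longrightarrow> n = 0"
  defines "M \<equiv> negative_reflection \<Lambda> x \<pi> N"
begin

lemma negative_reflection_space: "space_at M z = (if z = x then \<pi> ` incoming \<Lambda> x (space_at N) else space_at N z)"
  by (simp add: M_def negative_reflection_def)

lemma negative_reflection_map: "map_at M e = (if snd (\<Lambda> e) = x then (\<lambda>u. \<pi> (tuple {e} (\<lambda>_. u))) else map_at N e)"
  by (simp add: M_def negative_reflection_def)

lemma finite_dim_incoming: "finite_dim (incoming \<Lambda> x (space_at N))"
  unfolding incoming_def by (rule finite_dim_family_space) (rule is_rep_space(2)[OF rep])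

lemma negative_reflection_is_rep: "is_rep \<Lambda> M"
  unfolding is_rep_def finite_dim_def[symmetric]
proof (intro conjI allI)
  fix z
  show "amb.subspace (space_at M z)"
    using is_rep_space(1)[OF rep] amb_pair.linear_subspace_image[OF lin incoming_N_subspace]
    by (simp add: negative_reflection_space)
  show "finite_dim (space_at M z)"
    using is_rep_space(2)[OF rep] finite_dim_image[OF finite_dim_incoming lin] by (simp add: negative_reflection_space)
next
  fix e
  show "linear_map_between (space_at M (fst (\<Lambda> e))) (space_at M (snd (\<Lambda> e))) (map_at M e)"
  proof (cases "snd (\<Lambda> e) = x")
    case True
    have "tuple {e} (\<lambda>_. u) \<in> incoming \<Lambda> x (space_at N)" if "u \<in> space_at N (fst (\<Lambda> e))" for u
      unfolding incoming_def
      by (rule singleton_in_family_space) (use True that is_rep_space(1)[OF rep] in auto)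
    then show ?thesis
      using True sink_not_source[of e] amb_linear_singleton[of e]
      by (simp add: linear_map_between_def negative_reflection_space negative_reflection_map
          amb_pair.linear_add[OF lin] amb_pair.linear_scale[OF lin]
          amb_pair.linear_add[OF amb_linear_singleton[of e]] amb_pair.linear_scale[OF amb_linear_singleton[of e]])
  next
    case False
    then show ?thesis using map_along_other[OF False] sink_not_source[of e] by (simp add: negative_reflection_space negative_reflection_map)
  qed
qed

text \<open>Rank-nullity twice: the image of the injective map has the dimension of the old space at \<open>x\<close>, and the
  rest of the direct sum is the new one.\<close>

lemma negative_reflection_dim_vector:
  assumes graph: "loopfree_graph \<Gamma>" "orientation_of \<Gamma> \<Lambda>"
  shows "dim_vector M = simple_reflection \<Gamma> x (dim_vector N)"
proof -
  let ?D = "incoming \<Lambda> x (space_at N)" and ?h = "outgoing_vector \<Lambda> x N"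
  have hD: "?h ` space_at N x \<subseteq> ?D" using outgoing_linear by (auto simp: linear_map_between_def)
  have kerD: "{w \<in> ?D. \<pi> w = 0} = ?h ` space_at N x" using ker hD by blast
  have "?h 0 = 0"
    by (rule linear_map_between_zero[OF outgoing_linear is_rep_space(1)[OF rep]])
  then have "{n \<in> space_at N x. ?h n = 0} = {0}" using inj is_rep_space(3)[OF rep] by blast
  then have "amb.dim (space_at N x) = amb.dim (?h ` space_at N x)"
    using rank_nullity_between[OF is_rep_space(1,2)[OF rep, of x] outgoing_linear] by (simp add: dim_zero_space)
  then have "amb.dim ?D = amb.dim (space_at N x) + amb.dim (space_at M x)"
    using rank_nullity[OF incoming_N_subspace finite_dim_incoming lin] kerD by (simp add: negative_reflection_space)
  then have "(\<Sum>e | snd (\<Lambda> e) = x. int (amb.dim (space_at N (fst (\<Lambda> e)))))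
      = int (amb.dim (space_at N x)) + int (amb.dim (space_at M x))"
    unfolding dim_incoming[of "space_at N", OF is_rep_space(1,2)[OF rep]] by (metis of_nat_add of_nat_sum)
  then have "int (amb.dim (space_at M z)) = simple_reflection \<Gamma> x (dim_vector N) $ z" for z
    by (simp add: reflection_at_sink[OF graph x] dim_vector_def negative_reflection_space)
  then show ?thesis by (simp add: dim_vector_def vec_eq_iff)
qed

text \<open>The way from a subrepresentation of the negative reflection to one of the original: at the source
  take what the arrows map into the given spaces.\<close>

definition pull_subrep where
  "pull_subrep A = (\<lambda>z. if z = x
     then {n \<in> space_at N x. outgoing_vector \<Lambda> x N n \<in> incoming \<Lambda> x A} else A z)"

lemma pull_subrep_is_subrep:
  assumes A: "subrep \<Lambda> A M"
  shows "subrep (reverse_at x \<Lambda>) (pull_subrep A) N"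
proof -
  obtain g where g: "amb_linear g" "\<And>v. v \<in> space_at N x \<Longrightarrow> g v = outgoing_vector \<Lambda> x N v"
    using linear_map_extends[OF is_rep_space(1)[OF rep] outgoing_linear] by blast
  have "pull_subrep A x = space_at N x \<inter> {v. g v \<in> incoming \<Lambda> x A}"
    using g(2) by (auto simp: pull_subrep_def)
  then have "amb.subspace (pull_subrep A x)"
    using amb.subspace_inter[OF is_rep_space(1)[OF rep]
        amb_pair.linear_subspace_linear_preimage[OF g(1) incoming_subspace[of A, OF subrep_space(1)[OF A]]]]
    by simp
  then have "amb.subspace (pull_subrep A z)" for z
    using subrep_space(1)[OF A] by (cases "z = x") (simp_all add: pull_subrep_def)
  moreover have "pull_subrep A z \<subseteq> space_at N z" for z
    using subrep_space(2)[OF A, of z] by (auto simp: pull_subrep_def negative_reflection_space)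
  moreover have "map_at N e ` pull_subrep A (fst (reverse_at x \<Lambda> e)) \<subseteq> pull_subrep A (snd (reverse_at x \<Lambda> e))" for e
  proof (cases "snd (\<Lambda> e) = x")
    case True
    have "map_at N e n \<in> A (fst (\<Lambda> e))" if "outgoing_vector \<Lambda> x N n \<in> incoming \<Lambda> x A" for n
    proof -
      have "component e (outgoing_vector \<Lambda> x N n) \<in> A (fst (\<Lambda> e))"
        using that True by (simp add: incoming_def family_space_def)
      then show ?thesis using True by (simp add: outgoing_vector_def component_tuple)
    qed
    then show ?thesis using True sink_not_source[of e] by (auto simp: pull_subrep_def reverse_at_sink[OF x])
  next
    case False
    have "map_at M e ` A (fst (\<Lambda> e)) \<subseteq> A (snd (\<Lambda> e))" using A by (simp add: subrep_def)
    then show ?thesis using False sink_not_source[of e] by (simp add: pull_subrep_def reverse_at_sink[OF x] negative_reflection_map)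
  qed
  ultimately show ?thesis by (simp add: subrep_def)
qed

lemma incoming_M: "incoming \<Lambda> x (space_at M) = incoming \<Lambda> x (space_at N)"
  by (rule incoming_cong[OF x]) (simp add: negative_reflection_space)

text \<open>The projection of a family of vectors is the sum of their images under the arrows into \<open>x\<close>, and
  a subrepresentation contains these.\<close>

lemma projection_in_subrep:
  assumes A: "subrep \<Lambda> A M" and w: "w \<in> incoming \<Lambda> x A"
  shows "\<pi> w \<in> A x"
proof -
  have "w = (\<Sum>e | snd (\<Lambda> e) = x. tuple {e} (\<lambda>_. component e w))"
    using w unfolding incoming_def by (rule family_space_expand)
  then have "\<pi> w = \<pi> (\<Sum>e | snd (\<Lambda> e) = x. tuple {e} (\<lambda>_. component e w))"
    by (rule arg_cong)
  also have "\<dots> = (\<Sum>e | snd (\<Lambda> e) = x. \<pi> (tuple {e} (\<lambda>_. component e w)))"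
    by (rule amb_pair.linear_sum[OF lin])
  finally have "\<pi> w = (\<Sum>e | snd (\<Lambda> e) = x. \<pi> (tuple {e} (\<lambda>_. component e w)))" .
  moreover have "\<pi> (tuple {e} (\<lambda>_. component e w)) \<in> A x" if e: "snd (\<Lambda> e) = x" for e
  proof -
    have "component e w \<in> A (fst (\<Lambda> e))" using w e by (simp add: incoming_def family_space_def)
    moreover have "map_at M e ` A (fst (\<Lambda> e)) \<subseteq> A (snd (\<Lambda> e))" using A by (simp add: subrep_def)
    ultimately show ?thesis using e by (auto simp: negative_reflection_map)
  qed
  ultimately show ?thesis by (auto intro: amb.subspace_sum[OF subrep_space(1)[OF A]])
qed

text \<open>At the source, decompose the image of \<open>n\<close> in the direct sum as \<open>a + b\<close>. The projections of \<open>a\<close> and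
  \<open>b\<close> add up to zero and lie in complementary spaces, so both vanish. Hence \<open>a\<close> and \<open>b\<close> themselves come
  from the space at the source, and injectivity turns this into a decomposition of \<open>n\<close>.\<close>

lemma pull_direct_sum:
  assumes dec: "decomposition \<Lambda> A B M"
  shows "internal_direct_sum (pull_subrep A) (pull_subrep B) N"
proof -
  let ?h = "outgoing_vector \<Lambda> x N"
  have A: "subrep \<Lambda> A M" and B: "subrep \<Lambda> B M" and AB: "internal_direct_sum A B M"
    using dec by (simp_all add: decomposition_def)
  note inc_sum = incoming_direct_sum[OF AB x, unfolded incoming_M]
  have h_in: "?h n \<in> incoming \<Lambda> x (space_at N)" if "n \<in> space_at N x" for n
    using outgoing_linear that by (simp add: linear_map_between_def)
  have h_add: "?h (m + n) = ?h m + ?h n" if "m \<in> space_at N x" "n \<in> space_at N x" for m n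
    using outgoing_linear that by (simp add: linear_map_between_def)
  have incA: "incoming \<Lambda> x A \<subseteq> incoming \<Lambda> x (space_at N)" and incB: "incoming \<Lambda> x B \<subseteq> incoming \<Lambda> x (space_at N)"
    using incoming_mono[of A "space_at M" \<Lambda> x, OF subrep_space(2)[OF A]]
      incoming_mono[of B "space_at M" \<Lambda> x, OF subrep_space(2)[OF B]] by (simp_all only: incoming_M)
  have zero_in: "0 \<in> pull_subrep A x" "0 \<in> pull_subrep B x"
    using amb.subspace_0[OF subrep_space(1)[OF pull_subrep_is_subrep]] A B by blast+
  have inter: "pull_subrep A x \<inter> pull_subrep B x = {0}"
  proof -
    have "n = 0" if n: "n \<in> pull_subrep A x" "n \<in> pull_subrep B x" for n
    proof -
      have "?h n = 0" using n inc_sum(1) by (auto simp: pull_subrep_def)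
      then show ?thesis using n inj by (simp add: pull_subrep_def)
    qed
    then show ?thesis using zero_in by blast
  qed
  have "n \<in> {a + b | a b. a \<in> pull_subrep A x \<and> b \<in> pull_subrep B x}" if n: "n \<in> space_at N x" for n
  proof -
    obtain a b where ab: "a \<in> incoming \<Lambda> x A" "b \<in> incoming \<Lambda> x B" "?h n = a + b"
      using inc_sum(2)[OF h_in[OF n]] by blast
    have "\<pi> (?h n) = 0" using ker[OF h_in[OF n]] n by blast
    then have "\<pi> a + \<pi> b = 0" by (simp add: ab(3) amb_pair.linear_add[OF lin])
    then have "\<pi> a = - \<pi> b" by (rule eq_neg_iff_add_eq_0[THEN iffD2])
    moreover have "\<pi> a \<in> A x" "\<pi> b \<in> B x" using projection_in_subrep A B ab by blast+
    moreover have "- \<pi> b \<in> B x" using amb.subspace_neg[OF subrep_space(1)[OF B]] \<open>\<pi> b \<in> B x\<close> by blast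
    ultimately have "\<pi> a \<in> A x \<inter> B x" by simp
    then have "\<pi> a = 0" using direct_sum_parts(1)[OF AB, of x] by blast
    moreover have "\<pi> b = 0" using \<open>\<pi> a + \<pi> b = 0\<close> \<open>\<pi> a = 0\<close> by simp
    moreover have "a \<in> incoming \<Lambda> x (space_at N)" "b \<in> incoming \<Lambda> x (space_at N)"
      using ab(1,2) incA incB by blast+
    ultimately obtain p q where pq: "p \<in> space_at N x" "a = ?h p" "q \<in> space_at N x" "b = ?h q"
      using ker by blast
    have "?h (n - (p + q)) = 0"
    proof -
      have mem: "p + q \<in> space_at N x" "n - (p + q) \<in> space_at N x"
        using amb.subspace_add[OF is_rep_space(1)[OF rep] pq(1,3)]
          amb.subspace_diff[OF is_rep_space(1)[OF rep] n] by blast+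
      have "?h n = ?h (n - (p + q)) + ?h (p + q)" using h_add[OF mem(2,1)] by simp
      then show ?thesis using ab(3) pq h_add by simp
    qed
    moreover have "n - (p + q) \<in> space_at N x"
      using amb.subspace_diff[OF is_rep_space(1)[OF rep] n amb.subspace_add[OF is_rep_space(1)[OF rep] pq(1,3)]] .
    ultimately have "n - (p + q) = 0" using inj by blast
    then have "n = p + q" by simp
    moreover have "p \<in> pull_subrep A x" "q \<in> pull_subrep B x" using pq ab by (simp_all add: pull_subrep_def)
    ultimately show ?thesis by blast
  qed
  moreover have "a + b \<in> space_at N x" if "a \<in> pull_subrep A x" "b \<in> pull_subrep B x" for a b
    using that amb.subspace_add[OF is_rep_space(1)[OF rep]] by (simp add: pull_subrep_def)
  ultimately have sum: "space_at N x = {a + b | a b. a \<in> pull_subrep A x \<and> b \<in> pull_subrep B x}"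
    by blast
  show ?thesis
    unfolding internal_direct_sum_def
  proof
    fix z
    show "pull_subrep A z \<inter> pull_subrep B z = {0} \<and>
        space_at N z = {a + b | a b. a \<in> pull_subrep A z \<and> b \<in> pull_subrep B z}"
    proof (cases "z = x")
      case True
      show ?thesis unfolding True using inter sum by (rule conjI)
    next
      case False
      then show ?thesis using direct_sum_parts(1,2)[OF AB, of z]
        by (simp add: pull_subrep_def negative_reflection_space)
    qed
  qed
qed

text \<open>If a summand vanishes at all neighbours of \<open>x\<close>, the other summand contains everything that arrives
  at \<open>x\<close>, and this is the whole space there.\<close>

lemma pull_zero_imp_zero:
  assumes dec: "decomposition \<Lambda> A B M" and zero: "\<And>z. pull_subrep A z = {0}"
  shows "A z = {0}"
proof (cases "z = x")
  case True
  have A: "subrep \<Lambda> A M" and B: "subrep \<Lambda> B M" and AB: "internal_direct_sum A B M"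
    using dec by (simp_all add: decomposition_def)
  have "space_at M u = B u" if "u \<noteq> x" for u
    using direct_sum_parts(3)[OF AB, of u] zero[of u] that by (simp add: pull_subrep_def)
  then have "incoming \<Lambda> x (space_at M) = incoming \<Lambda> x B" by (intro incoming_cong[OF x])
  then have "space_at M x \<subseteq> B x"
    using projection_in_subrep[OF B] by (auto simp: negative_reflection_space incoming_M)
  then have "A x \<subseteq> A x \<inter> B x" using subrep_space(2)[OF A, of x] by blast
  then have "A x \<subseteq> {0}" using direct_sum_parts(1)[OF AB, of x] by simp
  then show ?thesis using amb.subspace_0[OF subrep_space(1)[OF A, of x]] True by blast
next
  case False
  then show ?thesis using zero[of z] by (simp add: pull_subrep_def)
qed

lemma negative_reflection_indecomposable:
  assumes ind: "indecomposable (reverse_at x \<Lambda>) N"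
  shows "indecomposable \<Lambda> M"
proof -
  have "\<not> zero_rep M"
  proof
    assume zero: "zero_rep M"
    have z: "space_at N u = {0}" if "u \<noteq> x" for u
      using zero that negative_reflection_space[of u] by (simp add: zero_rep_def)
    then have "incoming \<Lambda> x (space_at N) \<subseteq> {0}" by (rule incoming_trivial[OF x])
    then have "outgoing_vector \<Lambda> x N n = 0" if "n \<in> space_at N x" for n
      using outgoing_linear that by (auto simp: linear_map_between_def)
    then have "space_at N x = {0}" using inj is_rep_space(3)[OF rep] by blast
    then have "zero_rep N" unfolding zero_rep_def using z by metis
    then show False using ind by (simp add: indecomposable_def)
  qed
  moreover have "(\<forall>z. A z = {0}) \<or> (\<forall>z. B z = {0})" if dec: "decomposition \<Lambda> A B M" for A B
  proof -
    have dec': "decomposition \<Lambda> B A M"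
      using dec internal_direct_sum_commute unfolding decomposition_def by blast
    have "decomposition (reverse_at x \<Lambda>) (pull_subrep A) (pull_subrep B) N"
      using dec pull_subrep_is_subrep pull_direct_sum[OF dec] by (simp add: decomposition_def)
    then have "(\<forall>z. pull_subrep A z = {0}) \<or> (\<forall>z. pull_subrep B z = {0})"
      using ind unfolding indecomposable_iff by blast
    then show ?thesis
    proof
      assume zero: "\<forall>z. pull_subrep A z = {0}"
      have "A z = {0}" for z by (rule pull_zero_imp_zero[OF dec]) (rule zero[rule_format])
      then show ?thesis by simp
    next
      assume zero: "\<forall>z. pull_subrep B z = {0}"
      have "B z = {0}" for z by (rule pull_zero_imp_zero[OF dec']) (rule zero[rule_format])
      then show ?thesis by simp
    qed
  qed
  ultimately show ?thesis unfolding indecomposable_iff using negative_reflection_is_rep by blast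
qed

end

end

text \<open>Injectivity of the map from the source excludes only the simple module there, and a cokernel always
  exists inside the ambient space.\<close>

lemma exists_negative_reflection:
  fixes \<Gamma> :: "('v::finite, 'e::finite) graph" and N :: "('v, 'e, 'k::field) representation"
  assumes graph: "loopfree_graph \<Gamma>" "orientation_of \<Gamma> \<Lambda>" and x: "sink \<Lambda> x"
    and ind: "indecomposable (reverse_at x \<Lambda>) N" and not_simple: "dim_vector N \<noteq> axis x 1"
  shows "\<exists>M :: ('v, 'e, 'k) representation. indecomposable \<Lambda> M \<and>
    dim_vector M = simple_reflection \<Gamma> x (dim_vector N)"
proof -
  have rep: "is_rep (reverse_at x \<Lambda>) N" using ind by (simp add: indecomposable_def)
  note out = outgoing_linear[OF x rep]
  have "amb.subspace (outgoing_vector \<Lambda> x N ` space_at N x)"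
    by (rule linear_map_image_subspace[OF is_rep_space(1)[OF rep] out])
  moreover have "outgoing_vector \<Lambda> x N ` space_at N x \<subseteq> incoming \<Lambda> x (space_at N)"
    using out by (auto simp: linear_map_between_def)
  ultimately obtain \<pi> where \<pi>: "amb_linear \<pi>" "\<And>w. w \<in> incoming \<Lambda> x (space_at N) \<Longrightarrow>
      \<pi> w = 0 \<longleftrightarrow> w \<in> outgoing_vector \<Lambda> x N ` space_at N x"
    using linear_map_with_kernel[OF _ incoming_N_subspace[OF x rep]] by blast
  have inj: "n = 0" if "n \<in> space_at N x" "outgoing_vector \<Lambda> x N n = 0" for n
    using outgoing_injective[OF x rep ind edge_ends[OF graph] not_simple that] .
  show ?thesis
    using negative_reflection_indecomposable[OF x rep \<pi> inj ind] negative_reflection_dim_vector[OF x rep \<pi> inj graph] by blast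
qed

section \<open>Iterated reflections\<close>

lemma weyl_word_append: "weyl_word \<Gamma> (S @ T) v = weyl_word \<Gamma> T (weyl_word \<Gamma> S v)"
  by (simp add: weyl_word_def)

lemma reflect_along_append:
  "reflect_along \<Lambda> (S @ T) M = reflect_along (reverse_along S \<Lambda>) T (reflect_along \<Lambda> S M)"
  by (induction S arbitrary: \<Lambda> M) simp_all

lemma dim_vector_nonneg: "0 \<le> dim_vector M"
  by (simp add: dim_vector_def less_eq_vec_def)

text \<open>The theorem of Bernstein, Gelfand and Ponomarev on a positive reflection functor.\<close>

lemma sink_reflection_dichotomy:
  fixes \<Gamma> :: "('v::finite, 'e::finite) graph" and M :: "('v, 'e, 'k::field) representation"
  assumes graph: "loopfree_graph \<Gamma>" "orientation_of \<Gamma> \<Lambda>" and x: "sink \<Lambda> x" and ind: "indecomposable \<Lambda> M"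
  shows "dim_vector M = axis x 1 \<and> zero_rep (reflect_rep \<Lambda> x M) \<or>
    indecomposable (reverse_at x \<Lambda>) (reflect_rep \<Lambda> x M) \<and>
    dim_vector (reflect_rep \<Lambda> x M) = simple_reflection \<Gamma> x (dim_vector M)"
proof (cases "dim_vector M = axis x 1")
  case True
  have rep: "is_rep \<Lambda> M" using ind by (simp add: indecomposable_def)
  have "space_at M z = {0}" if "z \<noteq> x" for z
  proof -
    have "dim_vector M $ z = 0" using True that by (simp add: axis_def)
    then have "amb.dim (space_at M z) = 0" by (simp add: dim_vector_def)
    then show ?thesis by (rule dim_zero_imp_zero[OF is_rep_space(1,2)[OF rep]])
  qed
  then have "zero_rep (reflect_rep \<Lambda> x M)" by (rule reflect_simple_zero[OF x rep])
  then show ?thesis using True by simp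
next
  case False
  have rep: "is_rep \<Lambda> M" using ind by (simp add: indecomposable_def)
  have surj: "incoming_sum \<Lambda> x M ` incoming \<Lambda> x (space_at M) = space_at M x"
    by (rule incoming_sum_surjective[OF ind edge_ends[OF graph] x False])
  show ?thesis
    using reflect_indecomposable[OF ind x surj] dim_vector_reflect[OF graph x rep surj] by blast
qed

lemma reflect_zero_rep:
  fixes M :: "('v::finite, 'e::finite, 'k::field) representation"
  assumes "sink \<Lambda> x" "is_rep \<Lambda> M" "zero_rep M"
  shows "zero_rep (reflect_rep \<Lambda> x M)"
  using assms by (intro reflect_simple_zero) (auto simp: zero_rep_def)

lemma annihilates_append:
  fixes M :: "('v::finite, 'e::finite, 'k::field) representation"
  assumes "admissible \<Lambda> (S @ T)" "is_rep \<Lambda> M" "annihilates \<Lambda> S M"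
  shows "annihilates \<Lambda> (S @ T) M"
proof -
  have rep: "is_rep (reverse_along S \<Lambda>) (reflect_along \<Lambda> S M)"
    if "admissible \<Lambda> S" "is_rep \<Lambda> M" for \<Lambda> and M :: "('v, 'e, 'k) representation"
    using that by (induction S arbitrary: \<Lambda> M) (simp_all add: is_rep_reflect_rep)
  have zero: "zero_rep (reflect_along \<Lambda> T M)" if "admissible \<Lambda> T" "is_rep \<Lambda> M" "zero_rep M"
    for \<Lambda> and M :: "('v, 'e, 'k) representation"
    using that by (induction T arbitrary: \<Lambda> M) (simp_all add: is_rep_reflect_rep reflect_zero_rep)
  show ?thesis
    using assms rep zero by (simp add: annihilates_def reflect_along_append admissible_append)
qed

text \<open>A module that survives the whole sequence has never been the simple one at the sink to be reflected,
  so each step acts on its dimension vector by a simple reflection.\<close>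

lemma reflect_along_indecomposable:
  fixes \<Gamma> :: "('v::finite, 'e::finite) graph" and M :: "('v, 'e, 'k::field) representation"
  assumes "loopfree_graph \<Gamma>" "orientation_of \<Gamma> \<Lambda>" "admissible \<Lambda> T" "indecomposable \<Lambda> M"
    and "\<not> annihilates \<Lambda> T M"
  shows "indecomposable (reverse_along T \<Lambda>) (reflect_along \<Lambda> T M) \<and>
    dim_vector (reflect_along \<Lambda> T M) = weyl_word \<Gamma> T (dim_vector M)"
  using assms
proof (induction T arbitrary: \<Lambda> M)
  case Nil
  then show ?case by (simp add: weyl_word_def)
next
  case (Cons x T)
  have x: "sink \<Lambda> x" "admissible (reverse_at x \<Lambda>) T" using Cons.prems by auto
  have rep: "is_rep (reverse_at x \<Lambda>) (reflect_rep \<Lambda> x M)"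
    using Cons.prems x by (simp add: indecomposable_def is_rep_reflect_rep)
  have "\<not> zero_rep (reflect_rep \<Lambda> x M)"
  proof
    assume "zero_rep (reflect_rep \<Lambda> x M)"
    then have "annihilates (reverse_at x \<Lambda>) ([] @ T) (reflect_rep \<Lambda> x M)"
      using x rep by (intro annihilates_append) (simp_all add: annihilates_def)
    then show False using Cons.prems by (simp add: annihilates_def)
  qed
  then have *: "indecomposable (reverse_at x \<Lambda>) (reflect_rep \<Lambda> x M)"
    "dim_vector (reflect_rep \<Lambda> x M) = simple_reflection \<Gamma> x (dim_vector M)"
    using sink_reflection_dichotomy[OF Cons.prems(1,2) x(1) Cons.prems(4)] by auto
  have "\<not> annihilates (reverse_at x \<Lambda>) T (reflect_rep \<Lambda> x M)"
    using Cons.prems by (simp add: annihilates_def)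
  from Cons.IH[OF Cons.prems(1) orientation_of_reverse_at[OF Cons.prems(2)] x(2) *(1) this]
  show ?case by (simp add: * weyl_word_def)
qed

text \<open>A module that is annihilated in this step was the simple one at the sink just before. This determines
  the dimension vector of the original module as a root.\<close>

lemma dim_vector_when_annihilated:
  fixes \<Gamma> :: "('v::finite, 'e::finite) graph" and M :: "('v, 'e, 'k::field) representation"
  assumes graph: "loopfree_graph \<Gamma>" "orientation_of \<Gamma> \<Lambda>" and adm: "admissible \<Lambda> (T @ [x])"
    and ind: "indecomposable \<Lambda> M" and T: "\<not> annihilates \<Lambda> T M" and Tx: "annihilates \<Lambda> (T @ [x]) M"
  shows "weyl_word \<Gamma> T (dim_vector M) = axis x 1"
proof -
  let ?\<Lambda> = "reverse_along T \<Lambda>" and ?N = "reflect_along \<Lambda> T M"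
  have T_adm: "admissible \<Lambda> T" "sink ?\<Lambda> x" using adm by (auto simp: admissible_append)
  have *: "indecomposable ?\<Lambda> ?N" "dim_vector ?N = weyl_word \<Gamma> T (dim_vector M)"
    using reflect_along_indecomposable[OF graph T_adm(1) ind T] by auto
  have zero: "zero_rep (reflect_rep ?\<Lambda> x ?N)" using Tx by (simp add: annihilates_def reflect_along_append)
  then have "\<not> indecomposable (reverse_at x ?\<Lambda>) (reflect_rep ?\<Lambda> x ?N)"
    by (simp add: indecomposable_def)
  then have "dim_vector ?N = axis x 1"
    using sink_reflection_dichotomy[OF graph(1) orientation_of_reverse_along[OF graph(2)] T_adm(2) *(1)] by blast
  then show ?thesis using *(2) by simp
qed

definition simple_rep :: "'v \<Rightarrow> ('v, 'e, 'k::field) representation" where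
  "simple_rep x = \<lparr> space_at = (\<lambda>z. if z = x then amb.span {\<lambda>l. 1} else {0}), map_at = (\<lambda>e u. 0) \<rparr>"

lemma simple_rep_indecomposable:
  "indecomposable \<Lambda> (simple_rep x :: ('v, 'e, 'k::field) representation)"
proof -
  let ?one = "(\<lambda>l. 1) :: ('e, 'k) ambient"
  let ?L = "simple_rep x :: ('v, 'e, 'k) representation"
  have one: "?one \<noteq> 0" by (simp add: fun_eq_iff)
  have Lx: "space_at ?L x = amb.span {?one}" by (simp add: simple_rep_def)
  have "\<exists>B. finite B \<and> space_at ?L z \<subseteq> amb.span B" for z
    by (rule exI[of _ "{?one}"]) (simp add: simple_rep_def amb.span_zero)
  then have rep: "is_rep \<Lambda> ?L"
    by (auto simp: is_rep_def linear_map_between_def simple_rep_def amb.span_zero)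
  have "?one \<in> space_at ?L x" by (simp add: Lx amb.span_base)
  then have "\<not> zero_rep ?L" using one unfolding zero_rep_def by (metis singletonD)
  moreover have "(\<forall>z. A z = {0}) \<or> (\<forall>z. B z = {0})" if dec: "decomposition \<Lambda> A B ?L" for A B
  proof -
    have A: "subrep \<Lambda> A ?L" and B: "subrep \<Lambda> B ?L" and AB: "internal_direct_sum A B ?L"
      using dec by (simp_all add: decomposition_def)
    have full: "D x = space_at ?L x" if D: "subrep \<Lambda> D ?L" "D x \<noteq> {0}" for D
    proof -
      have "0 \<in> D x" using amb.subspace_0[OF subrep_space(1)[OF D(1)]] .
      then obtain v where v: "v \<in> D x" "v \<noteq> 0" using D(2) by blast
      then obtain c where c: "v = ascale c ?one"
        using subrep_space(2)[OF D(1), of x] Lx by (auto simp: amb.span_singleton)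
      then have "c \<noteq> 0" using v(2) by auto
      then have "ascale (1 / c) v = ?one" by (simp add: c ascale_def)
      then have "?one \<in> D x" using amb.subspace_scale[OF subrep_space(1)[OF D(1)] v(1)] by metis
      then have "amb.span {?one} \<subseteq> D x" by (intro amb.span_minimal subrep_space(1)[OF D(1)]) simp
      then show ?thesis using subrep_space(2)[OF D(1), of x] Lx by blast
    qed
    have off: "D z = {0}" if D: "subrep \<Lambda> D ?L" and z: "z \<noteq> x" for D z
    proof -
      have "D z \<subseteq> {0}" using subrep_space(2)[OF D, of z] z by (simp add: simple_rep_def)
      then show ?thesis using amb.subspace_0[OF subrep_space(1)[OF D, of z]] by blast
    qed
    have "A x = {0} \<or> B x = {0}"
    proof (rule ccontr)
      assume "\<not> ?thesis"
      then have "A x = space_at ?L x" "B x = space_at ?L x" using full A B by blast+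
      then have "?one \<in> A x \<inter> B x" using \<open>?one \<in> space_at ?L x\<close> by simp
      then show False using direct_sum_parts(1)[OF AB, of x] one by blast
    qed
    then show ?thesis using off[OF A] off[OF B] by metis
  qed
  ultimately show ?thesis unfolding indecomposable_iff using rep by blast
qed

lemma dim_vector_simple_rep:
  "dim_vector (simple_rep x :: ('v::finite, 'e, 'k::field) representation) = axis x 1"
proof -
  have "((\<lambda>l. 1) :: ('e, 'k) ambient) \<noteq> 0" by (simp add: fun_eq_iff)
  from dim_nonzero_line[OF this] show ?thesis
    by (simp add: dim_vector_def simple_rep_def vec_eq_iff axis_def dim_zero_space)
qed

text \<open>Start from the simple module at \<open>z\<close> and reflect backwards along the word. The negative reflection at
  \<open>x\<close> is obstructed only by the simple module at \<open>x\<close>, and that one would give the next vector a negative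
  coordinate.\<close>

lemma exists_indecomposable_of_root:
  fixes \<Gamma> :: "('v::finite, 'e::finite) graph"
  assumes "loopfree_graph \<Gamma>" "orientation_of \<Gamma> \<Lambda>" "admissible \<Lambda> T"
    and "\<And>A B. T = A @ B \<Longrightarrow> 0 \<le> reflection_product \<Gamma> B (axis z 1)"
  shows "\<exists>M :: ('v, 'e, 'k::field) representation. indecomposable \<Lambda> M \<and>
    dim_vector M = reflection_product \<Gamma> T (axis z 1)"
  using assms
proof (induction T arbitrary: \<Lambda>)
  case Nil
  show ?case
    by (rule exI[of _ "simple_rep z"]) (simp add: simple_rep_indecomposable dim_vector_simple_rep)
next
  case (Cons x T)
  have "0 \<le> reflection_product \<Gamma> B (axis z 1)" if "T = A @ B" for A B
    using Cons.prems(4)[of "x # A" B] that by simp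
  then have "\<exists>N :: ('v, 'e, 'k) representation. indecomposable (reverse_at x \<Lambda>) N \<and>
      dim_vector N = reflection_product \<Gamma> T (axis z 1)"
    using Cons.prems(3) by (intro Cons.IH Cons.prems(1) orientation_of_reverse_at[OF Cons.prems(2)]) auto
  then obtain N :: "('v, 'e, 'k) representation" where N: "indecomposable (reverse_at x \<Lambda>) N"
      "dim_vector N = reflection_product \<Gamma> T (axis z 1)"
    by blast
  have "dim_vector N \<noteq> axis x 1"
  proof
    assume "dim_vector N = axis x 1"
    then have "reflection_product \<Gamma> (x # T) (axis z 1) = - axis x 1"
      by (simp add: N(2)[symmetric] simple_reflection_own_root)
    then have "0 \<le> (- axis x 1 :: int ^ 'v)" using Cons.prems(4)[of "[]" "x # T"] by simp
    then have "0 \<le> (- axis x 1 :: int ^ 'v) $ x" unfolding less_eq_vec_def by (metis zero_index)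
    then show False by simp
  qed
  then show ?case
    using exists_negative_reflection[OF Cons.prems(1,2) _ N(1)] Cons.prems(3) N(2) by auto
qed

section \<open>The characterization\<close>

lemma principal_seq_nonempty: "principal_seq \<Gamma> \<Lambda> S \<Longrightarrow> S \<noteq> [] \<and> admissible \<Lambda> S"
  by (simp add: principal_seq_def)

text \<open>Each proper prefix leaves a nonzero module, and the last letter \<open>z\<close> kills it, so before the last step
  the module has dimension vector \<open>e\<^sub>z\<close>. The dimension vectors along the way are then precisely the roots
  that belong to the last letter, and dimension vectors are nonnegative.\<close>

lemma reduced_if_shortest_annihilating:
  fixes \<Gamma> :: "('v::finite, 'e::finite) graph" and M :: "('v, 'e, 'k::field) representation"
  assumes graph: "loopfree_graph \<Gamma>" "connected_graph \<Gamma>" "CARD('v) > 1" "orientation_of \<Gamma> \<Lambda>"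
    and princ: "principal_seq \<Gamma> \<Lambda> S" and ind: "indecomposable \<Lambda> M"
    and shortest: "shortest_annihilating \<Gamma> \<Lambda> M S"
  shows "reduced_word \<Gamma> S"
proof -
  have ann: "annihilates \<Lambda> S M" and adm: "admissible \<Lambda> S"
    and minimal: "\<And>S'. subsequence \<Gamma> \<Lambda> S' S \<Longrightarrow> \<not> seq_equiv \<Gamma> \<Lambda> S' S \<Longrightarrow> \<not> annihilates \<Lambda> S' M"
    using shortest unfolding shortest_annihilating_def by blast+
  have prefix: "\<not> annihilates \<Lambda> A M" if S: "S = A @ B" and B: "B \<noteq> []" for A B
  proof (rule minimal)
    show "subsequence \<Gamma> \<Lambda> A S"
      unfolding subsequence_def using adm seq_equiv_refl[OF adm, of \<Gamma>] S by (auto simp: admissible_append)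
    show "\<not> seq_equiv \<Gamma> \<Lambda> A S" using seq_equiv_length[of \<Gamma> \<Lambda> A S] S B by auto
  qed
  have "0 < reflection_product \<Gamma> B (axis z 1)" if S: "S = A @ B @ [z]" for A B z
  proof -
    have last: "weyl_word \<Gamma> (A @ B) (dim_vector M) = axis z 1"
      by (rule dim_vector_when_annihilated[OF graph(1,4) _ ind])
        (use adm ann prefix[of "A @ B" "[z]"] S in auto)
    have "weyl_word \<Gamma> A (dim_vector M) = dim_vector (reflect_along \<Lambda> A M)"
      using reflect_along_indecomposable[OF graph(1,4) _ ind, of A] prefix[of A "B @ [z]"] adm S
      by (simp add: admissible_append)
    moreover have "reflection_product \<Gamma> B (axis z 1) = weyl_word \<Gamma> A (dim_vector M)"
      using last by (simp add: weyl_word_append weyl_word_eq_product[of \<Gamma> B] reflection_product_inverse_rev flip: last)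
    ultimately show ?thesis
      unfolding pos_iff_nonneg_root using dim_vector_nonneg[of "reflect_along \<Lambda> A M"] by simp
  qed
  then show ?thesis using reduced_iff_last_roots_pos[OF graph princ] by blast
qed

text \<open>Take an indecomposable module whose dimension vector is the root obtained from the last letter \<open>z\<close>
  by the whole sequence. The Weyl group element of \<open>S\<close> sends it to \<open>- e\<^sub>z\<close>, so \<open>S\<close> annihilates the module.

  If a proper subsequence did so as well, the module would already be the simple one at some \<open>y\<close> before
  some letter \<open>y\<close> of a sequence equivalent to \<open>S\<close>, and this letter would not be the last one. The last
  letter of the equivalent sequence is again \<open>z\<close>, and comparing dimension vectors makes the root of \<open>y\<close>
  in the part between \<open>y\<close> and \<open>z\<close> equal to \<open>- e\<^sub>z\<close>. But the word
  formed by \<open>y\<close> and that part is reduced.\<close>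

lemma shortest_annihilating_if_reduced:
  fixes \<Gamma> :: "('v::finite, 'e::finite) graph"
  assumes graph: "loopfree_graph \<Gamma>" "connected_graph \<Gamma>" "CARD('v) > 1" "orientation_of \<Gamma> \<Lambda>"
    and princ: "principal_seq \<Gamma> \<Lambda> S" and reduced: "reduced_word \<Gamma> S"
  shows "\<exists>M :: ('v, 'e, 'k::field) representation.
    indecomposable \<Lambda> M \<and> shortest_annihilating \<Gamma> \<Lambda> M S"
proof -
  have adm: "admissible \<Lambda> S" using principal_seq_nonempty[OF princ] by simp
  obtain T z where S: "S = T @ [z]" using principal_seq_nonempty[OF princ] by (metis rev_exhaust)
  have "0 \<le> reflection_product \<Gamma> B (axis z 1)" if "T = A @ B" for A B
    using reduced_iff_last_roots_pos[OF graph princ] reduced S that by (auto intro: order_less_imp_le)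
  then obtain M :: "('v, 'e, 'k) representation" where ind: "indecomposable \<Lambda> M"
      and dim: "dim_vector M = reflection_product \<Gamma> T (axis z 1)"
    using exists_indecomposable_of_root[OF graph(1,4), of T z] adm S by (auto simp: admissible_append)
  have rep: "is_rep \<Lambda> M" using ind by (simp add: indecomposable_def)
  have image: "weyl_word \<Gamma> S (dim_vector M) = - axis z 1"
    by (simp add: S dim weyl_word_eq_product reflection_product_rev_inverse simple_reflection_own_root)
  have "annihilates \<Lambda> S M"
  proof (rule ccontr)
    assume "\<not> ?thesis"
    then have "dim_vector (reflect_along \<Lambda> S M) = - axis z 1"
      using reflect_along_indecomposable[OF graph(1,4) adm ind] image by simp
    then have "0 \<le> (- axis z 1 :: int ^ 'v) $ z"
      using dim_vector_nonneg[of "reflect_along \<Lambda> S M"] unfolding less_eq_vec_def by (metis zero_index)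
    then show False by simp
  qed
  moreover have "\<not> annihilates \<Lambda> S' M" if sub: "subsequence \<Gamma> \<Lambda> S' S" and neq: "\<not> seq_equiv \<Gamma> \<Lambda> S' S" for S'
  proof
    assume "annihilates \<Lambda> S' M"
    obtain U where U: "seq_equiv \<Gamma> \<Lambda> S (S' @ U)" using sub by (auto simp: subsequence_def)
    have "U \<noteq> []" using neq U seq_equiv_sym by fastforce
    have adm': "admissible \<Lambda> (S' @ U)" using U by (simp add: seq_equiv_def)
    have "\<not> annihilates \<Lambda> [] M" using ind by (simp add: annihilates_def indecomposable_def)
    then have "\<exists>A y B. S' = A @ [y] @ B \<and> \<not> annihilates \<Lambda> A M \<and> annihilates \<Lambda> (A @ [y]) M"
      using \<open>annihilates \<Lambda> S' M\<close>
    proof (induction S' rule: rev_induct)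
      case (snoc y S')
      then show ?case by (cases "annihilates \<Lambda> S' M") (fastforce, blast)
    qed simp
    then obtain A y B where A: "S' = A @ [y] @ B" "\<not> annihilates \<Lambda> A M" "annihilates \<Lambda> (A @ [y]) M"
      by blast
    have "admissible \<Lambda> (A @ [y])" using adm' A(1) by (auto simp: admissible_append)
    from dim_vector_when_annihilated[OF graph(1,4) this ind A(2,3)]
    have y: "weyl_word \<Gamma> A (dim_vector M) = axis y 1" .
    \<comment> \<open>Equivalent principal sequences have the same last letter: the generator of the last support.\<close>
    have "last (S' @ U) = z" using principal_seq_seq_equiv(2)[OF graph princ U] S by simp
    then obtain C where C: "B @ U = C @ [z]"
      using \<open>U \<noteq> []\<close> by (metis append_butlast_last_id append_is_Nil_conv last_appendR)
    then have whole: "S' @ U = A @ y # C @ [z]" using A(1) by simp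
    have "reduced_word \<Gamma> (S' @ U)" using reduced_word_seq_equiv[OF U] reduced by simp
    then have "reduced_word \<Gamma> (y # C @ [z])" unfolding whole by (rule reduced_word_suffix)
    then have "reduced_word \<Gamma> (y # C)" using reduced_word_prefix[of \<Gamma> "y # C" "[z]"] by simp
    then have "reduced_word \<Gamma> (rev C @ [y])" using reduced_word_rev[of \<Gamma> "y # C"] by simp
    then have pos: "0 < weyl_word \<Gamma> C (axis y 1)" by (simp add: reduced_word_snoc weyl_word_eq_product)
    have "weyl_word \<Gamma> S (dim_vector M) = weyl_word \<Gamma> (S' @ U) (dim_vector M)"
      by (simp add: seq_equiv_invariants(2)[OF U])
    also have "\<dots> = weyl_word \<Gamma> [z] (weyl_word \<Gamma> C (weyl_word \<Gamma> [y] (axis y 1)))"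
      unfolding whole weyl_word_append y by (simp add: weyl_word_def)
    also have "\<dots> = - simple_reflection \<Gamma> z (weyl_word \<Gamma> C (axis y 1))"
      by (simp add: weyl_word_eq_product simple_reflection_own_root reflection_product_uminus simple_reflection_uminus)
    finally have "simple_reflection \<Gamma> z (weyl_word \<Gamma> C (axis y 1)) = axis z 1" using image by simp
    then have "weyl_word \<Gamma> C (axis y 1) = - axis z 1"
      by (metis simple_reflection_involution simple_reflection_own_root)
    then have "0 \<le> (- axis z 1 :: int ^ 'v) $ z"
      using pos unfolding less_vec_def less_eq_vec_def by (metis zero_index)
    then show False by simp
  qed
  ultimately have "shortest_annihilating \<Gamma> \<Lambda> M S" using adm by (simp add: shortest_annihilating_def)
  then show ?thesis using ind by blast
qed

text \<open>The statement with indices refers to suffixes of the sequence without its last letter. The index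
  \<open>i = s\<close>, which it leaves out, concerns the empty suffix, for which the root is simple.\<close>

lemma last_roots_by_index:
  "(\<forall>i. 0 < i \<and> i < length S \<longrightarrow>
      0 < foldr (simple_reflection \<Gamma>) (map (\<lambda>j. S ! (j - 1)) [i..<length S]) (axis (last S) 1)) \<longleftrightarrow>
   (\<forall>A B z. S = A @ B @ [z] \<longrightarrow> 0 < reflection_product \<Gamma> B (axis z 1))"
proof -
  have word: "map (\<lambda>j. S ! (j - 1)) [i..<length S] = drop (i - 1) (butlast S)" if "0 < i" for i
    by (rule nth_equalityI) (use that in \<open>auto simp: nth_butlast\<close>)
  show ?thesis
  proof (intro iffI allI impI)
    fix A B z
    assume all: "\<forall>i. 0 < i \<and> i < length S \<longrightarrow>
        0 < foldr (simple_reflection \<Gamma>) (map (\<lambda>j. S ! (j - 1)) [i..<length S]) (axis (last S) 1)"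
      and S: "S = A @ B @ [z]"
    show "0 < reflection_product \<Gamma> B (axis z 1)"
    proof (cases "B = []")
      case True
      then show ?thesis using pos_iff_nonneg_root[of \<Gamma> "[]" z] by (simp add: less_eq_vec_def axis_def)
    next
      case False
      then have "0 < foldr (simple_reflection \<Gamma>) (drop (Suc (length A) - 1) (butlast S)) (axis (last S) 1)"
        using all[rule_format, of "Suc (length A)"] word[of "Suc (length A)"] S by simp
      moreover have "drop (Suc (length A) - 1) (butlast S) = B" by (simp add: S butlast_append)
      ultimately show ?thesis using S by simp
    qed
  next
    fix i
    assume all: "\<forall>A B z. S = A @ B @ [z] \<longrightarrow> 0 < reflection_product \<Gamma> B (axis z 1)"
      and i: "0 < i \<and> i < length S"
    have "S = take (i - 1) (butlast S) @ drop (i - 1) (butlast S) @ [last S]"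
      using i append_butlast_last_id[of S]
      by (metis append.assoc append_take_drop_id length_greater_0_conv less_trans)
    then have "0 < reflection_product \<Gamma> (drop (i - 1) (butlast S)) (axis (last S) 1)" using all by blast
    then show "0 < foldr (simple_reflection \<Gamma>) (map (\<lambda>j. S ! (j - 1)) [i..<length S]) (axis (last S) 1)"
      using word i by simp
  qed
qed

theorem theorem4p5:
  fixes \<Gamma> :: "('v::finite, 'e::finite) graph"
    and \<Lambda> :: "('v, 'e) orientation"
    and S :: "'v list"
  assumes "loopfree_graph \<Gamma>" and "connected_graph \<Gamma>" and "CARD('v) > 1"
    and "orientation_of \<Gamma> \<Lambda>" and "acyclic_orientation \<Lambda>"
    and "principal_seq \<Gamma> \<Lambda> S"
  shows "((\<exists>M :: ('v, 'e, 'k::field) representation.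
             indecomposable \<Lambda> M \<and> preprojective \<Lambda> M \<and>
             (\<exists>S\<^sub>M. shortest_annihilating \<Gamma> \<Lambda> M S\<^sub>M \<and> seq_equiv \<Gamma> \<Lambda> S S\<^sub>M))
          \<longleftrightarrow> reduced_word \<Gamma> S)
       \<and> (reduced_word \<Gamma> S
          \<longleftrightarrow> (\<forall>i. 0 < i \<and> i < length S \<longrightarrow>
                 0 < foldr (simple_reflection \<Gamma>) (map (\<lambda>j. S ! (j - 1)) [i..<length S])
                       (axis (last S) 1)))"
proof (intro conjI)
  note graph = assms(1-4) and princ = assms(6)
  show "reduced_word \<Gamma> S \<longleftrightarrow> (\<forall>i. 0 < i \<and> i < length S \<longrightarrow>
      0 < foldr (simple_reflection \<Gamma>) (map (\<lambda>j. S ! (j - 1)) [i..<length S]) (axis (last S) 1))"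
    unfolding last_roots_by_index by (rule reduced_iff_last_roots_pos[OF graph princ])
  show "(\<exists>M :: ('v, 'e, 'k) representation. indecomposable \<Lambda> M \<and> preprojective \<Lambda> M \<and>
      (\<exists>S\<^sub>M. shortest_annihilating \<Gamma> \<Lambda> M S\<^sub>M \<and> seq_equiv \<Gamma> \<Lambda> S S\<^sub>M)) \<longleftrightarrow> reduced_word \<Gamma> S"
  proof
    assume "\<exists>M :: ('v, 'e, 'k) representation. indecomposable \<Lambda> M \<and> preprojective \<Lambda> M \<and>
      (\<exists>S\<^sub>M. shortest_annihilating \<Gamma> \<Lambda> M S\<^sub>M \<and> seq_equiv \<Gamma> \<Lambda> S S\<^sub>M)"
    then obtain M :: "('v, 'e, 'k) representation" and T where ind: "indecomposable \<Lambda> M"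
        and T: "shortest_annihilating \<Gamma> \<Lambda> M T" "seq_equiv \<Gamma> \<Lambda> S T" by blast
    have "reduced_word \<Gamma> T"
      by (rule reduced_if_shortest_annihilating[OF graph principal_seq_seq_equiv(1)[OF graph princ T(2)] ind T(1)])
    then show "reduced_word \<Gamma> S" using reduced_word_seq_equiv[OF T(2)] by simp
  next
    assume "reduced_word \<Gamma> S"
    then obtain M :: "('v, 'e, 'k) representation" where ind: "indecomposable \<Lambda> M"
        and S: "shortest_annihilating \<Gamma> \<Lambda> M S"
      using shortest_annihilating_if_reduced[OF graph princ] by blast
    have "is_rep \<Lambda> M" using ind by (simp add: indecomposable_def)
    moreover have "admissible \<Lambda> S" "annihilates \<Lambda> S M"
      using S by (simp_all add: shortest_annihilating_def)
    ultimately have "preprojective \<Lambda> M" unfolding preprojective_def by blast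
    moreover have "seq_equiv \<Gamma> \<Lambda> S S" using S by (simp add: seq_equiv_refl shortest_annihilating_def)
    ultimately show "\<exists>M :: ('v, 'e, 'k) representation. indecomposable \<Lambda> M \<and> preprojective \<Lambda> M \<and>
        (\<exists>S\<^sub>M. shortest_annihilating \<Gamma> \<Lambda> M S\<^sub>M \<and> seq_equiv \<Gamma> \<Lambda> S S\<^sub>M)"
      using ind S by blast
  qed
qed

end
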